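(* Suppose the Radon harmonic measure system $\{\omega_\cdot^{D_\lambda}\}$ on $\mathbb R^n$ ($n\ge3$) satisfies: (H1) $\{D_\lambda\}$ is the family of all bounded open sets in $\mathbb{R}^n$; (H2) every bounded Lipschitz domain $D\subseteq\mathbb{R}^n$ is regular relative to $\omega_\cdot^D$; (H3) the system is translation and scaling closed and invariant (TSCI); (H4) for every bounded open $D\subseteq\mathbb{R}^n$, $\frac{\mathrm{d}\omega^D_x}{\mathrm{d}\omega^D_y}$ is continuous for any $x,y\in D$. Let $D\subset\mathbb{R}^n$ be a bounded Lipschitz domain, starlike about the origin $O\in D$. If $\mu$ is a positive measure on $D$ and $p>1$, then the following conditions are equivalent: (i) $\mu$ is a Carleson measure in $D$, that is, there exists $M>0$ such that for all $P\in\partial D$ and all $r>0$, $$\mu(C_{P,r}\cap D)\leq M\,\omega_O^D(\Delta_{P,r});$$ (ii) $H:f\mapsto\omega_\cdot^D(f)$ is strongly $(p,p)$, that is, there exists $K>0$ such that for all $f\in L^p(\omega_O^D)$, $$\int_D|(Hf)(x)|^p\,\mathrm{d}\mu(x) \leq K\int_{\partial D}|f|^p\,\mathrm{d}\omega_O^D,$$ where $(Hf)(x)=\omega_x^D(f)$.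
   Context: Measures: a measure on a set $Y$ is a map $\omega:2^Y\to[0,\infty]$ with $\omega(\emptyset)=0$ and countable subadditivity (an outer measure); measurability is in the sense of Carathéodory; it is Borel if every Borel set is measurable. It is Radon if it is Borel regular (Borel, and every set is contained in a Borel set of the same measure) and finite on compact sets. $\nu\ll\mu$ means $\mu(A)=0\Rightarrow\nu(A)=0$ for all $A\subseteq Y$. Write $\omega(f)=\int f\,\mathrm d\omega$, $\omega(A)=\omega(\chi_A)$. Pre-harmonic measure: let $D\subset \mathbb R^n$ be open with $\partial D\neq\emptyset$. A family of Borel measures $\{\omega^D_x:2^{\partial D}\to[0,1]:x\in D\}$ on $\partial D$ is a pre-harmonic measure relative to $D$ if for every connected component $V$ of $D$: (1) $\omega_x^D(\partial V)=1$ for all $x\in V$; (2) $\omega^D_x\ll\omega^D_y$ for all $x,y\in V$. Harmonic measure: let $\mathcal F_x=\{E\Delta N: E\subseteq\partial D\text{ Borel},\ N\subseteq\partial D,\ \omega_x^D(N)=0\}$ and $\mathcal F=\bigcap_{x\in D}\mathcal F_x$. Sets in $\mathcal F$ and functions measurable w.r.t. $\mathcal F$ are called $\omega_\cdot^D$-measurable. The pre-harmonic measure restricted to $\mathcal F$ is the harmonic measure $\omega_\cdot^D$ relative to $D$. $L(\partial D;\omega_\cdot^D)$ is the set of $\omega_\cdot^D$-measurable $f$ on $\partial D$ integrable with respect to $\omega_x^D$ for every $x\in D$. $\omega_\cdot^D$ is continuous if $x\mapsto\omega_x^D(f)$ is continuous on $D$ for every $f\in L(\partial D;\omega_\cdot^D)$.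 A point $y\in\partial D$ is regular if for every $f\in L(\partial D;\omega_\cdot^D)$ continuous at $y$ and every sequence $x_n\to y$ in $D$, $\lim_n\omega_{x_n}^D(f)=f(y)$; $D$ is regular if every $y\in\partial D$ is. Convention: $\omega_y^D(f):=f(y)$ for $y\in\partial D$. Harmonic measure system: a family of continuous harmonic measures $\{\omega_\cdot^{D_\lambda}\}$ which is compatible: for any $D,\widetilde D\in\{D_\lambda\}$ with $D\cap\widetilde D\ne\emptyset$, any $f\in L(\partial D;\omega_\cdot^D)$ and $\widetilde f\in L(\partial\widetilde D;\omega_\cdot^{\widetilde D})$ such that $\omega_y^{\widetilde D}(\widetilde f)=f(y)$ for all $y\in\widetilde D\cap\partial D$ and $\omega_y^D(f)=\widetilde f(y)$ for all $y\in\partial\widetilde D\cap\overline D$, one has $\omega_x^D(f)=\omega_x^{\widetilde D}(\widetilde f)$ for all $x\in D\cap\widetilde D$. It is Radon if all the measures $\omega_x^{D_\lambda}$ are Radon. TSCI: for every map $\nu(x)=\nu_0+k(x-x_0)$ with $x_0,\nu_0\in\mathbb R^n$, $k\in\mathbb R\setminus\{0\}$, and every $D\in\{D_\lambda\}$: (1) $\nu(D)\in\{D_\lambda\}$; (2) for every $\omega_\cdot^D$-measurable $A\subseteq\partial D$, $\nu(A)$ is $\omega_\cdot^{\nu(D)}$-measurable and $\omega_{\nu(x)}^{\nu(D)}(\nu(A))=\omega_x^D(A)$ for $x\in D$. Geometry: a Lipschitz domain $D$ is starlike about $P_0$ if each ray emanating from $P_0$ intersects $\partial D$ exactly once and, for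 any $Q\in\partial D$, the local coordinate system can be taken with its $y$-axis along $QP_0$. For $P\in\partial D$, $C_{P,r}=C_{P,r,sr}$ is the open circular cylinder centered at $P$ with (small) radius $r>0$, height $sr$ and axis along the line $P_0P$ (here $P_0=O$), where the parameter $s$ depends on the Lipschitz constant $L$ of $\partial D$ and is such that one bottom (flat face) of $C_{P,r}$ is contained in $D$ and the other lies outside $D$ (for example $s=2L$). $\Delta_{P,r}:=C_{P,r}\cap\partial D$. *)

theory Defs
  imports "HOL-Analysis.Analysis"
begin

section \<open>Outer measures\<close>

text \<open>
  A measure on \<open>Y\<close> is an outer measure, given as a function on all sets of which only the values
  on subsets of \<open>Y\<close> matter; measurability is Caratheodory's, i.e. membership in
  \<open>lambda_system Y (Pow Y) \<omega>\<close>. Borel subsets of \<open>Y\<close> are those of the subspace topology.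
\<close>

definition borel_outer_measure :: "'a::topological_space set \<Rightarrow> ('a set \<Rightarrow> ennreal) \<Rightarrow> bool" where
  "borel_outer_measure Y \<omega> \<longleftrightarrow>
     outer_measure_space (Pow Y) \<omega> \<and>
     sets (restrict_space borel Y) \<subseteq> lambda_system Y (Pow Y) \<omega>"

definition radon_outer_measure :: "'a::topological_space set \<Rightarrow> ('a set \<Rightarrow> ennreal) \<Rightarrow> bool" where
  "radon_outer_measure Y \<omega> \<longleftrightarrow>
     borel_outer_measure Y \<omega> \<and>
     (\<forall>A\<subseteq>Y. \<exists>B\<in>sets (restrict_space borel Y). A \<subseteq> B \<and> \<omega> B = \<omega> A) \<and>
     (\<forall>K\<subseteq>Y. compact K \<longrightarrow> \<omega> K < \<infinity>)"

definition abs_cont_on :: "'a set \<Rightarrow> ('a set \<Rightarrow> ennreal) \<Rightarrow> ('a set \<Rightarrow> ennreal) \<Rightarrow> bool" where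
  "abs_cont_on Y \<nu> \<mu> \<longleftrightarrow> (\<forall>A\<subseteq>Y. \<mu> A = 0 \<longrightarrow> \<nu> A = 0)"

definition caratheodory_measure :: "'a set \<Rightarrow> ('a set \<Rightarrow> ennreal) \<Rightarrow> 'a measure" where
  "caratheodory_measure Y \<omega> = measure_of Y (lambda_system Y (Pow Y) \<omega>) \<omega>"

lemma
  assumes "borel_outer_measure Y \<omega>"
  shows sets_caratheodory_measure:
      "sets (caratheodory_measure Y \<omega>) = lambda_system Y (Pow Y) \<omega>"
    and emeasure_caratheodory_measure:
      "\<And>A. A \<in> lambda_system Y (Pow Y) \<omega> \<Longrightarrow> emeasure (caratheodory_measure Y \<omega>) A = \<omega> A"
proof -
  have ms: "measure_space Y (lambda_system Y (Pow Y) \<omega>) \<omega>"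
    using sigma_algebra.caratheodory_lemma[OF sigma_algebra_Pow] assms
    by (auto simp: borel_outer_measure_def)
  then interpret S: sigma_algebra Y "lambda_system Y (Pow Y) \<omega>"
    by (simp add: measure_space_def)
  show "sets (caratheodory_measure Y \<omega>) = lambda_system Y (Pow Y) \<omega>"
    unfolding caratheodory_measure_def by (rule S.sets_measure_of_eq)
  show "emeasure (caratheodory_measure Y \<omega>) A = \<omega> A" if "A \<in> lambda_system Y (Pow Y) \<omega>" for A
    unfolding caratheodory_measure_def using ms that
    by (intro emeasure_measure_of_sigma) (auto simp: measure_space_def)
qed

section \<open>Harmonic measures\<close>

definition pre_harmonic_measure ::
    "'a::euclidean_space set \<Rightarrow> ('a \<Rightarrow> 'a set \<Rightarrow> ennreal) \<Rightarrow> bool" where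
  "pre_harmonic_measure D \<omega> \<longleftrightarrow>
     open D \<and> frontier D \<noteq> {} \<and>
     (\<forall>x\<in>D. borel_outer_measure (frontier D) (\<omega> x) \<and> (\<forall>A\<subseteq>frontier D. \<omega> x A \<le> 1)) \<and>
     (\<forall>V\<in>components D.
        (\<forall>x\<in>V. \<omega> x (frontier V) = 1) \<and>
        (\<forall>x\<in>V. \<forall>y\<in>V. abs_cont_on (frontier D) (\<omega> x) (\<omega> y)))"

definition hm_sets_at :: "'a::euclidean_space set \<Rightarrow> ('a set \<Rightarrow> ennreal) \<Rightarrow> 'a set set" where
  "hm_sets_at D \<omega>x =
     {sym_diff E N | E N.
        E \<in> sets (restrict_space borel (frontier D)) \<and> N \<subseteq> frontier D \<and> \<omega>x N = 0}"

definition hm_sets ::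
    "'a::euclidean_space set \<Rightarrow> ('a \<Rightarrow> 'a set \<Rightarrow> ennreal) \<Rightarrow> 'a set set" where
  "hm_sets D \<omega> = (\<Inter>x\<in>D. hm_sets_at D (\<omega> x))"

definition hm_measure ::
    "'a::euclidean_space set \<Rightarrow> ('a \<Rightarrow> 'a set \<Rightarrow> ennreal) \<Rightarrow> 'a \<Rightarrow> 'a measure" where
  "hm_measure D \<omega> x = measure_of (frontier D) (hm_sets D \<omega>) (\<omega> x)"

text \<open>
  By the following two lemmas \<open>hm_sets D \<omega>\<close> is a sigma-algebra and \<open>hm_measure D \<omega> x\<close> is
  the restriction of \<open>\<omega> x\<close> to it, so \<open>measure_of\<close> does not fall back to its default value.
\<close>

lemma
  assumes "borel_outer_measure (frontier D) w"
  shows sigma_algebra_hm_sets_at: "sigma_algebra (frontier D) (hm_sets_at D w)"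
    and hm_sets_at_subset: "hm_sets_at D w \<subseteq> lambda_system (frontier D) (Pow (frontier D)) w"
proof -
  let ?Y = "frontier D" let ?L = "lambda_system ?Y (Pow ?Y) w"
  let ?B = "sets (restrict_space borel ?Y)"
  interpret P: sigma_algebra ?Y "Pow ?Y" by (rule sigma_algebra_Pow)
  have oms: "outer_measure_space (Pow ?Y) w" and BL: "?B \<subseteq> ?L"
    using assms by (auto simp: borel_outer_measure_def)
  then have pos: "positive (Pow ?Y) w" and inc: "increasing (Pow ?Y) w"
    and csa: "countably_subadditive (Pow ?Y) w"
    by (auto simp: outer_measure_space_def)
  have mono: "w A \<le> w B" if "A \<subseteq> B" "B \<subseteq> ?Y" for A B
    using inc that by (auto simp: increasing_def)
  have "measure_space ?Y ?L w" by (rule P.caratheodory_lemma[OF oms])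
  then interpret L: sigma_algebra ?Y ?L by (simp add: measure_space_def)
  have null_L: "N \<in> ?L" if "N \<subseteq> ?Y" "w N = 0" for N
  proof -
    have "w (N \<inter> x) + w ((?Y - N) \<inter> x) = w x" if x: "x \<subseteq> ?Y" for x
    proof (rule antisym)
      have "w (N \<inter> x) = 0" using mono[of "N \<inter> x" N] \<open>N \<subseteq> ?Y\<close> \<open>w N = 0\<close> by auto
      then show "w (N \<inter> x) + w ((?Y - N) \<inter> x) \<le> w x" using x by (auto intro!: mono)
      have "w x = w ((N \<inter> x) \<union> ((?Y - N) \<inter> x))" using x by (auto intro!: arg_cong[of _ _ w])
      also have "\<dots> \<le> w (N \<inter> x) + w ((?Y - N) \<inter> x)"
        using x by (intro subadditiveD[OF P.countably_subadditive_subadditive[OF pos csa]]) auto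
      finally show "w x \<le> w (N \<inter> x) + w ((?Y - N) \<inter> x)" .
    qed
    then show ?thesis using that by (auto simp: lambda_system_def)
  qed
  show "hm_sets_at D w \<subseteq> ?L"
    unfolding hm_sets_at_def using BL null_L by (auto intro!: L.Un L.Diff)
  interpret B: sigma_algebra ?Y ?B
    by (metis sets.sigma_algebra_axioms space_restrict_space2 space_restrict_space space_borel Int_UNIV_right)
  have char: "A \<in> hm_sets_at D w \<longleftrightarrow> A \<subseteq> ?Y \<and> (\<exists>E\<in>?B. w (sym_diff A E) = 0)" for A
  proof
    assume "A \<in> hm_sets_at D w"
    then obtain E N where *: "A = sym_diff E N" "E \<in> ?B" "N \<subseteq> ?Y" "w N = 0"
      unfolding hm_sets_at_def by auto
    have "sym_diff A E = N" using * by auto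
    moreover have "A \<subseteq> ?Y" using * B.sets_into_space by blast
    ultimately show "A \<subseteq> ?Y \<and> (\<exists>E\<in>?B. w (sym_diff A E) = 0)" using *(2,4) by blast
  next
    assume "A \<subseteq> ?Y \<and> (\<exists>E\<in>?B. w (sym_diff A E) = 0)"
    then obtain E where E: "A \<subseteq> ?Y" "E \<in> ?B" "w (sym_diff A E) = 0" by auto
    have "A = sym_diff E (sym_diff A E)" by auto
    moreover have "sym_diff A E \<subseteq> ?Y" using E B.sets_into_space by blast
    ultimately show "A \<in> hm_sets_at D w" unfolding hm_sets_at_def using E by blast
  qed
  show "sigma_algebra ?Y (hm_sets_at D w)"
    unfolding sigma_algebra_iff2
  proof (intro conjI ballI allI impI)
    show "hm_sets_at D w \<subseteq> Pow ?Y" using char by auto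
    show "{} \<in> hm_sets_at D w" using pos by (auto simp: char positive_def intro!: bexI[of _ "{}"])
    fix A assume "A \<in> hm_sets_at D w"
    then obtain E where E: "A \<subseteq> ?Y" "E \<in> ?B" "w (sym_diff A E) = 0" by (auto simp: char)
    moreover have "sym_diff (?Y - A) (?Y - E) = sym_diff A E"
      using E(1) B.sets_into_space[OF E(2)] by auto
    ultimately show "?Y - A \<in> hm_sets_at D w" unfolding char by (metis B.compl_sets Diff_subset)
  next
    fix A :: "nat \<Rightarrow> 'a set" assume A: "range A \<subseteq> hm_sets_at D w"
    then have "\<forall>i. A i \<subseteq> ?Y \<and> (\<exists>E\<in>?B. w (sym_diff (A i) E) = 0)" using char by blast
    then obtain E where E: "\<And>i. A i \<subseteq> ?Y" "\<And>i. E i \<in> ?B" "\<And>i. w (sym_diff (A i) (E i)) = 0"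
      by metis
    have EY: "\<And>i. E i \<subseteq> ?Y" using E(2) B.sets_into_space by blast
    let ?N = "\<lambda>i. sym_diff (A i) (E i)"
    have NY: "\<And>i. ?N i \<subseteq> ?Y" using E(1) EY by blast
    have sub: "disjointed ?N i \<subseteq> ?N i" for i by (rule disjointed_subset)
    have le0: "w (disjointed ?N i) = 0" for i
      using mono[OF sub NY, of i] E(3)[of i] by simp
    have "w (\<Union>i. disjointed ?N i) \<le> (\<Sum>i. w (disjointed ?N i))"
    proof (rule csa[unfolded countably_subadditive_def, rule_format])
      show "range (disjointed ?N) \<subseteq> Pow ?Y" using sub NY by blast
      show "(\<Union>i. disjointed ?N i) \<in> Pow ?Y" using sub NY by blast
    qed (rule disjoint_family_disjointed)
    then have "w (\<Union>i. ?N i) = 0" by (simp add: le0 UN_disjointed_eq)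
    moreover have "w (sym_diff (\<Union>i. A i) (\<Union>i. E i)) \<le> w (\<Union>i. ?N i)"
      by (rule mono) (use NY in blast)+
    ultimately show "(\<Union>i. A i) \<in> hm_sets_at D w"
      unfolding char using E(1,2) by (auto intro!: bexI[of _ "\<Union>i. E i"])
  qed
qed

lemma
  assumes "pre_harmonic_measure D w" "x \<in> D"
  shows sets_hm_measure: "sets (hm_measure D w x) = hm_sets D w"
    and emeasure_hm_measure: "\<And>A. A \<in> hm_sets D w \<Longrightarrow> emeasure (hm_measure D w x) A = w x A"
proof -
  let ?Y = "frontier D" let ?L = "lambda_system ?Y (Pow ?Y) (w x)"
  have b: "\<And>y. y \<in> D \<Longrightarrow> borel_outer_measure ?Y (w y)"
    using assms(1) by (auto simp: pre_harmonic_measure_def)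
  have sa: "sigma_algebra ?Y (hm_sets D w)"
    unfolding sigma_algebra_iff2
    using sigma_algebra_hm_sets_at[OF b] assms(2)
    unfolding sigma_algebra_iff2 hm_sets_def by (auto simp: subset_iff) 
  then interpret S: sigma_algebra ?Y "hm_sets D w" .
  have ms: "measure_space ?Y ?L (w x)"
    using sigma_algebra.caratheodory_lemma[OF sigma_algebra_Pow] b[OF assms(2)]
    by (auto simp: borel_outer_measure_def)
  have "hm_sets D w \<subseteq> ?L" using hm_sets_at_subset[OF b[OF assms(2)]] assms(2)
    unfolding hm_sets_def by blast
  then have ms': "positive (hm_sets D w) (w x)" "countably_additive (hm_sets D w) (w x)"
    using ms unfolding measure_space_def positive_def countably_additive_def
    by (simp, meson subsetD subset_trans)
  show "sets (hm_measure D w x) = hm_sets D w"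
    unfolding hm_measure_def by (rule S.sets_measure_of_eq)
  show "emeasure (hm_measure D w x) A = w x A" if "A \<in> hm_sets D w" for A
    by (rule emeasure_measure_of_sigma[OF sa ms' that, folded hm_measure_def])
qed
text \<open>
  Functions on the boundary are functions on the whole space of which only the values on
  \<open>frontier D\<close> matter.
\<close>

definition hm_integrable ::
    "'a::euclidean_space set \<Rightarrow> ('a \<Rightarrow> 'a set \<Rightarrow> ennreal) \<Rightarrow> ('a \<Rightarrow> real) set" where
  "hm_integrable D \<omega> = {f. \<forall>x\<in>D. integrable (hm_measure D \<omega> x) f}"

definition hm_integral ::
    "'a::euclidean_space set \<Rightarrow> ('a \<Rightarrow> 'a set \<Rightarrow> ennreal) \<Rightarrow> ('a \<Rightarrow> real) \<Rightarrow> 'a \<Rightarrow> real" where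
  "hm_integral D \<omega> f x = (if x \<in> frontier D then f x else \<integral>z. f z \<partial>hm_measure D \<omega> x)"

definition continuous_harmonic_measure ::
    "'a::euclidean_space set \<Rightarrow> ('a \<Rightarrow> 'a set \<Rightarrow> ennreal) \<Rightarrow> bool" where
  "continuous_harmonic_measure D \<omega> \<longleftrightarrow>
     pre_harmonic_measure D \<omega> \<and>
     (\<forall>f\<in>hm_integrable D \<omega>. continuous_on D (hm_integral D \<omega> f))"

definition regular_point ::
    "'a::euclidean_space set \<Rightarrow> ('a \<Rightarrow> 'a set \<Rightarrow> ennreal) \<Rightarrow> 'a \<Rightarrow> bool" where
  "regular_point D \<omega> y \<longleftrightarrow>
     (\<forall>f\<in>hm_integrable D \<omega>. continuous (at y within frontier D) f \<longrightarrow>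
        (\<forall>X. (\<forall>k. X k \<in> D) \<longrightarrow> X \<longlonglongrightarrow> y \<longrightarrow> (\<lambda>k. hm_integral D \<omega> f (X k)) \<longlonglongrightarrow> f y))"

definition regular_domain ::
    "'a::euclidean_space set \<Rightarrow> ('a \<Rightarrow> 'a set \<Rightarrow> ennreal) \<Rightarrow> bool" where
  "regular_domain D \<omega> \<longleftrightarrow> (\<forall>y\<in>frontier D. regular_point D \<omega> y)"

section \<open>Harmonic measure systems\<close>

text \<open>
  A system is given by the family \<open>\<D>\<close> of its open sets and a function \<open>\<Omega>\<close> assigning to
  each of them its harmonic measure. As \<open>frontier {} = {}\<close>, the empty set never belongs to \<open>\<D>\<close>.
\<close>

definition harmonic_measure_system ::
    "'a::euclidean_space set set \<Rightarrow> ('a set \<Rightarrow> 'a \<Rightarrow> 'a set \<Rightarrow> ennreal) \<Rightarrow> bool" where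
  "harmonic_measure_system \<D> \<Omega> \<longleftrightarrow>
     (\<forall>D\<in>\<D>. continuous_harmonic_measure D (\<Omega> D)) \<and>
     (\<forall>D\<in>\<D>. \<forall>D'\<in>\<D>. D \<inter> D' \<noteq> {} \<longrightarrow>
        (\<forall>f\<in>hm_integrable D (\<Omega> D). \<forall>f'\<in>hm_integrable D' (\<Omega> D').
           (\<forall>y\<in>D' \<inter> frontier D. hm_integral D' (\<Omega> D') f' y = f y) \<longrightarrow>
           (\<forall>y\<in>frontier D' \<inter> closure D. hm_integral D (\<Omega> D) f y = f' y) \<longrightarrow>
           (\<forall>x\<in>D \<inter> D'. hm_integral D (\<Omega> D) f x = hm_integral D' (\<Omega> D') f' x)))"

definition radon_harmonic_measure_system ::
    "'a::euclidean_space set set \<Rightarrow> ('a set \<Rightarrow> 'a \<Rightarrow> 'a set \<Rightarrow> ennreal) \<Rightarrow> bool" where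
  "radon_harmonic_measure_system \<D> \<Omega> \<longleftrightarrow>
     harmonic_measure_system \<D> \<Omega> \<and>
     (\<forall>D\<in>\<D>. \<forall>x\<in>D. radon_outer_measure (frontier D) (\<Omega> D x))"

definition TSCI ::
    "'a::euclidean_space set set \<Rightarrow> ('a set \<Rightarrow> 'a \<Rightarrow> 'a set \<Rightarrow> ennreal) \<Rightarrow> bool" where
  "TSCI \<D> \<Omega> \<longleftrightarrow>
     (\<forall>x0 v0 k \<nu>. k \<noteq> 0 \<longrightarrow> \<nu> = (\<lambda>x. v0 + k *\<^sub>R (x - x0)) \<longrightarrow>
        (\<forall>D\<in>\<D>. \<nu> ` D \<in> \<D> \<and>
           (\<forall>A\<in>hm_sets D (\<Omega> D). \<nu> ` A \<in> hm_sets (\<nu> ` D) (\<Omega> (\<nu> ` D)) \<and>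
              (\<forall>x\<in>D. \<Omega> (\<nu> ` D) (\<nu> x) (\<nu> ` A) = \<Omega> D x A))))"

text \<open>
  \<open>d\<omega>\<^sub>x/d\<omega>\<^sub>y\<close> is determined only almost everywhere, so its continuity means that it has a
  (finite) continuous version. It exists if \<open>\<omega>\<^sub>x \<lless> \<omega>\<^sub>y\<close>, in particular if \<open>x\<close> and \<open>y\<close> lie
  in the same component of \<open>D\<close>; for points of different components this may fail.
\<close>

definition continuous_RN_derivs ::
    "'a::euclidean_space set \<Rightarrow> ('a \<Rightarrow> 'a set \<Rightarrow> ennreal) \<Rightarrow> bool" where
  "continuous_RN_derivs D \<omega> \<longleftrightarrow>
     (\<forall>x\<in>D. \<forall>y\<in>D. abs_cont_on (frontier D) (\<omega> x) (\<omega> y) \<longrightarrow>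
        (\<exists>g::'a \<Rightarrow> real. continuous_on (frontier D) g \<and>
           (AE z in hm_measure D \<omega> y.
              RN_deriv (hm_measure D \<omega> y) (hm_measure D \<omega> x) z = ennreal (g z))))"

section \<open>Lipschitz and starlike domains\<close>

text \<open>
  Near \<open>Q\<close>, in the coordinates \<open>Q + w + t *\<^sub>R e\<close> with \<open>w\<close> orthogonal to the unit vector \<open>e\<close>
  (the direction of the \<open>y\<close>-axis), \<open>D\<close> is the region above the graph of an \<open>L\<close>-Lipschitz
  function \<open>\<phi>\<close>.
\<close>

definition lipschitz_graph_at :: "'a::euclidean_space set \<Rightarrow> real \<Rightarrow> 'a \<Rightarrow> 'a \<Rightarrow> bool" where
  "lipschitz_graph_at D L Q e \<longleftrightarrow>
     norm e = 1 \<and>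
     (\<exists>\<phi>::'a \<Rightarrow> real. \<exists>\<rho>>0. \<exists>h>0.
        L-lipschitz_on {w. w \<bullet> e = 0} \<phi> \<and>
        (\<forall>w t. w \<bullet> e = 0 \<longrightarrow> norm w < \<rho> \<longrightarrow> \<bar>t\<bar> < h \<longrightarrow>
           (Q + w + t *\<^sub>R e \<in> D \<longleftrightarrow> \<phi> w < t) \<and>
           (Q + w + t *\<^sub>R e \<in> frontier D \<longleftrightarrow> t = \<phi> w)))"

definition lipschitz_domain :: "'a::euclidean_space set \<Rightarrow> bool" where
  "lipschitz_domain D \<longleftrightarrow>
     open D \<and> connected D \<and> D \<noteq> {} \<and>
     (\<exists>L. \<forall>Q\<in>frontier D. \<exists>e. lipschitz_graph_at D L Q e)"

definition starlike_lipschitz_domain :: "'a::euclidean_space \<Rightarrow> 'a set \<Rightarrow> bool" where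
  "starlike_lipschitz_domain P0 D \<longleftrightarrow>
     lipschitz_domain D \<and>
     (\<forall>v. v \<noteq> 0 \<longrightarrow> (\<exists>!X. X \<in> frontier D \<and> (\<exists>t\<ge>0. X = P0 + t *\<^sub>R v))) \<and>
     (\<exists>L. \<forall>Q\<in>frontier D. lipschitz_graph_at D L Q (sgn (P0 - Q)))"

section \<open>Cylinders and Carleson measures\<close>

text \<open>
  The cylinder centered at \<open>P\<close> of radius \<open>r\<close> and total height \<open>s * r\<close> (so it extends by
  \<open>s * r / 2\<close> to either side of \<open>P\<close>), with axis along the line through \<open>P0\<close> and \<open>P\<close>.
\<close>

definition cylinder :: "'a::euclidean_space \<Rightarrow> real \<Rightarrow> 'a \<Rightarrow> real \<Rightarrow> 'a set" where
  "cylinder P0 s P r =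
     {P + w + t *\<^sub>R sgn (P0 - P) | w t. w \<bullet> (P0 - P) = 0 \<and> norm w < r \<and> \<bar>t\<bar> < s * r / 2}"

text \<open>The flat faces on the side of \<open>P0\<close> (\<open>\<sigma> = 1\<close>) and on the opposite side (\<open>\<sigma> = -1\<close>).\<close>

definition cylinder_face :: "'a::euclidean_space \<Rightarrow> real \<Rightarrow> 'a \<Rightarrow> real \<Rightarrow> real \<Rightarrow> 'a set" where
  "cylinder_face P0 s P r \<sigma> =
     {P + w + (\<sigma> * (s * r / 2)) *\<^sub>R sgn (P0 - P) | w. w \<bullet> (P0 - P) = 0 \<and> norm w < r}"

text \<open>
  The faces are taken relatively open: for \<open>s = 2 * L\<close> their rims may touch the boundary.
\<close>

definition admissible_height :: "'a::euclidean_space \<Rightarrow> 'a set \<Rightarrow> real \<Rightarrow> bool" where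
  "admissible_height P0 D s \<longleftrightarrow>
     s > 0 \<and>
     (\<exists>r0>0. \<forall>P\<in>frontier D. \<forall>r. 0 < r \<and> r < r0 \<longrightarrow>
        cylinder_face P0 s P r 1 \<subseteq> D \<and> cylinder_face P0 s P r (-1) \<inter> D = {})"

definition carleson_measure ::
    "'a::euclidean_space set \<Rightarrow> ('a \<Rightarrow> 'a set \<Rightarrow> ennreal) \<Rightarrow> 'a \<Rightarrow> real \<Rightarrow> ('a set \<Rightarrow> ennreal) \<Rightarrow> bool"
  where
  "carleson_measure D \<omega> P0 s \<mu> \<longleftrightarrow>
     (\<exists>M::real. M > 0 \<and> (\<forall>P\<in>frontier D. \<forall>r>0.
        \<mu> (cylinder P0 s P r \<inter> D) \<le> ennreal M * \<omega> P0 (cylinder P0 s P r \<inter> frontier D)))"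

definition Lp_functions :: "real \<Rightarrow> 'a measure \<Rightarrow> ('a \<Rightarrow> real) set" where
  "Lp_functions p M = {f \<in> borel_measurable M. integrable M (\<lambda>z. \<bar>f z\<bar> powr p)}"

definition strongly_pp ::
    "'a::euclidean_space set \<Rightarrow> ('a \<Rightarrow> 'a set \<Rightarrow> ennreal) \<Rightarrow> 'a \<Rightarrow> real \<Rightarrow> ('a set \<Rightarrow> ennreal) \<Rightarrow> bool"
  where
  "strongly_pp D \<omega> P0 p \<mu> \<longleftrightarrow>
     (\<exists>K::real. K > 0 \<and> (\<forall>f\<in>Lp_functions p (hm_measure D \<omega> P0).
        (\<integral>\<^sup>+x. ennreal (\<bar>hm_integral D \<omega> f x\<bar> powr p) \<partial>caratheodory_measure D \<mu>)
          \<le> ennreal K * (\<integral>\<^sup>+z. ennreal (\<bar>f z\<bar> powr p) \<partial>hm_measure D \<omega> P0)))"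

end

theory Submission
  imports Defs
begin

text \<open>
  Compatibility of the system is the strong Markov property: for \<open>W \<subseteq> D\<close> a harmonic extension from
  \<open>\<partial>D\<close> is, on \<open>W\<close>, the harmonic extension of its own values on \<open>\<partial>W\<close>; it also yields a comparison
  principle on arbitrary bounded open sets. Continuity of the Radon-Nikodym derivatives
  and of harmonic extensions gives a Harnack inequality on balls, and regularity of one
  annulus gives the lower bound of harmonic measure near an exterior ball. For a starlike
  Lipschitz domain \<open>D = {N < 1}\<close> with a homogeneous Lipschitz gauge \<open>N\<close>, dilations replace
  the usual kernel estimates: comparing \<open>D\<close> with \<open>(1 + r)D\<close> gives the doubling property of
  \<open>\<omega>\<^sub>O\<close>, and comparing it with \<open>N(x)D\<close> bounds \<open>\<omega>\<^sub>O\<close> of the shadow of \<open>x\<close> by the measure, seen from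
  \<open>O\<close>, of paths that visit the neighbourhood of \<open>x\<close>. With a Vitali covering by shadows this
  shows that \<open>H\<close> is of weak type (1,1) with respect to a Carleson measure, and interpolation with
  the trivial \<open>L\<^sup>\<infinity>\<close> bound finishes one direction. The other one follows by testing on indicators
  of surface balls.
\<close>

section \<open>Harmonic extensions\<close>

text \<open>What is left is positivity, the strong Markov property and invariance under dilations.
  Two obstacles shape the details. Each harmonic measure has its own sigma-algebra, and a function
  measurable for one open set need not be so for another. The estimates are therefore carried out
  for bounded Borel functions on the whole space, which serve as boundary data for every open set at
  once; general boundary functions enter only in \<open>borel_version\<close> and
  \<open>strong_type\<close>. Moreover, two extensions can be compared only on a common open subset,
  and each estimate has to choose it: the part of \<open>D\<close> in a ball for the exterior ball
  bound, \<open>D\<close> inside a larger dilate for doubling, a smaller dilate of \<open>D\<close>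
  for the shadows. Constants are uniform because each basic fact is proved once, in the unit ball or
  in an annulus about 0, and then moved by homotheties.\<close>

definition bounded_borel :: "('a::topological_space \<Rightarrow> real) \<Rightarrow> bool" where
  "bounded_borel f \<longleftrightarrow> f \<in> borel_measurable borel \<and> (\<exists>B. \<forall>x. \<bar>f x\<bar> \<le> B)"

definition bdd_open :: "'a::euclidean_space set \<Rightarrow> bool" where
  "bdd_open U \<longleftrightarrow> open U \<and> bounded U \<and> U \<noteq> {}"

lemma bounded_borel_indicator [intro]:
  "A \<in> sets borel \<Longrightarrow> bounded_borel (indicat_real A)"
  unfolding bounded_borel_def by (auto intro!: exI[of _ 1] simp: indicator_def)

lemma bounded_borel_cmult [intro]:
  assumes "bounded_borel f" shows "bounded_borel (\<lambda>x. c * f x)"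
proof -
  obtain B where B: "\<And>x. \<bar>f x\<bar> \<le> B" and f: "f \<in> borel_measurable borel"
    using assms by (auto simp: bounded_borel_def)
  have "\<bar>c * f x\<bar> \<le> \<bar>c\<bar> * B" for x
    by (simp add: abs_mult B mult_left_mono)
  then show ?thesis using f by (auto simp: bounded_borel_def)
qed

lemma bounded_borel_mult [intro]:
  assumes "bounded_borel f" "bounded_borel g" shows "bounded_borel (\<lambda>x. f x * g x)"
proof -
  obtain B B' where B: "\<And>x. \<bar>f x\<bar> \<le> B" "\<And>x. \<bar>g x\<bar> \<le> B'"
    and f: "f \<in> borel_measurable borel" "g \<in> borel_measurable borel"
    using assms by (auto simp: bounded_borel_def)
  have "\<bar>f x * g x\<bar> \<le> B * B'" for x
    unfolding abs_mult by (intro mult_mono B) (use B(1)[of x] in auto)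
  then show ?thesis using f by (auto simp: bounded_borel_def)
qed

lemma bounded_borel_add [intro]:
  assumes "bounded_borel f" "bounded_borel g" shows "bounded_borel (\<lambda>x. f x + g x)"
proof -
  obtain B B' where B: "\<And>x. \<bar>f x\<bar> \<le> B" "\<And>x. \<bar>g x\<bar> \<le> B'"
    and f: "f \<in> borel_measurable borel" "g \<in> borel_measurable borel"
    using assms by (auto simp: bounded_borel_def)
  have "\<bar>f x + g x\<bar> \<le> B + B'" for x
    using abs_triangle_ineq[of "f x" "g x"] B[of x] by linarith
  then show ?thesis using f by (auto simp: bounded_borel_def)
qed

lemma bounded_borel_const [intro]: "bounded_borel (\<lambda>x. c)"
  by (auto simp: bounded_borel_def)

lemma bounded_borel_sum [intro]:
  assumes "\<And>i. i \<in> I \<Longrightarrow> bounded_borel (f i)" shows "bounded_borel (\<lambda>x. \<Sum>i\<in>I. f i x)"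
  using assms by (induction I rule: infinite_finite_induct) auto

text \<open>The hypotheses on the system with the family of (H1) already substituted. The dimension
  enters through the connectedness of annuli.\<close>

locale harmonic_system =
  fixes \<Omega> :: "'a::euclidean_space set \<Rightarrow> 'a \<Rightarrow> 'a set \<Rightarrow> ennreal"
  assumes system: "radon_harmonic_measure_system {U. open U \<and> bounded U \<and> U \<noteq> {}} \<Omega>"
    and regular: "\<And>U. lipschitz_domain U \<Longrightarrow> bounded U \<Longrightarrow> regular_domain U (\<Omega> U)"
    and tsci: "TSCI {U. open U \<and> bounded U \<and> U \<noteq> {}} \<Omega>"
    and RN: "\<And>U. open U \<Longrightarrow> bounded U \<Longrightarrow> U \<noteq> {} \<Longrightarrow> continuous_RN_derivs U (\<Omega> U)"
    and dim2: "2 \<le> DIM('a)"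
begin

abbreviation M :: "'a set \<Rightarrow> 'a \<Rightarrow> 'a measure" where
  "M U \<equiv> hm_measure U (\<Omega> U)"

text \<open>Equal to \<open>f\<close> on the boundary and to 0 off the closure: a total function, so
  that it can in turn be prescribed as boundary data of another open set.\<close>

definition H :: "'a set \<Rightarrow> ('a \<Rightarrow> real) \<Rightarrow> 'a \<Rightarrow> real" where
  "H U f x = (if x \<in> closure U then hm_integral U (\<Omega> U) f x else 0)"

lemma pre_harmonic:
  assumes "bdd_open U" shows "pre_harmonic_measure U (\<Omega> U)"
  using assms system
  by (auto simp: bdd_open_def radon_harmonic_measure_system_def harmonic_measure_system_def
      continuous_harmonic_measure_def)

lemma borel_outer_measure:
  assumes "bdd_open U" "x \<in> U" shows "borel_outer_measure (frontier U) (\<Omega> U x)"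
  using pre_harmonic[OF assms(1)] assms(2) by (auto simp: pre_harmonic_measure_def)

lemma outer_le_1:
  assumes "bdd_open U" "x \<in> U" "A \<subseteq> frontier U" shows "\<Omega> U x A \<le> 1"
  using pre_harmonic[OF assms(1)] assms(2,3) by (auto simp: pre_harmonic_measure_def)

lemma outer_empty:
  assumes "bdd_open U" "x \<in> U" shows "\<Omega> U x {} = 0"
  using borel_outer_measure[OF assms]
  by (auto simp: borel_outer_measure_def outer_measure_space_def positive_def)

lemma borel_hm_sets:
  assumes "bdd_open U" "A \<in> sets borel" "A \<subseteq> frontier U"
  shows "A \<in> hm_sets U (\<Omega> U)"
proof -
  have "A \<in> sets (restrict_space borel (frontier U))"
    using assms by (subst sets_restrict_space_iff) auto
  then have "A \<in> hm_sets_at U (\<Omega> U x)" if "x \<in> U" for x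
    unfolding hm_sets_at_def using outer_empty[OF assms(1) that]
    by (intro CollectI exI[of _ A] exI[of _ "{}"]) auto
  then show ?thesis by (auto simp: hm_sets_def)
qed

lemma space_M [simp]: "space (M U x) = frontier U"
  by (simp add: hm_measure_def space_measure_of_conv)

lemma sets_M: "bdd_open U \<Longrightarrow> x \<in> U \<Longrightarrow> sets (M U x) = hm_sets U (\<Omega> U)"
  using sets_hm_measure[OF pre_harmonic] .

lemma emeasure_M:
  assumes "bdd_open U" "x \<in> U" "A \<in> sets borel" "A \<subseteq> frontier U"
  shows "emeasure (M U x) A = \<Omega> U x A"
  using emeasure_hm_measure[OF pre_harmonic[OF assms(1)] assms(2)] borel_hm_sets[OF assms(1,3,4)] .

lemma finite_M:
  assumes "bdd_open U" "x \<in> U" shows "finite_measure (M U x)"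
proof
  have "emeasure (M U x) (frontier U) \<le> 1"
    using emeasure_M[OF assms, of "frontier U"] outer_le_1[OF assms, of "frontier U"] by auto
  then show "emeasure (M U x) (space (M U x)) \<noteq> \<infinity>" 
    by (auto simp: top_unique)
qed

lemma measure_M_le_1:
  assumes "bdd_open U" "x \<in> U" shows "measure (M U x) (frontier U) \<le> 1"
  using emeasure_M[OF assms, of "frontier U"] outer_le_1[OF assms, of "frontier U"]
  by (auto simp: measure_def intro!: enn2real_leI)

lemma measurable_M:
  assumes "bdd_open U" "x \<in> U" "f \<in> borel_measurable borel" shows "f \<in> borel_measurable (M U x)"
proof (rule measurableI)
  fix A :: "'b set" assume "A \<in> sets borel"
  then have "f -` A \<in> sets borel" using measurable_sets[OF assms(3), of A] by simp
  then show "f -` A \<inter> space (M U x) \<in> sets (M U x)"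
    unfolding sets_M[OF assms(1,2)] space_M by (intro borel_hm_sets[OF assms(1)]) auto
qed auto

lemma integrable_M:
  assumes "bdd_open U" "x \<in> U" "bounded_borel f" shows "integrable (M U x) f"
proof -
  interpret finite_measure "M U x" by (rule finite_M[OF assms(1,2)])
  obtain B where "\<And>x. \<bar>f x\<bar> \<le> B" "f \<in> borel_measurable borel"
    using assms by (auto simp: bounded_borel_def)
  then show ?thesis using measurable_M[OF assms(1,2)]
    by (intro integrable_const_bound[where B=B]) auto
qed

lemma hm_integrable:
  assumes "bdd_open U" "bounded_borel f" shows "f \<in> hm_integrable U (\<Omega> U)"
  using integrable_M[OF assms(1) _ assms(2)] by (auto simp: hm_integrable_def)

lemma not_frontier: "bdd_open U \<Longrightarrow> x \<in> U \<Longrightarrow> x \<notin> frontier U"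
  by (auto simp: bdd_open_def frontier_def interior_open)

lemma H_inside: "bdd_open U \<Longrightarrow> x \<in> U \<Longrightarrow> H U f x = (\<integral>z. f z \<partial>M U x)"
  using closure_subset[of U] not_frontier[of U x] by (auto simp: H_def hm_integral_def)

lemma H_frontier: "x \<in> frontier U \<Longrightarrow> H U f x = f x"
  by (auto simp: H_def hm_integral_def frontier_def)

lemma H_mono:
  assumes "bdd_open U" "bounded_borel f" "bounded_borel g" "x \<in> U"
    "\<And>y. y \<in> frontier U \<Longrightarrow> f y \<le> g y"
  shows "H U f x \<le> H U g x"
  unfolding H_inside[OF assms(1,4)]
  by (rule integral_mono) (use assms integrable_M in auto)

lemma H_cmult: "H U (\<lambda>x. c * f x) x = c * H U f x"
  unfolding H_def hm_integral_def by (auto)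

lemma H_add:
  assumes "bdd_open U" "bounded_borel f" "bounded_borel g" 
  shows "H U (\<lambda>x. f x + g x) x = H U f x + H U g x"
  unfolding H_def hm_integral_def using assms integrable_M[of U x f] integrable_M[of U x g]
  by (auto simp: closure_Un_frontier)

lemma H_zero: "H U (\<lambda>x. 0) x = 0"
  unfolding H_def hm_integral_def by auto

lemma H_sum:
  assumes "bdd_open U" "\<And>i. i \<in> I \<Longrightarrow> bounded_borel (f i)"
  shows "H U (\<lambda>x. \<Sum>i\<in>I. f i x) x = (\<Sum>i\<in>I. H U (f i) x)"
  using assms(2)
proof (induction I rule: infinite_finite_induct)
  case (insert i I)
  then show ?case using H_add[OF assms(1), of "f i" "\<lambda>x. \<Sum>i\<in>I. f i x" x] bounded_borel_sum[of I f]
    by auto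
qed (auto simp: H_zero)

lemma H_const_le:
  assumes "bdd_open U" "x \<in> U" "c \<ge> 0" shows "H U (\<lambda>x. c) x \<le> c"
  using measure_M_le_1[OF assms(1,2)] assms(3)
  by (auto simp: H_inside[OF assms(1,2)] mult_left_le_one_le)

lemma H_nonneg:
  assumes "\<And>y. y \<in> frontier U \<Longrightarrow> 0 \<le> f y" shows "0 \<le> H U f x"
  unfolding H_def hm_integral_def using assms
  by (auto intro!: Bochner_Integration.integral_nonneg)

lemma H_le:
  assumes "bdd_open U" "bounded_borel f" "x \<in> U" "c \<ge> 0"
    "\<And>y. y \<in> frontier U \<Longrightarrow> f y \<le> c"
  shows "H U f x \<le> c"
  using H_mono[OF assms(1,2) bounded_borel_const assms(3), of c] H_const_le[OF assms(1,3,4)]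
    assms(5) by force

lemma H_continuous:
  assumes "bdd_open U" "bounded_borel f" shows "continuous_on U (H U f)"
proof -
  have "continuous_on U (hm_integral U (\<Omega> U) f)"
    using system assms hm_integrable[OF assms]
    unfolding bdd_open_def radon_harmonic_measure_system_def harmonic_measure_system_def
      continuous_harmonic_measure_def by blast
  then show ?thesis
    using closure_subset[of U] by (subst continuous_on_cong[OF refl, of _ _ "hm_integral U (\<Omega> U) f"]) (auto simp: H_def)
qed

text \<open>This closure property allows extensions to be iterated. The function is pasted from a
  continuous one on the open set \<open>U\<close>, the Borel function \<open>f\<close> on the
  boundary, and 0; the bound survives since the measures have mass at most 1.\<close>

lemma bounded_borel_H [intro]:
  assumes "bdd_open U" "bounded_borel f" shows "bounded_borel (H U f)"
proof -
  obtain B where B: "\<And>x. \<bar>f x\<bar> \<le> B" and f: "f \<in> borel_measurable borel"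
    using assms by (auto simp: bounded_borel_def)
  have "B \<ge> 0" using B[of undefined] by auto
  have U: "open U" using assms by (auto simp: bdd_open_def)
  have eq: "H U f x = (if x \<in> U then H U f x else if x \<in> frontier U then f x else 0)" for x
    unfolding H_def hm_integral_def frontier_def using U closure_subset[of U]
    by (auto simp: interior_open)
  have "(\<lambda>x. if x \<in> U then H U f x else 0) \<in> borel_measurable borel"
    using U H_continuous[OF assms] by (intro borel_measurable_continuous_on_if) auto
  moreover have "(\<lambda>x. if x \<in> frontier U then f x else 0) \<in> borel_measurable borel"
    using f by measurable
  ultimately have "(\<lambda>x. if x \<in> U then (if x \<in> U then H U f x else 0)
      else if x \<in> frontier U then f x else 0) \<in> borel_measurable borel"
    using borel_open[OF U] by measurable
  moreover have "H U f = (\<lambda>x. if x \<in> U then (if x \<in> U then H U f x else 0)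
      else if x \<in> frontier U then f x else 0)"
    by (rule ext) (subst eq, simp)
  ultimately have "H U f \<in> borel_measurable borel" by simp
  moreover have "\<bar>H U f x\<bar> \<le> B" for x
  proof (cases "x \<in> U")
    case True
    have "\<bar>f y\<bar> \<le> B" for y using B .
    then have "H U f x \<le> B" "H U (\<lambda>x. -1 * f x) x \<le> B"
      by (intro H_le assms True bounded_borel_cmult \<open>B \<ge> 0\<close>; simp add: abs_le_iff)+
    then show ?thesis unfolding H_cmult by simp
  next
    case False then show ?thesis using eq[of x] B[of x] \<open>B \<ge> 0\<close> by auto
  qed
  ultimately show ?thesis by (auto simp: bounded_borel_def)
qed

text \<open>The matching conditions of a compatible system become trivial here: \<open>W\<close>
  does not meet the boundary of \<open>D\<close>, so the first one is empty, and the second holds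
  because the data on \<open>W\<close> are taken to be \<open>H D f\<close> itself.\<close>

lemma compatible:
  assumes "bdd_open D" "bdd_open W" "W \<subseteq> D" "bounded_borel f" "x \<in> W"
  shows "H D f x = H W (H D f) x"
proof -
  have fr: "D \<inter> frontier D = {}" "frontier W \<subseteq> closure D"
    using assms by (auto simp: bdd_open_def frontier_def interior_open dest: closure_mono)
  have "hm_integral D (\<Omega> D) f x = hm_integral W (\<Omega> W) (H D f) x"
  proof -
    have s: "\<forall>D\<in>{U. open U \<and> bounded U \<and> U \<noteq> {}}. \<forall>D'\<in>{U. open U \<and> bounded U \<and> U \<noteq> {}}. D \<inter> D' \<noteq> {} \<longrightarrow>
        (\<forall>f\<in>hm_integrable D (\<Omega> D). \<forall>f'\<in>hm_integrable D' (\<Omega> D').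
           (\<forall>y\<in>D' \<inter> frontier D. hm_integral D' (\<Omega> D') f' y = f y) \<longrightarrow>
           (\<forall>y\<in>frontier D' \<inter> closure D. hm_integral D (\<Omega> D) f y = f' y) \<longrightarrow>
           (\<forall>x\<in>D \<inter> D'. hm_integral D (\<Omega> D) f x = hm_integral D' (\<Omega> D') f' x))"
      using system unfolding radon_harmonic_measure_system_def harmonic_measure_system_def by blast
    show ?thesis
    proof (rule s[rule_format])
      show "f \<in> hm_integrable D (\<Omega> D)" "H D f \<in> hm_integrable W (\<Omega> W)"
        using assms by (auto intro!: hm_integrable)
      show "\<And>y. y \<in> W \<inter> frontier D \<Longrightarrow> hm_integral W (\<Omega> W) (H D f) y = f y"
        using assms fr by auto
      show "\<And>y. y \<in> frontier W \<inter> closure D \<Longrightarrow> hm_integral D (\<Omega> D) f y = H D f y"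
        by (auto simp: H_def)
    qed (use assms in \<open>auto simp: bdd_open_def\<close>)
  qed
  then show ?thesis
    using assms closure_subset[of W] closure_subset[of D] by (auto simp: H_def)
qed

text \<open>Takes the place of the maximum principle: on \<open>W\<close> both sides are extensions
  of their own values on the boundary of \<open>W\<close>, and extension is monotone.\<close>

lemma comparison:
  assumes "bdd_open W" "bdd_open D" "bdd_open D'" "W \<subseteq> D" "W \<subseteq> D'"
    "bounded_borel f" "bounded_borel g" "x \<in> W"
    "\<And>y. y \<in> frontier W \<Longrightarrow> H D f y \<le> H D' g y"
  shows "H D f x \<le> H D' g x"
  using compatible[of D W f x] compatible[of D' W g x] H_mono[of W "H D f" "H D' g" x] assms
  by auto

lemma outer_eq_H:
  assumes "bdd_open U" "x \<in> U" "A \<in> sets borel" "A \<subseteq> frontier U"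
  shows "\<Omega> U x A = ennreal (H U (indicator A) x)"
proof -
  interpret finite_measure "M U x" by (rule finite_M[OF assms(1,2)])
  have "A \<in> sets (M U x)" using borel_hm_sets assms sets_M by auto
  then show ?thesis
    unfolding H_inside[OF assms(1,2)] using assms
    by (simp add: emeasure_M[symmetric] emeasure_eq_measure Int_absorb2)
qed

subsection \<open>The Harnack inequality\<close>

lemma abs_cont:
  assumes "bdd_open U" "connected U" "x \<in> U" "y \<in> U"
  shows "abs_cont_on (frontier U) (\<Omega> U x) (\<Omega> U y)"
proof -
  have "U \<in> components U" using assms by (auto simp: in_components_self bdd_open_def)
  then show ?thesis using pre_harmonic[OF assms(1)] assms by (auto simp: pre_harmonic_measure_def)
qed

lemma absolutely_continuous_M:
  assumes "bdd_open U" "connected U" "x \<in> U" "y \<in> U"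
  shows "absolutely_continuous (M U y) (M U x)"
proof -
  note sets = sets_M[OF assms(1)]
    and em = emeasure_hm_measure[OF pre_harmonic[OF assms(1)]]
  have "A \<in> null_sets (M U x)" if A: "A \<in> null_sets (M U y)" for A
  proof -
    have A': "A \<in> hm_sets U (\<Omega> U)" "\<Omega> U y A = 0" 
      using A sets assms em null_setsD1[OF A] by (auto dest: null_setsD2)
    have "A \<subseteq> frontier U" using A sets.sets_into_space[of A "M U y"] by auto
    then have "\<Omega> U x A = 0"
      using abs_cont[OF assms] A' by (auto simp: abs_cont_on_def)
    then show ?thesis using A' assms sets em by (auto intro!: null_setsI)
  qed
  then show ?thesis by (auto simp: absolutely_continuous_def)
qed

text \<open>The density of one measure with respect to the other has a continuous version on a
  compact boundary, hence is bounded. Functions with values in \<open>ennreal\<close> are needed for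
  the infinite sums of the next lemma.\<close>

lemma M_le_cmult_M:
  assumes "bdd_open U" "connected U" "x \<in> U" "y \<in> U"
  obtains C :: real where "C \<ge> 0"
    "\<And>F::'a \<Rightarrow> ennreal. F \<in> borel_measurable borel \<Longrightarrow>
       (\<integral>\<^sup>+z. F z \<partial>M U x) \<le> ennreal C * (\<integral>\<^sup>+z. F z \<partial>M U y)"
proof -
  have U: "open U" "bounded U" "U \<noteq> {}" using assms by (auto simp: bdd_open_def)
  obtain g :: "'a \<Rightarrow> real" where g: "continuous_on (frontier U) g"
    "AE z in M U y. RN_deriv (M U y) (M U x) z = ennreal (g z)"
    using RN[OF U] abs_cont[OF assms] assms(3,4) by (auto simp: continuous_RN_derivs_def)
  have "bounded (g ` frontier U)"
    using g(1) compact_frontier_bounded[OF U(2)] by (intro compact_imp_bounded compact_continuous_image)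
  then obtain C where C: "\<And>z. z \<in> frontier U \<Longrightarrow> \<bar>g z\<bar> \<le> C" by (auto simp: bounded_iff)
  interpret y: finite_measure "M U y" using finite_M assms by auto
  note sets = sets_M[OF assms(1)]
  have sets_eq: "sets (M U x) = sets (M U y)" using sets assms by simp
  have d: "density (M U y) (RN_deriv (M U y) (M U x)) = M U x"
    by (rule y.density_RN_deriv[OF absolutely_continuous_M[OF assms] sets_eq])
  show ?thesis
  proof (rule that[of "max C 0"])
    fix F :: "'a \<Rightarrow> ennreal" assume F: "F \<in> borel_measurable borel"
    have Fm: "F \<in> borel_measurable (M U y)" by (rule measurable_M[OF assms(1,4) F])
    have "(\<integral>\<^sup>+z. F z \<partial>M U x) = (\<integral>\<^sup>+z. RN_deriv (M U y) (M U x) z * F z \<partial>M U y)"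
      by (subst d[symmetric], subst nn_integral_density) (use Fm in auto)
    also have "\<dots> \<le> (\<integral>\<^sup>+z. ennreal (max C 0) * F z \<partial>M U y)"
    proof (rule nn_integral_mono_AE, use g(2) AE_space[of "M U y"] in eventually_elim)
      case (elim z)
      then show ?case using C[of z]
        by (auto intro!: mult_right_mono ennreal_leI)
    qed
    also have "\<dots> = ennreal (max C 0) * (\<integral>\<^sup>+z. F z \<partial>M U y)"
      by (rule nn_integral_cmult[OF Fm])
    finally show "(\<integral>\<^sup>+z. F z \<partial>M U x) \<le> ennreal (max C 0) * (\<integral>\<^sup>+z. F z \<partial>M U y)" .
  qed simp
qed

text \<open>
  Gliding hump: if no uniform constant existed, a sum \<open>\<Sum>\<^sub>k c\<^sub>k F\<^sub>k\<close> of bad functions would be integrable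
  with a harmonic extension unbounded on \<open>K\<close>, against its continuity.
\<close>

lemma M_le_cmult_M_uniform:
  assumes U: "bdd_open U" "connected U" "y \<in> U" and K: "compact K" "K \<subseteq> U"
  obtains C :: real where "C > 0"
    "\<And>x F::'a \<Rightarrow> ennreal. x \<in> K \<Longrightarrow> F \<in> borel_measurable borel \<Longrightarrow>
       (\<integral>\<^sup>+z. F z \<partial>M U x) \<le> ennreal C * (\<integral>\<^sup>+z. F z \<partial>M U y)"
proof (rule ccontr)
  assume neg: "\<not> thesis"
  have "\<exists>x F. x \<in> K \<and> (F::'a \<Rightarrow> ennreal) \<in> borel_measurable borel \<and>
      ennreal (4 ^ k) * (\<integral>\<^sup>+z. F z \<partial>M U y) < (\<integral>\<^sup>+z. F z \<partial>M U x)" for k :: nat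
    using that[of "4 ^ k"] neg by (force simp: not_le)
  then obtain X F where X: "\<And>k::nat. X k \<in> K" and F: "\<And>k. F k \<in> borel_measurable borel"
    and less: "\<And>k. ennreal (4 ^ k) * (\<integral>\<^sup>+z. F k z \<partial>M U y) < (\<integral>\<^sup>+z. F k z \<partial>M U (X k))"
    by metis
  have XU: "X k \<in> U" for k using X K by auto
  \<comment> \<open>The integral at \<open>y\<close> is positive, since otherwise
    \<open>M_le_cmult_M\<close> makes the integral at \<open>X k\<close> vanish too, and finite,
    since the inequality \<open>less\<close> is strict.\<close>
  have "\<exists>a>0. (\<integral>\<^sup>+z. F k z \<partial>M U y) = ennreal a" for k
  proof -
    obtain C where "C \<ge> 0" "(\<integral>\<^sup>+z. F k z \<partial>M U (X k)) \<le> ennreal C * (\<integral>\<^sup>+z. F k z \<partial>M U y)"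
      using M_le_cmult_M[OF U(1,2) XU U(3)] F by metis
    then have "(\<integral>\<^sup>+z. F k z \<partial>M U y) \<noteq> 0" using less[of k] by auto
    moreover have "(\<integral>\<^sup>+z. F k z \<partial>M U y) \<noteq> \<infinity>" using less[of k] by (auto simp: ennreal_mult_top)
    ultimately show ?thesis
      by (cases "\<integral>\<^sup>+z. F k z \<partial>M U y") (auto simp: less_le)
  qed
  then obtain a where a: "\<And>k. a k > 0" "\<And>k. (\<integral>\<^sup>+z. F k z \<partial>M U y) = ennreal (a k)" by metis
  \<comment> \<open>The weights split the factor \<open>4 ^ k\<close> evenly: the
    \<open>k\<close>-th term has integral \<open>(1/2) ^ k\<close> at \<open>y\<close> but at least
    \<open>2 ^ k\<close> at \<open>X k\<close>.\<close>
  define G where "G z = (\<Sum>k. ennreal (1 / (2 ^ k * a k)) * F k z)" for z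
  have G: "G \<in> borel_measurable borel" unfolding G_def using F by measurable
  have "(\<integral>\<^sup>+z. G z \<partial>M U y) = (\<Sum>k. ennreal (1 / (2 ^ k * a k)) * ennreal (a k))"
    unfolding G_def a(2)[symmetric] using measurable_M[OF U(1,3) F]
    by (subst nn_integral_suminf) (simp_all add: nn_integral_cmult)
  also have "\<dots> = (\<Sum>k. ennreal ((1/2) ^ k))"
  proof (intro suminf_cong)
    fix k
    have "1 / (2 ^ k * a k) * a k = (1/2) ^ k" using a(1)[of k] unfolding power_divide by simp
    then show "ennreal (1 / (2 ^ k * a k)) * ennreal (a k) = ennreal ((1/2) ^ k)"
      using a(1)[of k] by (subst ennreal_mult[symmetric]) auto
  qed
  also have "\<dots> = ennreal 2"
  proof (rule suminf_ennreal_eq)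
    show "(\<lambda>k. (1/2::real) ^ k) sums 2" using geometric_sums[of "1/2::real"] by simp
  qed simp
  finally have Gy: "(\<integral>\<^sup>+z. G z \<partial>M U y) = ennreal 2" .
  \<comment> \<open>The continuity axiom speaks of real functions. \<open>G\<close> is finite almost
    everywhere for every point of \<open>U\<close>, so sending the value infinity to 0 changes no
    integral.\<close>
  define f where "f z = enn2real (G z)" for z
  have Gx: "(\<integral>\<^sup>+z. G z \<partial>M U x) < \<infinity>" if x: "x \<in> U" for x
  proof -
    obtain C where "(\<integral>\<^sup>+z. G z \<partial>M U x) \<le> ennreal C * (\<integral>\<^sup>+z. G z \<partial>M U y)"
      using M_le_cmult_M[OF U(1,2) x U(3)] G by metis
    then show ?thesis unfolding Gy by (auto simp: ennreal_mult_less_top intro: le_less_trans)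
  qed
  have fG: "(\<integral>\<^sup>+z. ennreal (f z) \<partial>M U x) = (\<integral>\<^sup>+z. G z \<partial>M U x)" if "x \<in> U" for x
  proof (rule nn_integral_cong_AE)
    have "AE z in M U x. G z \<noteq> \<infinity>"
      using Gx[OF that] measurable_M[OF U(1) that G] by (intro nn_integral_PInf_AE) auto
    then show "AE z in M U x. ennreal (f z) = G z"
      by eventually_elim (auto simp: f_def less_top)
  qed
  have fm: "f \<in> borel_measurable borel" unfolding f_def using G by measurable
  have f0: "f z \<ge> 0" for z by (simp add: f_def)
  have int: "integrable (M U x) f" if "x \<in> U" for x
    using measurable_M[OF U(1) that fm] fG[OF that] Gx[OF that] f0
    by (intro integrableI_nonneg) auto
  then have "f \<in> hm_integrable U (\<Omega> U)" by (auto simp: hm_integrable_def)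
  then have "continuous_on U (hm_integral U (\<Omega> U) f)"
    using system U unfolding bdd_open_def radon_harmonic_measure_system_def
      harmonic_measure_system_def continuous_harmonic_measure_def by blast
  then have "compact (hm_integral U (\<Omega> U) f ` K)"
    using K continuous_on_subset by (blast intro: compact_continuous_image)
  then obtain B where B: "\<And>x. x \<in> K \<Longrightarrow> \<bar>hm_integral U (\<Omega> U) f x\<bar> \<le> B"
    using compact_imp_bounded by (fastforce simp: bounded_iff)
  have "2 ^ k \<le> B" for k :: nat
  proof -
    have "ennreal (2 ^ k) = ennreal (1 / (2 ^ k * a k)) * (ennreal (4 ^ k) * ennreal (a k))"
      using a(1)[of k] by (simp add: ennreal_mult'[symmetric] power_mult_distrib[symmetric] field_simps)
    also have "\<dots> \<le> ennreal (1 / (2 ^ k * a k)) * (\<integral>\<^sup>+z. F k z \<partial>M U (X k))"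
      using less[of k] a(2)[of k] by (intro mult_left_mono) auto
    also have "\<dots> = (\<integral>\<^sup>+z. ennreal (1 / (2 ^ k * a k)) * F k z \<partial>M U (X k))"
      using F measurable_M[OF U(1) XU] by (subst nn_integral_cmult) auto
    also have "\<dots> \<le> (\<integral>\<^sup>+z. G z \<partial>M U (X k))"
    proof (rule nn_integral_mono)
      fix z show "ennreal (1 / (2 ^ k * a k)) * F k z \<le> G z"
        using sum_le_suminf[of "\<lambda>k. ennreal (1 / (2 ^ k * a k)) * F k z" "{k}"] by (simp add: G_def)
    qed
    also have "\<dots> = ennreal (\<integral>z. f z \<partial>M U (X k))"
      unfolding fG[OF XU, symmetric] using int[OF XU] f0 by (intro nn_integral_eq_integral) auto
    also have "(\<integral>z. f z \<partial>M U (X k)) = hm_integral U (\<Omega> U) f (X k)"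
      using not_frontier[OF U(1) XU] by (auto simp: hm_integral_def)
    also have "ennreal \<dots> \<le> ennreal B"
      using B[OF X[of k]] by (intro ennreal_leI) auto
    finally have "ennreal (2 ^ k) \<le> ennreal B" .
    moreover have "0 \<le> B" using B[OF X[of k]] by auto
    ultimately show ?thesis by (simp add: ennreal_le_iff)
  qed
  moreover obtain k :: nat where "B < 2 ^ k" using real_arch_pow[of 2 B] by auto
  ultimately show False by (meson not_le)
qed

lemma Harnack_compact:
  assumes U: "bdd_open U" "connected U" "y \<in> U" and K: "compact K" "K \<subseteq> U"
  obtains C :: real where "C > 0"
    "\<And>x f. x \<in> K \<Longrightarrow> bounded_borel f \<Longrightarrow> (\<And>z. z \<in> frontier U \<Longrightarrow> 0 \<le> f z) \<Longrightarrow>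
       H U f x \<le> C * H U f y"
proof -
  obtain C where C: "C > 0"
    "\<And>x F::'a \<Rightarrow> ennreal. x \<in> K \<Longrightarrow> F \<in> borel_measurable borel \<Longrightarrow>
       (\<integral>\<^sup>+z. F z \<partial>M U x) \<le> ennreal C * (\<integral>\<^sup>+z. F z \<partial>M U y)"
    using M_le_cmult_M_uniform[OF assms] by metis
  have "H U f x \<le> C * H U f y" if "x \<in> K" "bounded_borel f" "\<And>z. z \<in> frontier U \<Longrightarrow> 0 \<le> f z" for x f
  proof -
    have eq: "(\<integral>\<^sup>+z. ennreal (f z) \<partial>M U w) = ennreal (H U f w)" if "w \<in> U" for w
      unfolding H_inside[OF U(1) that] using integrable_M[OF U(1) that \<open>bounded_borel f\<close>] \<open>\<And>z. z \<in> frontier U \<Longrightarrow> 0 \<le> f z\<close>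
      by (intro nn_integral_eq_integral) auto
    have "ennreal (H U f x) \<le> ennreal C * ennreal (H U f y)"
      using C(2)[of x "\<lambda>z. ennreal (f z)"] eq[of x] eq[of y] that K U by (auto simp: bounded_borel_def)
    then show ?thesis
      using C(1) H_nonneg[of U f y] that by (auto simp: ennreal_mult'[symmetric] ennreal_le_iff)
  qed
  then show ?thesis using that C(1) by blast
qed

end

section \<open>Translations and dilations\<close>

definition homothety :: "'a::real_normed_vector \<Rightarrow> real \<Rightarrow> 'a \<Rightarrow> 'a" where
  "homothety v k x = v + k *\<^sub>R x"

lemma homothety_image: "homothety v k ` S = (\<lambda>x. v + x) ` ((\<lambda>x. k *\<^sub>R x) ` S)"
  by (auto simp: homothety_def image_image)

lemma frontier_homothety:
  fixes S :: "'a::euclidean_space set"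
  assumes "k \<noteq> 0" shows "frontier (homothety v k ` S) = homothety v k ` frontier S"
proof -
  have lin: "linear (\<lambda>x::'a. k *\<^sub>R x)" and inj: "inj (\<lambda>x::'a. k *\<^sub>R x)"
    using assms by (auto intro: injI linear_scaleR)
  have "frontier ((\<lambda>x. k *\<^sub>R x) ` S) = (\<lambda>x. k *\<^sub>R x) ` frontier S"
    unfolding frontier_def
    by (simp add: closure_injective_linear_image[OF lin inj] interior_injective_linear_image[OF lin inj]
        image_set_diff[OF inj])
  then show ?thesis unfolding homothety_image frontier_translation by simp
qed

lemma bdd_open_homothety:
  fixes S :: "'a::euclidean_space set"
  assumes "bdd_open S" "k \<noteq> 0" shows "bdd_open (homothety v k ` S)"
  using assms unfolding bdd_open_def homothety_image
  by (auto intro: open_translation open_scaling bounded_translation bounded_scaling)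

lemma continuous_on_homothety [continuous_intros]: "continuous_on S (homothety v k)"
  unfolding homothety_def by (intro continuous_intros)

lemma measurable_homothety [measurable]:
  "homothety v k \<in> borel_measurable (borel :: 'a::euclidean_space measure)"
  by (intro borel_measurable_continuous_onI continuous_on_homothety)

lemma inj_homothety: "k \<noteq> 0 \<Longrightarrow> inj (homothety v k)"
  by (rule injI) (simp add: homothety_def)

lemma homothety_ball:
  fixes v :: "'a::euclidean_space"
  assumes "k > 0" shows "homothety v k ` ball 0 r = ball v (k * r)"
proof -
  have "x \<in> homothety v k ` ball 0 r" if "x \<in> ball v (k * r)" for x
  proof (rule image_eqI)
    show "x = homothety v k ((1/k) *\<^sub>R (x - v))" using assms by (simp add: homothety_def)
    have "norm ((1/k) *\<^sub>R (x - v)) = norm (x - v) / k" using assms by simp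
    then show "(1/k) *\<^sub>R (x - v) \<in> ball 0 r"
      unfolding mem_ball dist_0_norm
      using that assms by (simp only:) (simp add: dist_norm norm_minus_commute pos_divide_less_eq mult.commute)
  qed
  then show ?thesis using assms by (auto simp: homothety_def dist_norm)
qed

section \<open>Dilation invariance and the Harnack inequality at all scales\<close>

context harmonic_system begin

lemma outer_homothety:
  assumes "bdd_open U" "x \<in> U" "k \<noteq> 0" "A \<in> sets borel" "A \<subseteq> frontier U"
  shows "\<Omega> (homothety v k ` U) (homothety v k x) (homothety v k ` A) = \<Omega> U x A"
proof -
  have "homothety v k = (\<lambda>x. v + k *\<^sub>R (x - 0))" by (auto simp: homothety_def)
  then show ?thesis
    using tsci borel_hm_sets[OF assms(1,4,5)] assms(1,2,3)
    unfolding TSCI_def bdd_open_def by blast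
qed

lemma H_homothety:
  assumes U: "bdd_open U" "x \<in> U" and k: "k \<noteq> 0" and f: "bounded_borel f"
  shows "H (homothety v k ` U) f (homothety v k x) = H U (f \<circ> homothety v k) x"
proof -
  let ?h = "homothety v k"
  have U': "bdd_open (?h ` U)" "?h x \<in> ?h ` U" using bdd_open_homothety U k by auto
  have f': "f \<in> borel_measurable borel" using f by (auto simp: bounded_borel_def)
  have h: "?h \<in> measurable (M U x) borel"
    by (rule measurable_M[OF U measurable_homothety])
  have i: "(\<lambda>x. x) \<in> measurable (M (?h ` U) (?h x)) borel"
    by (rule measurable_M[OF U']) auto
  \<comment> \<open>TSCI speaks of measures of sets only. Pushing both measures to
    \<open>borel\<close>, one of them by the identity map, makes them comparable set by set and
    gives the change of variables in the integral.\<close>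
  have "distr (M (?h ` U) (?h x)) borel (\<lambda>x. x) = distr (M U x) borel ?h"
  proof (rule measure_eqI)
    fix A assume "A \<in> sets (distr (M (?h ` U) (?h x)) borel (\<lambda>x. x))"
    then have A: "A \<in> sets borel" by simp
    let ?A = "?h -` A \<inter> frontier U"
    have fr: "frontier (?h ` U) = ?h ` frontier U" by (rule frontier_homothety[OF k])
    have A': "?A \<in> sets borel" using measurable_sets[OF measurable_homothety A, of v k] by auto
    have "emeasure (distr (M (?h ` U) (?h x)) borel (\<lambda>x. x)) A = emeasure (M (?h ` U) (?h x)) (A \<inter> frontier (?h ` U))"
      using A i by (subst emeasure_distr) auto
    also have "\<dots> = \<Omega> (?h ` U) (?h x) (A \<inter> frontier (?h ` U))"
      using A by (intro emeasure_M U') auto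
    also have "A \<inter> frontier (?h ` U) = ?h ` ?A" unfolding fr by auto
    also have "\<Omega> (?h ` U) (?h x) (?h ` ?A) = \<Omega> U x ?A"
      by (rule outer_homothety[OF U k A']) auto
    also have "\<dots> = emeasure (distr (M U x) borel ?h) A"
      using A A' h U by (subst emeasure_distr) (auto simp: emeasure_M)
    finally show "emeasure (distr (M (?h ` U) (?h x)) borel (\<lambda>x. x)) A = emeasure (distr (M U x) borel ?h) A" .
  qed simp
  then have "(\<integral>z. f z \<partial>distr (M (?h ` U) (?h x)) borel (\<lambda>x. x)) = (\<integral>z. f z \<partial>distr (M U x) borel ?h)"
    by simp
  then show ?thesis
    unfolding H_inside[OF U] H_inside[OF U'] using f'
    by (simp add: integral_distr[OF i] integral_distr[OF h] comp_def)
qed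

lemma bounded_borel_homothety:
  fixes f :: "'a \<Rightarrow> real"
  shows "bounded_borel f \<Longrightarrow> bounded_borel (f \<circ> homothety v k)"
  using measurable_compose[OF measurable_homothety[of v k], of f borel]
  by (auto simp: bounded_borel_def comp_def)

text \<open>One constant serves all open sets and all balls: on \<open>ball b d\<close> the function
  \<open>H U f\<close> is the extension of its own values, and a homothety carries this ball to the
  unit ball, where \<open>Harnack_compact\<close> applies.\<close>

lemma Harnack_ball:
  obtains C where "C \<ge> 1"
    "\<And>U f a b d. bdd_open U \<Longrightarrow> bounded_borel f \<Longrightarrow> (\<And>z. z \<in> frontier U \<Longrightarrow> 0 \<le> f z) \<Longrightarrow>
       d > 0 \<Longrightarrow> cball b d \<subseteq> U \<Longrightarrow> dist a b \<le> d / 2 \<Longrightarrow> H U f a \<le> C * H U f b"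
proof -
  have B: "bdd_open (ball (0::'a) 1)" by (auto simp: bdd_open_def)
  obtain C where C: "C > 0"
    "\<And>x f. x \<in> cball 0 (1/2) \<Longrightarrow> bounded_borel f \<Longrightarrow> (\<And>z. z \<in> frontier (ball 0 1) \<Longrightarrow> 0 \<le> f z) \<Longrightarrow>
       H (ball (0::'a) 1) f x \<le> C * H (ball 0 1) f 0"
  proof (rule Harnack_compact[OF B, of 0 "cball 0 (1/2)"])
    show "cball (0::'a) (1/2) \<subseteq> ball 0 1" by auto
  qed auto
  show ?thesis
  proof (rule that[of "max C 1"])
    fix U f and a b :: 'a and d :: real
    assume U: "bdd_open U" and f: "bounded_borel f" "\<And>z. z \<in> frontier U \<Longrightarrow> 0 \<le> f z"
      and d: "d > 0" "cball b d \<subseteq> U" "dist a b \<le> d / 2"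
    let ?h = "homothety b d"
    have hb: "?h ` ball 0 1 = ball b d" using homothety_ball[of d b 1] d by simp
    have sub: "ball b d \<subseteq> U" using d ball_subset_cball by blast
    have eq: "H U f (?h x) = H (ball 0 1) (H U f \<circ> ?h) x" if "x \<in> ball 0 1" for x
    proof -
      have "?h x \<in> ball b d" using that hb by blast
      then have "H U f (?h x) = H (ball b d) (H U f) (?h x)"
        using bdd_open_homothety[OF B, of d b] d hb
        by (intro compatible[OF U _ sub f(1)]) auto
      then show ?thesis
        using H_homothety[OF B that, of d "H U f" b] d bounded_borel_H[OF U f(1)] hb by auto
    qed
    define x where "x = (1/d) *\<^sub>R (a - b)"
    have "norm x = norm (a - b) / d" using d by (simp add: x_def)
    then have x: "?h x = a" "?h 0 = b" "x \<in> cball 0 (1/2)"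
      using d by (auto simp: x_def homothety_def dist_norm divide_simps)
    have "H U f a = H (ball 0 1) (H U f \<circ> ?h) x" using eq[of x] x by auto
    also have "\<dots> \<le> C * H (ball 0 1) (H U f \<circ> ?h) 0"
      using x(3) f U bounded_borel_homothety bounded_borel_H by (intro C(2)) (auto intro!: H_nonneg)
    also have "\<dots> = C * H U f b" using eq[of 0] x by auto
    also have "\<dots> \<le> max C 1 * H U f b" using H_nonneg[of U f b] f by (intro mult_right_mono) auto
    finally show "H U f a \<le> max C 1 * H U f b" .
  qed simp
qed

text \<open>Walk from \<open>b\<close> to \<open>a\<close> in steps of length \<open>d / 2\<close>,
  each costing one factor \<open>C\<close>.\<close>

lemma Harnack_segment:
  obtains C where "C \<ge> 1"
    "\<And>n U f (a::'a) b d. bdd_open U \<Longrightarrow> bounded_borel f \<Longrightarrow> (\<And>z. z \<in> frontier U \<Longrightarrow> 0 \<le> f z) \<Longrightarrow>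
       d > 0 \<Longrightarrow> (\<And>z. z \<in> closed_segment a b \<Longrightarrow> cball z d \<subseteq> U) \<Longrightarrow> dist a b \<le> real n * d / 2 \<Longrightarrow>
       H U f a \<le> C ^ n * H U f b"
proof -
  obtain C where C: "C \<ge> 1"
    "\<And>U f a b d. bdd_open U \<Longrightarrow> bounded_borel f \<Longrightarrow> (\<And>z. z \<in> frontier U \<Longrightarrow> 0 \<le> f z) \<Longrightarrow>
       d > 0 \<Longrightarrow> cball b d \<subseteq> U \<Longrightarrow> dist a b \<le> d / 2 \<Longrightarrow> H U f a \<le> C * H U f b"
    using Harnack_ball by blast
  show ?thesis
  proof (rule that[OF C(1)])
    fix n :: nat and U f and a b :: 'a and d :: real
    assume U: "bdd_open U" and f: "bounded_borel f" "\<And>z. z \<in> frontier U \<Longrightarrow> 0 \<le> f z" and d: "d > 0"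
      and "\<And>z. z \<in> closed_segment a b \<Longrightarrow> cball z d \<subseteq> U" "dist a b \<le> real n * d / 2"
    then show "H U f a \<le> C ^ n * H U f b"
    proof (induction n arbitrary: b)
      case (Suc n)
      note nonneg = H_nonneg[of U f, OF f(2)]
      show ?case
      proof (cases "dist a b \<le> d / 2")
        case True
        then have "H U f a \<le> C * H U f b" using Suc.prems by (intro C(2)[where d=d]) auto
        also have "\<dots> \<le> C ^ Suc n * H U f b"
          using self_le_power[of C "Suc n"] C(1) nonneg by (intro mult_right_mono) auto
        finally show ?thesis .
      next
        case False
        \<comment> \<open>\<open>c\<close> is the point of the segment at distance
          \<open>d / 2\<close> from \<open>b\<close>; the induction hypothesis covers the rest of
          the way from \<open>c\<close> to \<open>a\<close>.\<close>
        define t where "t = d / 2 / dist a b"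
        define c where "c = b + t *\<^sub>R (a - b)"
        have t: "0 \<le> t" "t \<le> 1" "t * dist a b = d / 2" 
          using False d by (auto simp: t_def divide_simps simp del: dist_eq_0_iff zero_less_dist_iff)
        have c: "c \<in> closed_segment a b"
          unfolding in_segment using t
          by (intro exI[of _ "1 - t"]) (auto simp: c_def algebra_simps)
        have "dist c b = d / 2" using t by (simp add: c_def dist_norm)
        moreover have "a - c = (1 - t) *\<^sub>R (a - b)" by (simp add: c_def algebra_simps)
        then have "dist a c = (1 - t) * dist a b"
          unfolding dist_norm using t by (simp only: norm_scaleR abs_of_nonneg diff_ge_0_iff_ge)
        then have "dist a c = dist a b - d / 2" using t(3) by (simp add: left_diff_distrib)
        moreover have "closed_segment a c \<subseteq> closed_segment a b"
          using c by (simp add: subset_closed_segment)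
        moreover have "b \<in> closed_segment a b" by simp
        ultimately have b: "dist c b \<le> d / 2" "cball b d \<subseteq> U" "dist a c \<le> real n * d / 2"
          "\<And>z. z \<in> closed_segment a c \<Longrightarrow> cball z d \<subseteq> U"
          using Suc.prems(5,6) by (simp_all add: algebra_simps) blast+
        have "H U f a \<le> C ^ n * H U f c"
          by (rule Suc.IH) (use Suc.prems b in blast)+
        moreover have "H U f c \<le> C * H U f b"
          by (rule C(2)[where d=d]) (use Suc.prems b in blast)+
        moreover have "C ^ n * H U f c \<le> C ^ n * (C * H U f b)"
          using C(1) calculation(2) by (intro mult_left_mono) auto
        ultimately show ?thesis by (simp add: mult_ac)
      qed
    qed auto
  qed
qed

end

section \<open>Annuli\<close>

lemma abs_diff_mult_add:
  fixes x y :: real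
  assumes "0 \<le> x" "0 \<le> y" shows "\<bar>x - y\<bar> * (x + y) = \<bar>x\<^sup>2 - y\<^sup>2\<bar>"
proof -
  have "x\<^sup>2 - y\<^sup>2 = (x - y) * (x + y)" by (simp add: power2_eq_square algebra_simps)
  then show ?thesis using assms by (simp add: abs_mult)
qed

lemma power2_less_iff_nonneg:
  fixes x y :: real
  assumes "0 \<le> x" "0 \<le> y" shows "x\<^sup>2 < y\<^sup>2 \<longleftrightarrow> x < y"
  using assms by (meson power2_less_imp_less power_strict_mono pos2)

text \<open>The height of a sphere of radius \<open>a\<close> over a central hyperplane, as a graph
  function for the annulus. Capping \<open>norm w\<close> at \<open>a / 2\<close> keeps the root at
  least \<open>a / 2\<close>, which makes the function Lipschitz on the whole hyperplane, as
  \<open>lipschitz_graph_at\<close> demands.\<close>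

lemma lipschitz_on_spherical_cap:
  fixes X :: "'a::real_normed_vector set"
  assumes "a > 0"
  shows "1-lipschitz_on X (\<lambda>w. sqrt (a\<^sup>2 - (min (norm w) (a/2))\<^sup>2))"
proof (rule lipschitz_onI)
  fix x y :: 'a
  let ?m = "\<lambda>w::'a. min (norm w) (a/2)"
  let ?s = "\<lambda>w::'a. sqrt (a\<^sup>2 - (?m w)\<^sup>2)"
  have m: "0 \<le> ?m w" "?m w \<le> a/2" for w using assms by auto
  have sq: "(?m w)\<^sup>2 \<le> (a/2)\<^sup>2" for w using m[of w] by (intro power_mono) auto
  have sq': "(a/2)\<^sup>2 \<le> a\<^sup>2 - (?m w)\<^sup>2" for w
  proof -
    have "(a/2)\<^sup>2 = a\<^sup>2 / 4" by (simp add: power_divide)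
    then show ?thesis using sq[of w] zero_le_power2[of a] by linarith
  qed
  then have s: "a/2 \<le> ?s w" for w by (rule real_le_rsqrt)
  have s2: "(?s w)\<^sup>2 = a\<^sup>2 - (?m w)\<^sup>2" for w
    by (rule real_sqrt_pow2[OF order_trans[OF zero_le_power2 sq']])
  have "\<bar>?s x - ?s y\<bar> * (?s x + ?s y) = \<bar>(?s x)\<^sup>2 - (?s y)\<^sup>2\<bar>"
    using s[of x] s[of y] assms by (intro abs_diff_mult_add) linarith+
  also have "\<dots> = \<bar>?m x - ?m y\<bar> * (?m x + ?m y)"
    unfolding s2 abs_diff_mult_add[OF m(1) m(1)] by simp
  also have "\<dots> \<le> \<bar>?m x - ?m y\<bar> * a"
    using m[of x] m[of y] by (intro mult_left_mono) auto
  finally have 1: "\<bar>?s x - ?s y\<bar> * (?s x + ?s y) \<le> \<bar>?m x - ?m y\<bar> * a" .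
  have "\<bar>?s x - ?s y\<bar> * a \<le> \<bar>?s x - ?s y\<bar> * (?s x + ?s y)"
    using s[of x] s[of y] by (intro mult_left_mono) auto
  with 1 have "\<bar>?s x - ?s y\<bar> * a \<le> \<bar>?m x - ?m y\<bar> * a" by linarith
  then have "\<bar>?s x - ?s y\<bar> \<le> \<bar>?m x - ?m y\<bar>" using assms by simp
  also have "\<dots> \<le> norm (x - y)" using norm_triangle_ineq3[of x y] by auto
  finally show "dist (?s x) (?s y) \<le> 1 * dist x y" by (simp add: dist_norm)
qed simp

definition annulus :: "real \<Rightarrow> 'a::real_normed_vector set" where
  "annulus R = {y. 1 < norm y \<and> norm y < R}"

lemma open_annulus: "open (annulus R)"
  unfolding annulus_def by (intro open_Collect_conj open_Collect_less continuous_intros)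

lemma bdd_open_annulus:
  assumes "R \<ge> 2" shows "bdd_open (annulus R :: 'a::euclidean_space set)"
proof -
  obtain e :: 'a where "norm e = 1" by (meson norm_Basis nonempty_Basis ex_in_conv)
  then have "(3/2) *\<^sub>R e \<in> annulus R" using assms by (auto simp: annulus_def)
  moreover have "bounded (annulus R :: 'a set)"
    by (rule bounded_subset[OF bounded_ball[of 0 R]]) (auto simp: annulus_def)
  ultimately show ?thesis using open_annulus by (auto simp: bdd_open_def)
qed

lemma connected_norm_annulus:
  "2 \<le> DIM('a) \<Longrightarrow> connected (annulus R :: 'a::euclidean_space set)"
  using connected_annulus(1)[where a="0::'a" and ?r1.0=1 and ?r2.0=R] by (simp add: annulus_def)

lemma frontier_annulus:
  assumes "R \<ge> 2"
  shows "frontier (annulus R) = {y::'a::euclidean_space. norm y = 1 \<or> norm y = R}"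
proof -
  have "closure (annulus R) \<subseteq> {y::'a. 1 \<le> norm y \<and> norm y \<le> R}"
    by (rule closure_minimal)
      (auto simp: annulus_def intro!: closed_Collect_conj closed_Collect_le continuous_intros)
  moreover have "y \<in> closure (annulus R)" if "norm y = 1 \<or> norm y = R" for y :: 'a
  proof -
    \<comment> \<open>Points of the inner sphere are approached by moving outwards, points of the
      outer one by moving inwards. The shift by 4 below gives \<open>q \<le> 1/4\<close>, so that
      \<open>(1 - q) * R > 1\<close> because of \<open>R \<ge> 2\<close>.\<close>
    define \<sigma> where "\<sigma> = (if norm y = 1 then 1 else -1 :: real)"
    have "(\<lambda>n. (1 + \<sigma> * (1 / real (n + 4))) *\<^sub>R y) \<longlonglongrightarrow> (1 + \<sigma> * 0) *\<^sub>R y"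
      by (intro tendsto_intros LIMSEQ_ignore_initial_segment[OF lim_1_over_n])
    moreover have "(1 + \<sigma> * (1 / real (n + 4))) *\<^sub>R y \<in> annulus R" for n
    proof -
      define q where "q = 1 / real (n + 4)"
      have q: "0 < q" "q \<le> 1/4" by (auto simp: q_def field_simps)
      then have n: "norm ((1 + \<sigma> * q) *\<^sub>R y) = (1 + \<sigma> * q) * norm y" by (auto simp: \<sigma>_def)
      show ?thesis
      proof (cases "norm y = 1")
        case True
        then show ?thesis using n q assms unfolding annulus_def q_def[symmetric] by (auto simp: \<sigma>_def)
      next
        case False
        then have y: "norm y = R" using that by auto
        have "1 < (1 - 1/4) * R" using assms by auto
        also have "\<dots> \<le> (1 - q) * R" using q assms by (intro mult_right_mono) auto
        finally have "1 < (1 - q) * R" .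
        moreover have "(1 - q) * R < R" using q assms by (simp add: algebra_simps)
        ultimately show ?thesis
          using n False y unfolding annulus_def q_def[symmetric] by (auto simp: \<sigma>_def)
      qed
    qed
    ultimately show ?thesis unfolding closure_sequential by (intro exI conjI allI) auto
  qed
  moreover have "annulus R \<subseteq> closure (annulus R :: 'a set)" by (rule closure_subset)
  ultimately show ?thesis
    unfolding frontier_def interior_open[OF open_annulus]
    by (force simp: annulus_def)
qed

text \<open>The axis points away from the centre, into the annulus, and by Pythagoras the position
  relative to the sphere is decided by comparing \<open>1 + t\<close> with the height of the
  cap.\<close>

lemma lipschitz_graph_at_annulus_inner:
  fixes Q :: "'a::euclidean_space"
  assumes "R \<ge> 2" "norm Q = 1"
  shows "lipschitz_graph_at (annulus R) 1 Q Q"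
  unfolding lipschitz_graph_at_def
proof (intro conjI exI[of _ "\<lambda>w. sqrt (1\<^sup>2 - (min (norm w) (1/2))\<^sup>2) - 1"] exI[of _ "1/4"]
    allI impI)
  show "1-lipschitz_on {w. w \<bullet> Q = 0} (\<lambda>w. sqrt (1\<^sup>2 - (min (norm w) (1/2))\<^sup>2) - 1)"
    using lipschitz_on_spherical_cap[of 1 "{w. w \<bullet> Q = 0}"] by (auto simp: lipschitz_on_def dist_norm)
  fix w :: 'a and t :: real assume "w \<bullet> Q = 0" "norm w < 1/4" and t: "\<bar>t\<bar> < 1/4"
  then have w: "w \<bullet> Q = 0" "norm w < 1/2" by auto
  let ?y = "Q + w + t *\<^sub>R Q"
  have QQ: "Q \<bullet> Q = 1" using assms by (simp add: dot_square_norm)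
  have "(norm ?y)\<^sup>2 = (1 + t)\<^sup>2 + (norm w)\<^sup>2"
    using w QQ unfolding power2_norm_eq_inner
    by (simp add: inner_add_left inner_add_right inner_commute[of Q w] power2_eq_square algebra_simps)
  then have n: "norm ?y = sqrt ((1 + t)\<^sup>2 + (norm w)\<^sup>2)" by (metis norm_ge_zero real_sqrt_unique)
  have w2: "(norm w)\<^sup>2 < (1/2)\<^sup>2" using w by (intro power_strict_mono) auto
  \<comment> \<open>The window is so small that the outer sphere is out of reach.\<close>
  have less: "norm ?y < R"
    using norm_triangle_ineq[of "Q + w" "t *\<^sub>R Q"] norm_triangle_ineq[of Q w] assms w t by auto
  define \<psi> where "\<psi> = sqrt (1 - (norm w)\<^sup>2)"
  have \<psi>: "\<psi> \<ge> 0" "\<psi>\<^sup>2 = 1 - (norm w)\<^sup>2" using w2 by (auto simp: \<psi>_def power_divide)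
  have "1 < norm ?y \<longleftrightarrow> \<psi>\<^sup>2 < (1 + t)\<^sup>2" "norm ?y = 1 \<longleftrightarrow> \<psi>\<^sup>2 = (1 + t)\<^sup>2"
    unfolding n \<psi> by (auto simp: real_sqrt_eq_1_iff)
  moreover have "\<psi>\<^sup>2 < (1 + t)\<^sup>2 \<longleftrightarrow> \<psi> < 1 + t" "\<psi>\<^sup>2 = (1 + t)\<^sup>2 \<longleftrightarrow> \<psi> = 1 + t"
    using \<psi>(1) t by (auto simp: power2_eq_iff_nonneg power2_less_iff_nonneg)
  ultimately show "?y \<in> annulus R \<longleftrightarrow> sqrt (1\<^sup>2 - (min (norm w) (1/2))\<^sup>2) - 1 < t"
    "?y \<in> frontier (annulus R) \<longleftrightarrow> t = sqrt (1\<^sup>2 - (min (norm w) (1/2))\<^sup>2) - 1"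
    using less w unfolding frontier_annulus[OF assms(1)] by (auto simp: annulus_def \<psi>_def)
qed (use assms in auto)

text \<open>Now the annulus lies on the side of the centre, hence the sign of the axis;
  \<open>R - t > 1\<close> in the window keeps the inner sphere away.\<close>

lemma lipschitz_graph_at_annulus_outer:
  fixes Q :: "'a::euclidean_space"
  assumes "R \<ge> 2" "norm Q = R"
  shows "lipschitz_graph_at (annulus R) 1 Q (- (1/R) *\<^sub>R Q)"
  unfolding lipschitz_graph_at_def
proof (intro conjI exI[of _ "\<lambda>w. R - sqrt (R\<^sup>2 - (min (norm w) (R/2))\<^sup>2)"] exI[of _ "R/4"]
    allI impI)
  define e where "e = - (1/R) *\<^sub>R Q"
  have ee: "e \<bullet> e = 1" "Q = (-R) *\<^sub>R e" "norm e = 1"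
    using assms by (auto simp: e_def dot_square_norm power2_eq_square)
  show "1-lipschitz_on {w. w \<bullet> (- (1/R) *\<^sub>R Q) = 0} (\<lambda>w. R - sqrt (R\<^sup>2 - (min (norm w) (R/2))\<^sup>2))"
    using lipschitz_on_spherical_cap[of R "{w. w \<bullet> (- (1/R) *\<^sub>R Q) = 0}"] assms
    by (auto simp: lipschitz_on_def dist_norm abs_minus_commute)
  fix w :: 'a and t :: real assume "w \<bullet> (- (1/R) *\<^sub>R Q) = 0" and "norm w < R/4" and t: "\<bar>t\<bar> < R/4"
  then have w: "w \<bullet> e = 0" "norm w < R/2" using assms by (auto simp: e_def)
  let ?y = "Q + w + t *\<^sub>R (- (1/R) *\<^sub>R Q)"
  have y: "?y = w + (t - R) *\<^sub>R e" unfolding e_def[symmetric] by (subst ee(2)) (simp add: algebra_simps)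
  have "(norm ?y)\<^sup>2 = (R - t)\<^sup>2 + (norm w)\<^sup>2"
    using w ee(1) unfolding power2_norm_eq_inner y
    by (simp add: inner_add_left inner_add_right inner_commute[of e w] power2_eq_square algebra_simps)
  then have n: "norm ?y = sqrt ((R - t)\<^sup>2 + (norm w)\<^sup>2)" by (metis norm_ge_zero real_sqrt_unique)
  have w2: "(norm w)\<^sup>2 < (R/2)\<^sup>2" using w by (intro power_strict_mono) auto
  have "1 < R - t" using assms t by auto
  also have "R - t \<le> norm ?y" unfolding n by (intro real_le_rsqrt) auto
  finally have gt: "1 < norm ?y" .
  define \<psi> where "\<psi> = sqrt (R\<^sup>2 - (norm w)\<^sup>2)"
  have \<psi>: "\<psi> \<ge> 0" "\<psi>\<^sup>2 = R\<^sup>2 - (norm w)\<^sup>2"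
    using w assms by (auto simp: \<psi>_def)
  have "norm ?y < R \<longleftrightarrow> (norm ?y)\<^sup>2 < R\<^sup>2" "norm ?y = R \<longleftrightarrow> (norm ?y)\<^sup>2 = R\<^sup>2"
    using assms by (auto simp: power2_eq_iff_nonneg power2_less_iff_nonneg)
  then have "norm ?y < R \<longleftrightarrow> (R - t)\<^sup>2 < \<psi>\<^sup>2" "norm ?y = R \<longleftrightarrow> (R - t)\<^sup>2 = \<psi>\<^sup>2"
    unfolding \<psi> \<open>(norm ?y)\<^sup>2 = _\<close> by auto
  moreover have "(R - t)\<^sup>2 < \<psi>\<^sup>2 \<longleftrightarrow> R - t < \<psi>" "(R - t)\<^sup>2 = \<psi>\<^sup>2 \<longleftrightarrow> R - t = \<psi>"
    using \<psi>(1) t assms by (auto simp: power2_eq_iff_nonneg power2_less_iff_nonneg)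
  ultimately show "?y \<in> annulus R \<longleftrightarrow> R - sqrt (R\<^sup>2 - (min (norm w) (R/2))\<^sup>2) < t"
    "?y \<in> frontier (annulus R) \<longleftrightarrow> t = R - sqrt (R\<^sup>2 - (min (norm w) (R/2))\<^sup>2)"
    using gt w unfolding frontier_annulus[OF assms(1)] by (auto simp: annulus_def \<psi>_def)
qed (use assms in auto)

lemma lipschitz_domain_annulus:
  assumes "R \<ge> 2" "2 \<le> DIM('a)"
  shows "lipschitz_domain (annulus R :: 'a::euclidean_space set)"
proof -
  have "\<exists>e. lipschitz_graph_at (annulus R) 1 Q e" if "Q \<in> frontier (annulus R)" for Q :: 'a
    using that lipschitz_graph_at_annulus_inner[OF assms(1), of Q]
      lipschitz_graph_at_annulus_outer[OF assms(1), of Q] frontier_annulus[OF assms(1)] by blast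
  then show ?thesis
    using bdd_open_annulus[OF assms(1)] connected_norm_annulus[OF assms(2)]
    unfolding lipschitz_domain_def bdd_open_def by blast
qed

section \<open>The lower bound in an annulus\<close>

context harmonic_system begin

text \<open>Otherwise there are points \<open>Y n\<close> where the harmonic measure of the inner
  sphere tends to 0. A limit point on that sphere contradicts regularity there. At a limit point
  inside, the harmonic measure vanishes, hence by Harnack it vanishes on the whole annulus, again
  contradicting regularity on the inner sphere.\<close>

lemma annulus_lower_bound:
  assumes R: "R \<ge> 2"
  obtains c where "c > 0"
    "\<And>y. 1 < norm y \<Longrightarrow> norm y \<le> R / 2 \<Longrightarrow> c \<le> H (annulus R) (indicator (cball 0 1)) y"
proof (rule ccontr)
  let ?G = "annulus R :: 'a set" let ?f = "indicat_real (cball (0::'a) 1)"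
  let ?u = "H ?G ?f"
  assume neg: "\<not> thesis"
  have G: "bdd_open ?G" by (rule bdd_open_annulus[OF R])
  have f: "bounded_borel ?f" by auto
  have "\<exists>y. 1 < norm y \<and> norm y \<le> R / 2 \<and> ?u y < inverse (real (Suc n))" for n
    using that[of "inverse (real (Suc n))"] neg by (force simp: not_le)
  then obtain Y where Y: "\<And>n. 1 < norm (Y n)" "\<And>n. norm (Y n) \<le> R / 2" "\<And>n. ?u (Y n) < inverse (real (Suc n))"
    by metis
  have YG: "Y n \<in> ?G" for n using Y(1,2)[of n] R by (auto simp: annulus_def)
  have "\<forall>n. Y n \<in> cball 0 (R / 2)" using Y by auto
  then obtain l r where l: "l \<in> cball 0 (R/2)" "strict_mono r" "(Y \<circ> r) \<longlonglongrightarrow> l"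
    using compact_cball unfolding compact_def by metis
  have u0: "(\<lambda>n. ?u ((Y \<circ> r) n)) \<longlonglongrightarrow> 0"
  proof (rule tendsto_sandwich[of "\<lambda>n. 0"])
    have "(\<lambda>n. inverse (real (Suc (r n)))) \<longlonglongrightarrow> 0"
      using LIMSEQ_subseq_LIMSEQ[OF LIMSEQ_inverse_real_of_nat l(2)] by (simp add: comp_def)
    then show "(\<lambda>n. inverse (real (Suc (r n)))) \<longlonglongrightarrow> 0" .
    show "\<forall>\<^sub>F n in sequentially. ?u ((Y \<circ> r) n) \<le> inverse (real (Suc (r n)))"
      unfolding comp_def by (intro always_eventually allI less_imp_le Y(3))
    show "\<forall>\<^sub>F n in sequentially. 0 \<le> ?u ((Y \<circ> r) n)" by (intro always_eventually allI H_nonneg) auto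
  qed simp
  have "(\<lambda>n. norm ((Y \<circ> r) n)) \<longlonglongrightarrow> norm l" by (intro tendsto_norm l)
  then have "1 \<le> norm l" by (rule LIMSEQ_le_const) (use Y(1) in \<open>auto intro: less_imp_le\<close>)
  have reg: "(\<lambda>n. ?u (X n)) \<longlonglongrightarrow> 1" if z: "norm z = 1" and X: "\<And>n. X n \<in> ?G" "X \<longlonglongrightarrow> z" for z X
  proof -
    have fr: "z \<in> frontier ?G" using z frontier_annulus[OF R] by auto
    have "\<forall>\<^sub>F x in at z within frontier ?G. ?f x = 1"
      unfolding eventually_at
    \<comment> \<open>Within distance 1 of the inner sphere there is no point of the outer one, as
      \<open>R \<ge> 2\<close>; so the indicator is locally constant on the boundary.\<close>
    proof (intro exI[of _ 1] conjI ballI impI)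
      fix x assume "x \<in> frontier ?G" "x \<noteq> z \<and> dist x z < 1"
      then have "norm x = 1" using frontier_annulus[OF R] norm_triangle_ineq2[of x z] z R
        by (auto simp: dist_norm)
      then show "?f x = 1" by auto
    qed simp
    then have "continuous (at z within frontier ?G) ?f"
      unfolding continuous_within using z tendsto_eventually by fastforce
    moreover have "regular_point ?G (\<Omega> ?G) z"
      using regular[OF lipschitz_domain_annulus[OF R dim2]] G fr by (auto simp: regular_domain_def bdd_open_def)
    ultimately have "(\<lambda>n. hm_integral ?G (\<Omega> ?G) ?f (X n)) \<longlonglongrightarrow> ?f z"
      using X hm_integrable[OF G f] unfolding regular_point_def by blast
    moreover have "hm_integral ?G (\<Omega> ?G) ?f (X n) = ?u (X n)" for n
      using X(1) closure_subset[of ?G] by (auto simp: H_def)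
    ultimately show ?thesis using z by simp
  qed
  show False
  proof (cases "norm l = 1")
    case True
    have "(\<lambda>n. ?u ((Y \<circ> r) n)) \<longlonglongrightarrow> 1" by (rule reg[OF True _ l(3)]) (use YG in auto)
    with u0 show False using LIMSEQ_unique by fastforce
  next
    case False
    then have lG: "l \<in> ?G" using \<open>1 \<le> norm l\<close> l(1) R by (auto simp: annulus_def)
    have "isCont ?u l"
      using H_continuous[OF G f] lG continuous_on_eq_continuous_at[OF open_annulus, where f="?u"] by blast
    then have "(\<lambda>n. ?u ((Y \<circ> r) n)) \<longlonglongrightarrow> ?u l" by (rule isCont_tendsto_compose[OF _ l(3)])
    then have ul: "?u l = 0" using u0 LIMSEQ_unique by blast
    have zero: "?u x = 0" if xG: "x \<in> ?G" for x
    proof -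
      obtain C where "?u x \<le> C * ?u l"
      proof (rule Harnack_compact[OF G connected_norm_annulus[OF dim2] lG, of "{x}"])
        fix C assume C: "\<And>y f. y \<in> {x} \<Longrightarrow> bounded_borel f \<Longrightarrow> (\<And>z. z \<in> frontier ?G \<Longrightarrow> 0 \<le> f z) \<Longrightarrow>
             H ?G f y \<le> C * H ?G f l"
        have "?u x \<le> C * ?u l" by (rule C) auto
        then show thesis using that by blast
      qed (use xG in auto)
      then show ?thesis using ul H_nonneg[of ?G ?f x] by auto
    qed
    obtain z :: 'a where z: "norm z = 1" by (meson norm_Basis nonempty_Basis ex_in_conv)
    then have "z \<in> closure ?G" using frontier_annulus[OF R] by (auto simp: frontier_def)
    then obtain X where X: "\<And>n. X n \<in> ?G" "X \<longlonglongrightarrow> z" unfolding closure_sequential by blast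
    have "(\<lambda>n. ?u (X n)) \<longlonglongrightarrow> 1" by (rule reg[OF z X])
    then show False using zero X(1) by (simp add: LIMSEQ_const_iff)
  qed
qed

end

section \<open>The gauge of a starlike Lipschitz domain\<close>

text \<open>The Minkowski functional of a domain that may fail to be convex: dilates of
  \<open>D\<close> are sublevel sets by homogeneity, and the Lipschitz bound stands in for the
  triangle inequality. \<open>1 - N x\<close> serves as the depth of \<open>x\<close> in
  \<open>D\<close>.\<close>

locale starlike_gauge =
  fixes D :: "'a::euclidean_space set" and N :: "'a \<Rightarrow> real" and \<Lambda> b :: real
  assumes D_eq: "D = {x. N x < 1}"
    and frontier_eq: "frontier D = {x. N x = 1}"
    and N_scaleR: "\<And>t x. 0 \<le> t \<Longrightarrow> N (t *\<^sub>R x) = t * N x"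
    and N_pos: "\<And>x. x \<noteq> 0 \<Longrightarrow> 0 < N x"
    and N_lipschitz: "\<And>x y. \<bar>N x - N y\<bar> \<le> \<Lambda> * dist x y"
    and norm_le_N: "\<And>x. norm x \<le> b * N x"
    and \<Lambda>_pos: "0 < \<Lambda>" and b_pos: "0 < b"

section \<open>Construction of the gauge\<close>

context
  fixes D :: "'a::euclidean_space set"
  assumes bD: "bounded D" and D0: "0 \<in> D" and star: "starlike_lipschitz_domain 0 D"
begin

private lemma openD: "open D"
  using star by (auto simp: starlike_lipschitz_domain_def lipschitz_domain_def)

private lemma zero_frontier: "0 \<notin> frontier D"
  using openD D0 by (auto simp: frontier_def interior_open)

text \<open>The parameter at which the ray through \<open>x\<close> crosses the boundary; its
  reciprocal is homogeneous of degree 1.\<close>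

private definition T :: "'a \<Rightarrow> real" where "T x = (THE t. 0 < t \<and> t *\<^sub>R x \<in> frontier D)"

private definition N :: "'a \<Rightarrow> real" where "N x = (if x = 0 then 0 else 1 / T x)"

private lemma ex1_T: assumes "x \<noteq> 0" shows "\<exists>!t. 0 < t \<and> t *\<^sub>R x \<in> frontier D"
proof -
  have ex1: "\<exists>!X. X \<in> frontier D \<and> (\<exists>t\<ge>0. X = 0 + t *\<^sub>R x)"
    using star assms by (auto simp: starlike_lipschitz_domain_def)
  then obtain t where t: "t \<ge> 0" "t *\<^sub>R x \<in> frontier D" by auto
  show ?thesis
  proof (rule ex1I[of _ t])
    show "0 < t \<and> t *\<^sub>R x \<in> frontier D"
      using t zero_frontier by (cases "t = 0") auto
    fix s assume "0 < s \<and> s *\<^sub>R x \<in> frontier D"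
    then have "s *\<^sub>R x = t *\<^sub>R x" using ex1 t by (metis add_0 less_imp_le)
    then show "s = t" using assms by simp
  qed
qed

private lemma T: "x \<noteq> 0 \<Longrightarrow> 0 < T x" "x \<noteq> 0 \<Longrightarrow> T x *\<^sub>R x \<in> frontier D"
  using theI'[OF ex1_T] by (auto simp: T_def)

private lemma T_unique: "x \<noteq> 0 \<Longrightarrow> 0 < t \<Longrightarrow> t *\<^sub>R x \<in> frontier D \<Longrightarrow> t = T x"
  using ex1_T T by blast

private lemma N_pos': "x \<noteq> 0 \<Longrightarrow> 0 < N x" using T by (simp add: N_def)

private lemma N_nonneg': "0 \<le> N x" using N_pos'[of x] by (cases "x = 0") (auto simp: N_def)

private lemma N_scaleR': assumes "0 \<le> t" shows "N (t *\<^sub>R x) = t * N x"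
proof (cases "t = 0 \<or> x = 0")
  case False
  then have "T x / t = T (t *\<^sub>R x)" using T[of x] assms by (intro T_unique) auto
  then show ?thesis using False T[of x] assms by (simp add: N_def field_simps)
qed (auto simp: N_def)

text \<open>A segment of a ray with one end in \<open>D\<close> and the other outside meets the
  boundary, which can happen only at the parameter \<open>T x\<close>. The next lemma applies the
  same argument beyond \<open>T x\<close>.\<close>

private lemma inside: assumes "x \<noteq> 0" "0 \<le> t" "t < T x" shows "t *\<^sub>R x \<in> D"
proof (rule ccontr)
  assume neg: "t *\<^sub>R x \<notin> D"
  let ?S = "(\<lambda>s. s *\<^sub>R x) ` {0..t}"
  have "connected ?S" by (intro connected_continuous_image continuous_intros) auto
  moreover have "0 \<in> ?S" "t *\<^sub>R x \<in> ?S" using assms by (auto intro: image_eqI[of _ _ 0])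
  ultimately have "?S \<inter> frontier D \<noteq> {}"
    using neg D0 by (intro connected_Int_frontier) auto
  then obtain s where s: "0 \<le> s" "s \<le> t" "s *\<^sub>R x \<in> frontier D" by auto
  then have "s > 0" using zero_frontier by (cases "s = 0") auto
  then show False using T_unique[OF assms(1) _ s(3)] s assms by auto
qed

private lemma outside: assumes "x \<noteq> 0" "T x < t" shows "t *\<^sub>R x \<notin> D"
proof
  assume D: "t *\<^sub>R x \<in> D"
  obtain B where B: "\<And>y. y \<in> D \<Longrightarrow> norm y \<le> B" using bD by (auto simp: bounded_iff)
  \<comment> \<open>A parameter so large that the ray has left the bounded set
    \<open>D\<close>.\<close>
  define u where "u = max t (B / norm x + 1)"
  have "B < (B / norm x + 1) * norm x" using assms by (simp add: field_simps)
  also have "\<dots> \<le> u * norm x" unfolding u_def by (intro mult_right_mono) auto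
  finally have "B < norm (u *\<^sub>R x)" using T[OF assms(1)] assms(2) by (auto simp: u_def)
  then have "u *\<^sub>R x \<notin> D" using B[of "u *\<^sub>R x"] by (auto simp: not_le)
  let ?S = "(\<lambda>s. s *\<^sub>R x) ` {t..u}"
  have "connected ?S" by (intro connected_continuous_image continuous_intros) auto
  moreover have "u *\<^sub>R x \<in> ?S" "t *\<^sub>R x \<in> ?S" by (auto simp: u_def)
  ultimately have "?S \<inter> frontier D \<noteq> {}"
    using D \<open>u *\<^sub>R x \<notin> D\<close> by (intro connected_Int_frontier) blast+
  then obtain s where s: "t \<le> s" "s *\<^sub>R x \<in> frontier D" by auto
  then show False using T_unique[OF assms(1) _ s(2)] T[OF assms(1)] assms by auto
qed

private lemma mem_frontier_iff: "x \<in> frontier D \<longleftrightarrow> N x = 1"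
proof (cases "x = 0")
  case False
  have "x \<in> frontier D \<longleftrightarrow> T x = 1"
    using T_unique[OF False, of 1] T[OF False] by auto
  then show ?thesis using False T(1)[OF False] by (auto simp: N_def)
qed (use zero_frontier in \<open>auto simp: N_def\<close>)

private lemma mem_D_iff: "x \<in> D \<longleftrightarrow> N x < 1"
proof (cases "x = 0")
  case False
  have "x \<in> D \<longleftrightarrow> 1 < T x"
  proof (cases "T x" "1::real" rule: linorder_cases)
    case equal
    then show ?thesis using T(2)[OF False] openD by (auto simp: frontier_def interior_open)
  qed (use inside[OF False, of 1] outside[OF False, of 1] in auto)
  then show ?thesis using False T[OF False] by (simp add: N_def)
qed (use D0 in \<open>auto simp: N_def\<close>)

private lemma mem_closure_iff: "x \<in> closure D \<longleftrightarrow> N x \<le> 1"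
  using mem_D_iff mem_frontier_iff closure_Un_frontier[of D] by auto

private lemma norm_bounds:
  obtains a B where "0 < a" "0 < B" "\<And>x. norm x \<le> B * N x" "\<And>x. N x \<le> norm x / a"
proof -
  obtain a where a: "a > 0" "ball 0 a \<subseteq> D" using openD D0 openE by blast
  obtain B where B: "\<And>y. y \<in> closure D \<Longrightarrow> norm y \<le> B"
    using bounded_closure[OF bD] by (auto simp: bounded_iff)
  show ?thesis
  proof (rule that[OF a(1), of "max B 1"])
    fix x
    show "norm x \<le> max B 1 * N x"
    proof (cases "x = 0")
      case False
      have "norm (T x *\<^sub>R x) \<le> B" using T[OF False] by (intro B) (auto simp: frontier_def)
      then show ?thesis using T[OF False] False by (auto simp: N_def field_simps)
    qed (auto simp: N_def)
    show "N x \<le> norm x / a"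
    proof (cases "x = 0")
      case False
      have "T x *\<^sub>R x \<notin> D" using T[OF False] openD by (auto simp: frontier_def interior_open)
      then have "a \<le> norm (T x *\<^sub>R x)" using a(2) by (meson mem_ball_0 not_le subsetD)
      then show ?thesis using T[OF False] False a by (auto simp: N_def field_simps)
    qed (auto simp: N_def)
  qed auto
qed

text \<open>By homogeneity \<open>{N < c}\<close> is a dilate of the open set \<open>D\<close> and
  \<open>{N \<le> c}\<close> one of its closure, which gives upper and lower semicontinuity.\<close>

private lemma isCont_N: "isCont N x"
  unfolding isCont_def
proof (rule order_tendstoI)
  have scaled: "N y < c \<longleftrightarrow> (1/c) *\<^sub>R y \<in> D" "N y \<le> c \<longleftrightarrow> (1/c) *\<^sub>R y \<in> closure D" if "c > 0" for c y
    using that by (simp_all add: mem_D_iff mem_closure_iff N_scaleR')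
  fix c
  show "\<forall>\<^sub>F y in at x. N y < c" if c: "N x < c"
  proof -
    have "c > 0" using c N_nonneg'[of x] by auto
    have "open {y. (1/c) *\<^sub>R y \<in> D}"
      using open_vimage[OF openD, of "\<lambda>y. (1/c) *\<^sub>R y"] by (simp add: vimage_def continuous_intros)
    then have "open {y. N y < c}" using scaled[OF \<open>c > 0\<close>] by simp
    then show ?thesis using c eventually_at_topological by blast
  qed
  show "\<forall>\<^sub>F y in at x. c < N y" if c: "c < N x"
  proof (cases "c < 0")
    case True then show ?thesis using N_nonneg' by (auto intro!: always_eventually simp: less_le_trans)
  next
    case False
    \<comment> \<open>A positive level between \<open>c\<close> and \<open>N x\<close>: dilation by
      \<open>1 / c\<close> makes no sense for \<open>c = 0\<close>.\<close>
    define d where "d = (c + N x) / 2"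
    have d: "0 < d" "c < d" "d < N x" using False c by (auto simp: d_def)
    have "open {y. (1/d) *\<^sub>R y \<in> - closure D}"
      using open_vimage[of "- closure D" "\<lambda>y. (1/d) *\<^sub>R y"] by (simp add: vimage_def continuous_intros)
    then have "open {y. d < N y}" using scaled(2)[OF \<open>d > 0\<close>] by (simp flip: not_le)
    moreover have "\<forall>y\<in>{y. d < N y}. y \<noteq> x \<longrightarrow> c < N y" using d by auto
    ultimately show ?thesis using d unfolding eventually_at_topological by blast
  qed
qed

text \<open>The axis of the graph at \<open>Q\<close> is the line through \<open>Q\<close> and the
  centre, so nearby rays are transversal to the graph. Moving along a ray changes mainly the height;
  since two boundary points cannot differ in height by more than \<open>L\<close> times their
  horizontal distance, the radial discrepancy is controlled by \<open>dist x y\<close>.\<close>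

private lemma local_lipschitz_N:
  assumes Q: "Q \<in> frontier D"
  obtains \<epsilon> K where "\<epsilon> > 0" "\<And>x y. dist x Q < \<epsilon> \<Longrightarrow> dist y Q < \<epsilon> \<Longrightarrow> \<bar>N x - N y\<bar> \<le> K * dist x y"
proof -
  have NQ: "N Q = 1" "Q \<noteq> 0" using Q mem_frontier_iff zero_frontier by auto
  define e where "e = sgn (0 - Q)"
  obtain L where "lipschitz_graph_at D L Q e"
    using star Q by (auto simp: starlike_lipschitz_domain_def e_def)
  then obtain \<phi> \<rho> h where \<rho>: "\<rho> > 0" "h > 0" and \<phi>: "L-lipschitz_on {w. w \<bullet> e = 0} \<phi>"
    and graph: "\<And>w t. w \<bullet> e = 0 \<Longrightarrow> norm w < \<rho> \<Longrightarrow> \<bar>t\<bar> < h \<Longrightarrow> Q + w + t *\<^sub>R e \<in> frontier D \<longleftrightarrow> t = \<phi> w"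
    unfolding lipschitz_graph_at_def by blast
  have e: "norm e = 1" "e \<bullet> e = 1" "Q = (- norm Q) *\<^sub>R e"
    using NQ by (auto simp: e_def sgn_div_norm norm_sgn dot_square_norm)
  have L: "L \<ge> 0" using \<phi> by (rule lipschitz_on_nonneg)
  define t where "t Z = (Z - Q) \<bullet> e" for Z
  define w where "w Z = (Z - Q) - t Z *\<^sub>R e" for Z
  define q where "q = norm Q"
  have q: "q > 0" using NQ by (simp add: q_def)
  \<comment> \<open>The last term makes the deviations of \<open>Z2\<close> from \<open>Q\<close> in
    height and, times \<open>L\<close>, in the horizontal direction small compared with
    \<open>q\<close>.\<close>
  define \<epsilon>0 where "\<epsilon>0 = min (min \<rho> h) (q / (4 * (1 + L)))"
  have \<epsilon>0: "\<epsilon>0 > 0" using \<rho> q L by (simp add: \<epsilon>0_def)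
  have we: "w Z \<bullet> e = 0" for Z by (simp add: w_def t_def inner_diff_left e(2))
  have t_le: "\<bar>t Z\<bar> \<le> dist Z Q" for Z
    unfolding t_def dist_norm using Cauchy_Schwarz_ineq2[of "Z - Q" e] e by simp
  have proj: "norm (v - (v \<bullet> e) *\<^sub>R e) \<le> norm v" for v
  proof -
    have "(norm (v - (v \<bullet> e) *\<^sub>R e))\<^sup>2 = (norm v)\<^sup>2 - (v \<bullet> e)\<^sup>2"
      unfolding power2_norm_eq_inner
      by (simp add: inner_diff_left inner_diff_right e(2) inner_commute[of e v] power2_eq_square algebra_simps)
    then have "(norm (v - (v \<bullet> e) *\<^sub>R e))\<^sup>2 \<le> (norm v)\<^sup>2" by simp
    then show ?thesis by (rule power2_le_imp_le) simp
  qed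
  have w_le: "norm (w Z) \<le> dist Z Q" for Z
    using proj[of "Z - Q"] by (simp add: w_def t_def dist_norm)
  have t\<phi>: "t Z = \<phi> (w Z)" if "Z \<in> frontier D" "dist Z Q < \<epsilon>0" for Z
  proof -
    have "Q + w Z + t Z *\<^sub>R e = Z" by (simp add: w_def)
    then show ?thesis
      using graph[OF we, of Z "t Z"] t_le[of Z] w_le[of Z] that by (auto simp: \<epsilon>0_def)
  qed
  have key: "N y - N x \<le> 2 * (1 + L) / q * dist x y"
    if xy: "x \<noteq> 0" "y \<noteq> 0" "N x < N y"
      and near: "dist ((1 / N x) *\<^sub>R x) Q < \<epsilon>0" "dist ((1 / N y) *\<^sub>R y) Q < \<epsilon>0" for x y
  proof -
    define Z1 where "Z1 = (1 / N x) *\<^sub>R x"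
    define Z2 where "Z2 = (1 / N y) *\<^sub>R y"
    \<comment> \<open>\<open>1 + \<eta>\<close> is the quotient \<open>N y / N x\<close>. Stretching
      \<open>Z2\<close> by this factor gives the point that differs from \<open>Z1\<close> by
      \<open>(1 / N x) *\<^sub>R (x - y)\<close>.\<close>
    define \<eta> where "\<eta> = (N y - N x) / N x"
    define d where "d = dist x y / N x"
    have pos: "0 < N x" "0 < N y" using xy N_pos' by auto
    have Z: "Z1 \<in> frontier D" "Z2 \<in> frontier D"
      using pos by (auto simp: Z1_def Z2_def mem_frontier_iff N_scaleR')
    have "\<eta> > 0" using pos xy by (simp add: \<eta>_def)
    have diff: "Z1 - Z2 - \<eta> *\<^sub>R Z2 = (1 / N x) *\<^sub>R (x - y)"
    proof -
      have "Z2 + \<eta> *\<^sub>R Z2 = (1 + \<eta>) *\<^sub>R Z2" by (simp add: algebra_simps)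
      also have "\<dots> = ((1 + \<eta>) / N y) *\<^sub>R y" by (simp add: Z2_def)
      also have "(1 + \<eta>) / N y = 1 / N x" using pos by (simp add: \<eta>_def field_simps)
      finally show ?thesis by (simp add: Z1_def algebra_simps)
    qed
    have nd: "norm (Z1 - Z2 - \<eta> *\<^sub>R Z2) = d" unfolding diff using pos by (simp add: d_def dist_norm)
    have Qe: "Q \<bullet> e = - q" by (subst e(3)) (simp add: e(2) q_def)
    have "(Z1 - Z2 - \<eta> *\<^sub>R Z2) \<bullet> e = (t Z1 - t Z2) - \<eta> * (t Z2 - q)"
      by (simp add: t_def inner_diff_left Qe)
    then have 1: "(t Z1 - t Z2) - \<eta> * (t Z2 - q) \<le> d"
      using Cauchy_Schwarz_ineq2[of "Z1 - Z2 - \<eta> *\<^sub>R Z2" e] e nd by simp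
    have "w Z1 - w Z2 - \<eta> *\<^sub>R w Z2 =
        (Z1 - Z2 - \<eta> *\<^sub>R Z2) - ((Z1 - Z2 - \<eta> *\<^sub>R Z2) \<bullet> e) *\<^sub>R e"
    proof -
      \<comment> \<open>\<open>Q\<close> lies on the axis, so its horizontal part vanishes and
        \<open>w\<close> is the restriction of a linear projection.\<close>
      have "Q - (Q \<bullet> e) *\<^sub>R e = 0" by (subst (1 2) e(3)) (simp add: e(2))
      then have wZ: "w Z = Z - (Z \<bullet> e) *\<^sub>R e" for Z
        by (simp add: w_def t_def inner_diff_left algebra_simps)
      show ?thesis unfolding wZ by (simp add: inner_diff_left algebra_simps)
    qed
    then have "norm (w Z1 - w Z2 - \<eta> *\<^sub>R w Z2) \<le> d" using proj nd by metis
    then have w12: "norm (w Z1 - w Z2) \<le> d + \<eta> * norm (w Z2)"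
      using norm_triangle_ineq2[of "w Z1 - w Z2" "\<eta> *\<^sub>R w Z2"] \<open>\<eta> > 0\<close> by simp
    have "\<bar>t Z1 - t Z2\<bar> \<le> L * norm (w Z1 - w Z2)"
      using lipschitz_onD[OF \<phi>, of "w Z1" "w Z2"] we t\<phi>[OF Z(1)] t\<phi>[OF Z(2)] near
      by (simp add: Z1_def Z2_def dist_norm)
    also have "\<dots> \<le> L * (d + \<eta> * norm (w Z2))" using w12 L by (rule mult_left_mono)
    \<comment> \<open>Vertical and horizontal estimates are combined: the stretching contributes
      about \<open>\<eta> * q\<close> to the height, which the Lipschitz graph cannot
      compensate.\<close>
    finally have "\<eta> * (q - t Z2 - L * norm (w Z2)) \<le> (1 + L) * d"
      using 1 by (simp add: algebra_simps)
    moreover have "q / 2 \<le> q - t Z2 - L * norm (w Z2)"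
    proof -
      have "dist Z2 Q < q / (4 * (1 + L))" using near by (simp add: Z2_def \<epsilon>0_def)
      then have "(1 + L) * dist Z2 Q \<le> q / 4" using L by (simp add: field_simps)
      moreover have "L * norm (w Z2) \<le> L * dist Z2 Q" using w_le L by (rule mult_left_mono)
      ultimately show ?thesis using t_le[of Z2] q by (simp add: algebra_simps)
    qed
    ultimately have "\<eta> * (q / 2) \<le> (1 + L) * d"
      using \<open>\<eta> > 0\<close> mult_left_mono[of "q / 2" "q - t Z2 - L * norm (w Z2)" \<eta>] by linarith
    then have "((N y - N x) * (q / 2)) / N x \<le> ((1 + L) * dist x y) / N x"
      by (simp add: \<eta>_def d_def)
    then have "(N y - N x) * (q / 2) \<le> (1 + L) * dist x y"
      using pos(1) unfolding divide_le_cancel by blast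
    then show ?thesis using q by (simp add: field_simps)
  qed
  have "isCont (\<lambda>x. (1 / N x) *\<^sub>R x) Q"
    using NQ by (intro continuous_intros isCont_N) auto
  then obtain \<delta> where \<delta>: "\<delta> > 0" "\<And>x. dist x Q < \<delta> \<Longrightarrow> dist ((1 / N x) *\<^sub>R x) Q < \<epsilon>0"
    using \<epsilon>0 NQ unfolding continuous_at_eps_delta by auto
  show ?thesis
  \<comment> \<open>\<open>\<delta>\<close> brings the radial projections close to \<open>Q\<close>,
    and \<open>q\<close> keeps the points away from 0.\<close>
  proof (rule that[of "min \<delta> q" "2 * (1 + L) / q"])
    fix x y assume "dist x Q < min \<delta> q" "dist y Q < min \<delta> q"
    then have *: "x \<noteq> 0" "y \<noteq> 0" "dist x Q < \<delta>" "dist y Q < \<delta>"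
      by (auto simp: q_def dist_norm)
    have "0 \<le> 2 * (1 + L) / q * dist x y" using L q by simp
    then show "\<bar>N x - N y\<bar> \<le> 2 * (1 + L) / q * dist x y"
      using key[OF *(1,2) _ \<delta>(2)[OF *(3)] \<delta>(2)[OF *(4)]]
        key[OF *(2,1) _ \<delta>(2)[OF *(4)] \<delta>(2)[OF *(3)]]
      by (cases "N x" "N y" rule: linorder_cases) (auto simp: dist_commute)
  qed (use \<delta> q in auto)
qed

text \<open>Compactness of the boundary turns the local constants into one constant for
  \<open>x\<close> on the boundary and arbitrary \<open>y\<close>; homogeneity then frees
  \<open>x\<close>.\<close>

private lemma lipschitz_N: obtains \<Lambda> where "\<Lambda> > 0" "\<And>x y. \<bar>N x - N y\<bar> \<le> \<Lambda> * dist x y"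
proof -
  obtain a B where aB: "0 < a" "0 < B" "\<And>x. norm x \<le> B * N x" "\<And>x. N x \<le> norm x / a"
    using norm_bounds by blast
  have "\<exists>\<Lambda>>0. \<forall>x\<in>frontier D. \<forall>y. \<bar>N x - N y\<bar> \<le> \<Lambda> * dist x y"
  proof (rule ccontr)
    assume neg: "\<not> ?thesis"
    \<comment> \<open>The summand \<open>1 / a\<close> absorbs the linear growth of
      \<open>N\<close>, so that a violation with factor \<open>Suc k\<close> forces
      \<open>dist (X k) (Y k)\<close> to tend to 0, and both sequences enter one neighbourhood of
      \<open>Q\<close>.\<close>
    have "\<exists>x y. x \<in> frontier D \<and> (real (Suc k) + 1 / a) * dist x y < \<bar>N x - N y\<bar>" for k
    proof -
      have "real (Suc k) + 1 / a > 0" using aB(1) by (simp add: add_pos_pos)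
      then show ?thesis using neg by (force simp: not_le)
    qed
    then obtain X Y where XY: "\<And>k. X k \<in> frontier D"
      "\<And>k. (real (Suc k) + 1 / a) * dist (X k) (Y k) < \<bar>N (X k) - N (Y k)\<bar>"
      by metis
    have small: "dist (X k) (Y k) \<le> (1 + B / a) * inverse (real (Suc k))" for k
    proof -
      have NX: "N (X k) = 1" "norm (X k) \<le> B"
        using XY(1)[of k] mem_frontier_iff aB(3)[of "X k"] by auto
      have "norm (Y k) \<le> B + dist (X k) (Y k)"
        using norm_triangle_ineq2[of "Y k" "X k"] NX by (simp add: dist_norm norm_minus_commute)
      then have "N (Y k) \<le> (B + dist (X k) (Y k)) / a"
        using aB(1) by (intro order_trans[OF aB(4)] divide_right_mono) auto
      then have "\<bar>N (X k) - N (Y k)\<bar> \<le> 1 + (B + dist (X k) (Y k)) / a"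
        using NX N_nonneg'[of "Y k"] aB(1,2) by (auto simp: abs_le_iff)
      then have "real (Suc k) * dist (X k) (Y k) \<le> 1 + B / a"
        using XY(2)[of k] by (simp add: algebra_simps add_divide_distrib)
      then show ?thesis by (simp add: field_simps del: of_nat_Suc)
    qed
    have "compact (frontier D)" by (rule compact_frontier_bounded[OF bD])
    then obtain Q r where Q: "Q \<in> frontier D" "strict_mono r" "(X \<circ> r) \<longlonglongrightarrow> Q"
      using XY(1) unfolding compact_def by metis
    obtain \<epsilon> K where \<epsilon>: "\<epsilon> > 0"
      "\<And>x y. dist x Q < \<epsilon> \<Longrightarrow> dist y Q < \<epsilon> \<Longrightarrow> \<bar>N x - N y\<bar> \<le> K * dist x y"
      using local_lipschitz_N[OF Q(1)] by blast
    have "(\<lambda>k. (1 + B / a) * inverse (real (Suc (r k)))) \<longlonglongrightarrow> (1 + B / a) * 0"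
      by (intro tendsto_intros LIMSEQ_subseq_LIMSEQ[OF LIMSEQ_inverse_real_of_nat Q(2), unfolded comp_def])
    then have "\<forall>\<^sub>F k in sequentially. (1 + B / a) * inverse (real (Suc (r k))) < \<epsilon> / 2"
      using \<epsilon>(1) by (intro order_tendstoD) auto
    moreover have "\<forall>\<^sub>F k in sequentially. dist (X (r k)) Q < \<epsilon> / 2"
      using tendstoD[OF Q(3), of "\<epsilon> / 2"] \<epsilon>(1) by simp
    moreover have "\<forall>\<^sub>F k in sequentially. K < real k"
      using filterlim_real_sequentially unfolding filterlim_at_top_dense by blast
    ultimately have "\<forall>\<^sub>F k in sequentially. False"
    proof eventually_elim
      case (elim k)
      let ?x = "X (r k)" and ?y = "Y (r k)"
      have "dist ?y Q \<le> dist ?x ?y + dist ?x Q" using dist_triangle3[of ?y Q ?x] by simp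
      then have "dist ?y Q < \<epsilon>" "dist ?x Q < \<epsilon>" using elim small[of "r k"] \<epsilon>(1) by linarith+
      then have le: "(real (Suc (r k)) + 1 / a) * dist ?x ?y < K * dist ?x ?y"
        using \<epsilon>(2)[of ?x ?y] XY(2)[of "r k"] by linarith
      then have "real (Suc (r k)) + 1 / a < K"
        using zero_le_dist[of ?x ?y] by (rule mult_right_less_imp_less)
      moreover have "real k \<le> real (r k)" using seq_suble[OF Q(2)] by simp
      moreover have "1 / a > 0" using aB(1) by simp
      ultimately show False using elim by simp
    qed
    then show False by simp
  qed
  then obtain \<Lambda> where \<Lambda>: "\<Lambda> > 0" "\<And>x y. x \<in> frontier D \<Longrightarrow> \<bar>N x - N y\<bar> \<le> \<Lambda> * dist x y" by blast
  have main: "\<bar>N x - N y\<bar> \<le> \<Lambda> * dist x y" if "x \<noteq> 0" for x y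
  proof -
    have pos: "N x > 0" using N_pos' that by auto
    have "\<bar>N ((1 / N x) *\<^sub>R x) - N ((1 / N x) *\<^sub>R y)\<bar> \<le> \<Lambda> * dist ((1 / N x) *\<^sub>R x) ((1 / N x) *\<^sub>R y)"
      using pos by (intro \<Lambda>(2)) (simp add: mem_frontier_iff N_scaleR')
    moreover have "dist ((1 / N x) *\<^sub>R x) ((1 / N x) *\<^sub>R y) = dist x y / N x"
      using pos by (simp add: dist_norm flip: scaleR_diff_right)
    moreover have "N ((1 / N x) *\<^sub>R x) - N ((1 / N x) *\<^sub>R y) = (N x - N y) / N x"
      using pos by (simp add: N_scaleR' diff_divide_distrib)
    ultimately show ?thesis using pos by (simp add: abs_divide divide_le_cancel)
  qed
  have "\<bar>N x - N y\<bar> \<le> \<Lambda> * dist x y" for x y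
    using main[of x y] main[of y x] by (cases "x = 0"; cases "y = 0") (auto simp: dist_commute abs_minus_commute)
  then show ?thesis using that \<Lambda>(1) by blast
qed

lemma starlike_gauge_exists: "\<exists>N \<Lambda> b. starlike_gauge D N \<Lambda> b"
proof -
  obtain a B where aB: "0 < a" "0 < B" "\<And>x. norm x \<le> B * N x" "\<And>x. N x \<le> norm x / a"
    using norm_bounds by blast
  obtain \<Lambda> where "\<Lambda> > 0" "\<And>x y. \<bar>N x - N y\<bar> \<le> \<Lambda> * dist x y" using lipschitz_N by blast
  then have "starlike_gauge D N \<Lambda> B"
    using aB mem_D_iff mem_frontier_iff N_scaleR' N_pos' by unfold_locales auto
  then show ?thesis by blast
qed

end

lemma (in harmonic_system) H_indicator_le_1:
  assumes "bdd_open U" "A \<in> sets borel" shows "H U (indicat_real A) x \<le> 1"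
proof -
  consider "x \<in> U" | "x \<in> frontier U" | "x \<notin> closure U"
    using assms(1) closure_Un_frontier[of U] by blast
  then show ?thesis
  proof cases
    case 1 then show ?thesis using assms by (intro H_le) (auto simp: indicator_def)
  next
    case 2 then show ?thesis by (auto simp: H_frontier indicator_def)
  next
    case 3 then show ?thesis by (simp add: H_def)
  qed
qed

section \<open>Estimates in starlike domains\<close>

locale starlike_harmonic_system = harmonic_system \<Omega> + starlike_gauge D N \<Lambda> b
  for \<Omega> :: "'a::euclidean_space set \<Rightarrow> 'a \<Rightarrow> 'a set \<Rightarrow> ennreal" and D :: "'a set" and N :: "'a \<Rightarrow> real" and \<Lambda> b :: real
begin

section \<open>Elementary geometry, Harnack chains and nondegeneracy\<close>

lemma N_zero [simp]: "N 0 = 0" using N_scaleR[of 0 0] by simp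

lemma N_nonneg: "0 \<le> N x" using N_pos[of x] by (cases "x = 0") auto

lemma open_D: "open D"
proof -
  have "\<Lambda>-lipschitz_on UNIV N"
    using N_lipschitz \<Lambda>_pos by (auto simp: lipschitz_on_def dist_real_def)
  then have "continuous_on UNIV N" by (rule lipschitz_on_continuous_on)
  then show ?thesis unfolding D_eq by (intro open_Collect_less continuous_intros)
qed

lemma norm_frontier_le: "x \<in> frontier D \<Longrightarrow> norm x \<le> b"
  using norm_le_N[of x] frontier_eq by auto

lemma norm_D_le: assumes "x \<in> D" shows "norm x \<le> b"
proof -
  have "b * N x \<le> b * 1" using assms b_pos by (intro mult_left_mono) (auto simp: D_eq)
  then show ?thesis using norm_le_N[of x] by simp
qed

lemma zero_in_D: "0 \<in> D" by (simp add: D_eq)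

lemma bdd_open_D: "bdd_open D"
  using open_D norm_D_le zero_in_D by (auto simp: bdd_open_def bounded_iff)

lemma cball_subset_D: "\<Lambda> * d < 1 - N x \<Longrightarrow> cball x d \<subseteq> D"
proof
  fix y assume d: "\<Lambda> * d < 1 - N x" "y \<in> cball x d"
  then have "\<Lambda> * dist x y \<le> \<Lambda> * d" using \<Lambda>_pos by (intro mult_left_mono) auto
  then show "y \<in> D" using N_lipschitz[of x y] d by (auto simp: D_eq)
qed

text \<open>
  \<open>D\<close> need not be convex, so the points are joined by the polygon through \<open>\<kappa> *\<^sub>R a\<close> and \<open>\<kappa> *\<^sub>R c\<close>, with
  \<open>\<kappa>\<close> so small that the middle segment stays at distance of order \<open>\<delta>\<close> from the boundary.
\<close>

lemma Harnack_chain: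
  assumes K: "K > 0"
  obtains C where "C \<ge> 1"
    "\<And>f a c \<delta>. bounded_borel f \<Longrightarrow> (\<And>z. z \<in> frontier D \<Longrightarrow> 0 \<le> f z) \<Longrightarrow> 0 < \<delta> \<Longrightarrow>
       N a \<le> 1 - \<delta> \<Longrightarrow> N c \<le> 1 - \<delta> \<Longrightarrow> dist a c \<le> K * \<delta> \<Longrightarrow> H D f a \<le> C * H D f c"
proof -
  obtain C where C: "C \<ge> 1"
    "\<And>n U f (a::'a) b d. bdd_open U \<Longrightarrow> bounded_borel f \<Longrightarrow> (\<And>z. z \<in> frontier U \<Longrightarrow> 0 \<le> f z) \<Longrightarrow>
       d > 0 \<Longrightarrow> (\<And>z. z \<in> closed_segment a b \<Longrightarrow> cball z d \<subseteq> U) \<Longrightarrow> dist a b \<le> real n * d / 2 \<Longrightarrow>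
       H U f a \<le> C ^ n * H U f b"
    using Harnack_segment by blast
  \<comment> \<open>Chosen so that the middle segment satisfies \<open>\<kappa> * (1 + \<Lambda> * K
    * \<delta>) \<le> 1 - A * \<delta> + \<Lambda> * K * \<delta> = 1 - \<delta>\<close>.\<close>
  define A where "A = \<Lambda> * K + 1"
  \<comment> \<open>Enough steps of length \<open>d / 2\<close>,
    \<open>d = \<delta> / (2 * \<Lambda>)\<close>, for the radial legs, of length at most
    \<open>A * \<delta> * b\<close>, and for the middle one, at most
    \<open>K * \<delta>\<close>.\<close>
  define n where "n = nat \<lceil>4 * \<Lambda> * (A * b + K)\<rceil>"
  have A: "A > 0" using \<Lambda>_pos K by (simp add: A_def add_pos_pos)
  have n: "4 * \<Lambda> * (A * b) \<le> real n" "4 * \<Lambda> * K \<le> real n"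
  proof -
    have "4 * \<Lambda> * (A * b + K) \<le> real n" unfolding n_def by linarith
    moreover have "0 \<le> \<Lambda> * (A * b)" "0 \<le> \<Lambda> * K" using A \<Lambda>_pos K b_pos by auto
    ultimately show "4 * \<Lambda> * (A * b) \<le> real n" "4 * \<Lambda> * K \<le> real n"
      by (simp_all add: algebra_simps)
  qed
  show ?thesis
  proof (rule that[of "C ^ n * (C ^ n * C ^ n)"])
    show "C ^ n * (C ^ n * C ^ n) \<ge> 1" using C(1) by (metis one_le_power power_add)
    fix f :: "'a \<Rightarrow> real" and a c :: 'a and \<delta>
    assume f: "bounded_borel f" "\<And>z. z \<in> frontier D \<Longrightarrow> 0 \<le> f z" and \<delta>: "0 < \<delta>"
      and ac: "N a \<le> 1 - \<delta>" "N c \<le> 1 - \<delta>" "dist a c \<le> K * \<delta>"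
    have \<delta>1: "\<delta> \<le> 1" using ac(1) N_nonneg[of a] by linarith
    define d where "d = \<delta> / (2 * \<Lambda>)"
    have d: "d > 0" "\<Lambda> * d < \<delta>" using \<delta> \<Lambda>_pos by (auto simp: d_def field_simps)
    have ball: "cball z d \<subseteq> D" if "N z \<le> 1 - \<delta>" for z
      by (rule cball_subset_D) (use d that in linarith)
    note chain = C(2)[OF bdd_open_D f d(1)]
    \<comment> \<open>If \<open>A * \<delta>\<close> exceeds 1, the polygon runs through the origin
      and the middle segment degenerates.\<close>
    define \<kappa> where "\<kappa> = max 0 (1 - A * \<delta>)"
    have \<kappa>: "0 \<le> \<kappa>" "\<kappa> \<le> 1" "1 - \<kappa> \<le> A * \<delta>" using A \<delta> by (auto simp: \<kappa>_def)
    have radial: "cball z d \<subseteq> D" if z: "z \<in> closed_segment (\<kappa> *\<^sub>R y) y" and y: "N y \<le> 1 - \<delta>" for z y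
    proof -
      obtain u where u: "0 \<le> u" "u \<le> 1" "z = (1 - u) *\<^sub>R \<kappa> *\<^sub>R y + u *\<^sub>R y" using z by (auto simp: in_segment)
      have "z = ((1 - u) * \<kappa> + u) *\<^sub>R y" using u(3) by (simp add: algebra_simps)
      moreover have "0 \<le> (1 - u) * \<kappa> + u" "(1 - u) * \<kappa> + u \<le> 1"
        using u(1,2) \<kappa> mult_left_le[of \<kappa> "1 - u"] by (auto simp: mult_nonneg_nonneg)
      ultimately have "N z \<le> N y" using N_nonneg[of y] by (simp add: N_scaleR mult_left_le_one_le)
      then show ?thesis using y by (intro ball) linarith
    qed
    have rdist: "dist y (\<kappa> *\<^sub>R y) \<le> real n * d / 2" if "N y \<le> 1 - \<delta>" for y
    proof -
      have "norm y \<le> b" using norm_D_le that \<delta> by (auto simp: D_eq)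
      have "y - \<kappa> *\<^sub>R y = (1 - \<kappa>) *\<^sub>R y" by (simp add: algebra_simps)
      then have "dist y (\<kappa> *\<^sub>R y) = (1 - \<kappa>) * norm y" using \<kappa> by (simp add: dist_norm)
      also have "\<dots> \<le> A * \<delta> * b" using \<kappa> \<open>norm y \<le> b\<close> A \<delta> by (intro mult_mono) auto
      also have "\<dots> = 4 * \<Lambda> * (A * b) * d / 2" using \<Lambda>_pos by (simp add: d_def field_simps)
      also have "\<dots> \<le> real n * d / 2" using n d by (intro divide_right_mono mult_right_mono) auto
      finally show ?thesis .
    qed
    have 1: "H D f a \<le> C ^ n * H D f (\<kappa> *\<^sub>R a)"
      using radial[OF _ ac(1)] rdist[OF ac(1)] by (intro chain) (auto simp: closed_segment_commute)
    have 3: "H D f (\<kappa> *\<^sub>R c) \<le> C ^ n * H D f c"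
      using radial[OF _ ac(2)] rdist[OF ac(2)] by (intro chain) (auto simp: dist_commute)
    have 2: "H D f (\<kappa> *\<^sub>R a) \<le> C ^ n * H D f (\<kappa> *\<^sub>R c)"
    proof (rule chain)
      fix z assume "z \<in> closed_segment (\<kappa> *\<^sub>R a) (\<kappa> *\<^sub>R c)"
      then obtain u where u: "0 \<le> u" "u \<le> 1" "z = (1 - u) *\<^sub>R \<kappa> *\<^sub>R a + u *\<^sub>R \<kappa> *\<^sub>R c"
        by (auto simp: in_segment)
      define y where "y = (1 - u) *\<^sub>R a + u *\<^sub>R c"
      have z: "z = \<kappa> *\<^sub>R y" unfolding u(3) y_def by (simp add: algebra_simps)
      have "y \<in> closed_segment a c" using u by (auto simp: y_def in_segment)
      then have "dist a y \<le> dist a c" using segment_bound(1)[of y a c] by (simp add: dist_norm norm_minus_commute)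
      then have "\<Lambda> * dist a y \<le> \<Lambda> * (K * \<delta>)" using ac(3) \<Lambda>_pos by (intro mult_left_mono) auto
      then have "N y \<le> 1 + \<Lambda> * K * \<delta>" using N_lipschitz[of a y] ac(1) \<delta> by (auto simp: mult.assoc)
      then have "N z \<le> \<kappa> * (1 + \<Lambda> * K * \<delta>)" unfolding z using \<kappa>(1) by (simp add: N_scaleR mult_left_mono)
      also have "\<dots> \<le> 1 - \<delta>"
      proof (cases "A * \<delta> \<le> 1")
        case True
        have "0 \<le> A * \<delta> * (\<Lambda> * K * \<delta>)" using A \<delta> \<Lambda>_pos K by simp
        moreover have \<kappa>': "\<kappa> = 1 - A * \<delta>" using True by (simp add: \<kappa>_def)
        ultimately have "\<kappa> * (1 + \<Lambda> * K * \<delta>) \<le> 1 - A * \<delta> + \<Lambda> * K * \<delta>"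
          unfolding \<kappa>' by (simp add: algebra_simps)
        then show ?thesis by (simp add: A_def algebra_simps)
      next
        case False then show ?thesis using \<delta>1 by (simp add: \<kappa>_def)
      qed
      finally show "cball z d \<subseteq> D" by (rule ball)
    next
      have "dist (\<kappa> *\<^sub>R a) (\<kappa> *\<^sub>R c) = \<kappa> * dist a c"
        using \<kappa>(1) by (simp add: dist_norm flip: scaleR_diff_right)
      also have "\<dots> \<le> 1 * (K * \<delta>)" using \<kappa> ac(3) by (intro mult_mono) auto
      also have "\<dots> = 4 * \<Lambda> * K * d / 2" using \<Lambda>_pos by (simp add: d_def field_simps)
      also have "\<dots> \<le> real n * d / 2" using n d by (intro divide_right_mono mult_right_mono) auto
      finally show "dist (\<kappa> *\<^sub>R a) (\<kappa> *\<^sub>R c) \<le> real n * d / 2" .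
    qed
    have pos: "0 \<le> C ^ n" using C(1) by simp
    have "H D f a \<le> C ^ n * (C ^ n * (C ^ n * H D f c))"
      by (rule order_trans[OF 1 mult_left_mono[OF order_trans[OF 2 mult_left_mono[OF 3 pos]] pos]])
    then show "H D f a \<le> C ^ n * (C ^ n * C ^ n) * H D f c" by (simp add: mult_ac)
  qed
qed

text \<open>
  \<open>D \<inter> ball A (R * \<rho>)\<close> lies in the annulus around the exterior point \<open>A\<close> beyond \<open>P\<close>, and comparison
  on it with the harmonic measure of the inner sphere gives the bound.
\<close>

lemma nondegenerate_near:
  obtains c where "c > 0"
    "\<And>P r x. P \<in> frontier D \<Longrightarrow> r > 0 \<Longrightarrow> x \<in> D \<Longrightarrow> dist x P \<le> r / 8 \<Longrightarrow>
       c \<le> H D (indicator (frontier D \<inter> cball P r)) x"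
proof -
  \<comment> \<open>The centre \<open>A\<close> below lies within
    \<open>\<Lambda> * \<rho> * b\<close> of \<open>P\<close>; this \<open>R\<close> makes that at
    most a quarter of the outer radius \<open>R * \<rho> = r / 2\<close>.\<close>
  define R where "R = 4 * \<Lambda> * b + 4"
  have R: "R \<ge> 2" "4 * \<Lambda> * b \<le> R" using \<Lambda>_pos b_pos by (auto simp: R_def)
  obtain c where c: "c > 0"
    "\<And>y. 1 < norm y \<Longrightarrow> norm y \<le> R / 2 \<Longrightarrow> c \<le> H (annulus R) (indicator (cball 0 1)) y"
    using annulus_lower_bound[OF R(1)] by blast
  show ?thesis
  proof (rule that[OF c(1)])
    fix P x :: 'a and r :: real
    assume P: "P \<in> frontier D" and r: "r > 0" and x: "x \<in> D" "dist x P \<le> r / 8"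
    define \<rho> where "\<rho> = r / (2 * R)"
    \<comment> \<open>\<open>N A = 1 + \<Lambda> * \<rho>\<close>, and so by the Lipschitz bound all
      points of \<open>D\<close> are farther than \<open>\<rho>\<close> from
      \<open>A\<close>.\<close>
    define A where "A = (1 + \<Lambda> * \<rho>) *\<^sub>R P"
    define h where "h = homothety A \<rho>"
    define G where "G = h ` annulus R"
    define W where "W = D \<inter> ball A (R * \<rho>)"
    let ?f = "indicat_real (cball A \<rho>)" and ?g = "indicat_real (frontier D \<inter> cball P r)"
    have \<rho>: "\<rho> > 0" "R * \<rho> = r / 2" using r R by (auto simp: \<rho>_def)
    have "A - P = (\<Lambda> * \<rho>) *\<^sub>R P" by (simp add: A_def algebra_simps)
    then have "dist A P = \<Lambda> * \<rho> * norm P" using \<Lambda>_pos \<rho> by (simp add: dist_norm abs_mult)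
    also have "\<dots> \<le> \<Lambda> * \<rho> * b" using norm_frontier_le[OF P] \<Lambda>_pos \<rho> by (intro mult_left_mono) auto
    also have "\<dots> \<le> R * \<rho> / 4" using mult_right_mono[OF R(2), of \<rho>] \<rho>(1) by (simp add: mult_ac)
    finally have AP: "dist A P \<le> r / 8" using \<rho> by simp
    have h_norm: "dist (h y) A = \<rho> * norm y" for y using \<rho> by (simp add: h_def homothety_def dist_norm)
    have h_surj: "\<exists>z. y = h z" for y
      using \<rho> by (intro exI[of _ "(1/\<rho>) *\<^sub>R (y - A)"]) (simp add: h_def homothety_def)
    have G_iff: "y \<in> G \<longleftrightarrow> \<rho> < dist y A \<and> dist y A < R * \<rho>" for y
    proof -
      obtain z where z: "y = h z" using h_surj by blast
      have "y \<in> G \<longleftrightarrow> z \<in> annulus R"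
        unfolding G_def z h_def using inj_homothety[of \<rho> A] \<rho> by (simp add: inj_image_mem_iff)
      then show ?thesis using \<rho> by (simp add: z h_norm annulus_def mult.commute)
    qed
    have fr_G: "y \<in> frontier G" if "dist y A = R * \<rho>" for y
    proof -
      obtain z where z: "y = h z" using h_surj by blast
      then have "norm z = R" using that \<rho>(1) by (simp add: h_norm mult.commute[of R])
      then have "z \<in> frontier (annulus R)" using frontier_annulus[OF R(1)] by auto
      then show ?thesis unfolding G_def h_def using frontier_homothety[of \<rho> A] \<rho> z h_def by auto
    qed
    have bG: "bdd_open G" unfolding G_def h_def using bdd_open_annulus[OF R(1)] \<rho> by (intro bdd_open_homothety) auto
    have far: "\<rho> < dist y A" if "y \<in> D" for y
    proof -
      have "N A = 1 + \<Lambda> * \<rho>" using P \<Lambda>_pos \<rho> by (simp add: A_def N_scaleR frontier_eq)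
      then have "\<Lambda> * \<rho> < \<Lambda> * dist A y" using N_lipschitz[of A y] that by (auto simp: D_eq)
      then show ?thesis using \<Lambda>_pos by (simp add: dist_commute)
    qed
    have xA: "dist x A \<le> R * \<rho> / 2"
      using dist_triangle2[of x A P] x(2) AP \<rho> by simp
    then have xW: "x \<in> W" using x \<rho> r by (simp add: W_def dist_commute)
    have bW: "bdd_open W" using bdd_open_D xW by (auto simp: W_def bdd_open_def)
    \<comment> \<open>On the outer sphere the left side vanishes. The rest of the boundary of
      \<open>W\<close> belongs to the boundary of \<open>D\<close> within \<open>r\<close> of
      \<open>P\<close>, where the right side is 1.\<close>
    have "H G ?f x \<le> H D ?g x"
    proof (rule comparison[OF bW bG bdd_open_D])
      show "W \<subseteq> G" using far by (auto simp: W_def G_iff dist_commute)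
      show "x \<in> W" by (rule xW)
      fix y assume y: "y \<in> frontier W"
      have "frontier W \<subseteq> closure D \<inter> cball A (R * \<rho>)"
        using closure_mono[of W D] closure_mono[of W "ball A (R * \<rho>)"] \<rho> r
        by (auto simp: frontier_def W_def)
      then have y': "y \<in> closure D" "dist y A \<le> R * \<rho>" using y by (auto simp: dist_commute)
      show "H G ?f y \<le> H D ?g y"
      proof (cases "dist y A = R * \<rho>")
        case True
        have "\<rho> < R * \<rho>" using R \<rho> by simp
        then have "H G ?f y = 0" using fr_G[OF True] True by (simp add: H_frontier dist_commute)
        then show ?thesis using H_nonneg[of D ?g y] by simp
      next
        case False
        then have lt: "dist y A < R * \<rho>" using y' by simp
        have "y \<notin> W" using y not_frontier[OF bW] by blast
        then have "y \<notin> D" using lt by (auto simp: W_def dist_commute)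
        then have fr: "y \<in> frontier D" using y' by (simp add: frontier_def interior_open open_D)
        have "dist P y \<le> r" using lt AP \<rho> r dist_triangle3[of P y A] by (simp add: dist_commute)
        then have "H D ?g y = 1" using fr by (simp add: H_frontier)
        then show ?thesis using H_indicator_le_1[OF bG, of "cball A \<rho>" y] by simp
      qed
    qed (auto simp: W_def)
    moreover have "c \<le> H G ?f x"
    proof -
      obtain z where z: "x = h z" using h_surj by blast
      have "?f \<circ> h = indicator (cball 0 1)"
        using h_norm \<rho> by (auto simp: fun_eq_iff indicator_def dist_commute)
      moreover have zn: "1 < norm z" "norm z \<le> R / 2"
        using far[OF x(1)] xA \<rho>(1) by (simp_all add: z h_norm)
      moreover have "z \<in> annulus R" using zn R by (simp add: annulus_def)
      ultimately have "H G ?f x = H (annulus R) (indicator (cball 0 1)) z"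
        unfolding z G_def h_def using \<rho> bdd_open_annulus[OF R(1)] by (subst H_homothety) auto
      then show ?thesis using c(2) zn by simp
    qed
    ultimately show "c \<le> H D ?g x" by linarith
  qed
qed

text \<open>Extends \<open>nondegenerate_near\<close> from points close to \<open>P\<close> to
  points at distance and depth comparable to \<open>r\<close>: a Harnack chain joins them to a point
  \<open>x\<close> on the ray of \<open>P\<close>.\<close>

lemma nondegenerate:
  assumes K: "K > 0" and R: "R > 0"
  obtains c where "c > 0"
    "\<And>P r z. P \<in> frontier D \<Longrightarrow> 0 < r \<Longrightarrow> r \<le> R \<Longrightarrow> N z \<le> 1 - r / K \<Longrightarrow> dist z P \<le> K * r \<Longrightarrow>
       c \<le> H D (indicator (frontier D \<inter> cball P r)) z"
proof -
  obtain c where c: "c > 0"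
    "\<And>P r x. P \<in> frontier D \<Longrightarrow> r > 0 \<Longrightarrow> x \<in> D \<Longrightarrow> dist x P \<le> r / 8 \<Longrightarrow>
       c \<le> H D (indicator (frontier D \<inter> cball P r)) x"
    using nondegenerate_near by blast
  \<comment> \<open>The first bound puts \<open>x\<close> within \<open>r / 8\<close> of
    \<open>P\<close>, the second keeps the factor \<open>1 - \<eta> * r\<close> nonnegative for all
    \<open>r \<le> R\<close>.\<close>
  define \<eta> where "\<eta> = min (1 / (8 * b)) (1 / R)"
  \<comment> \<open>\<open>m * r\<close> is a lower bound for the depths of both \<open>x\<close>
    and \<open>z\<close>.\<close>
  define m where "m = min \<eta> (1 / K)"
  have \<eta>: "\<eta> > 0" "\<eta> * b \<le> 1 / 8" "\<eta> * R \<le> 1"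
    using b_pos R by (auto simp: \<eta>_def min_def field_simps)
  have m: "m > 0" "m \<le> \<eta>" "m \<le> 1 / K" using \<eta> K by (auto simp: m_def)
  obtain C where C: "C \<ge> 1"
    "\<And>f a c \<delta>. bounded_borel f \<Longrightarrow> (\<And>z. z \<in> frontier D \<Longrightarrow> 0 \<le> f z) \<Longrightarrow> 0 < \<delta> \<Longrightarrow>
       N a \<le> 1 - \<delta> \<Longrightarrow> N c \<le> 1 - \<delta> \<Longrightarrow> dist a c \<le> (K + 1) / m * \<delta> \<Longrightarrow> H D f a \<le> C * H D f c"
    using Harnack_chain[of "(K + 1) / m"] K m by auto
  show ?thesis
  proof (rule that[of "c / C"])
    show "c / C > 0" using c C by simp
    fix P z :: 'a and r :: real
    assume P: "P \<in> frontier D" and r: "0 < r" "r \<le> R" and z: "N z \<le> 1 - r / K" "dist z P \<le> K * r"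
    let ?f = "indicat_real (frontier D \<inter> cball P r)"
    define x where "x = (1 - \<eta> * r) *\<^sub>R P"
    have \<eta>r: "\<eta> * r \<le> 1" "\<eta> * r > 0"
    proof -
      have "\<eta> * r \<le> \<eta> * R" using \<eta>(1) r by (intro mult_left_mono) auto
      then show "\<eta> * r \<le> 1" using \<eta>(3) by linarith
      show "\<eta> * r > 0" using \<eta> r by simp
    qed
    have Nx: "N x = 1 - \<eta> * r" using P \<eta>r by (simp add: x_def N_scaleR frontier_eq)
    have "x - P = - ((\<eta> * r) *\<^sub>R P)" by (simp add: x_def algebra_simps)
    then have "dist x P = \<eta> * r * norm P" using \<eta>r unfolding dist_norm by (simp only: norm_minus_cancel norm_scaleR)
    also have "\<dots> \<le> \<eta> * r * b" using norm_frontier_le[OF P] \<eta>r by (intro mult_left_mono) auto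
    also have "\<dots> \<le> r / 8" using mult_right_mono[OF \<eta>(2), of r] r by (simp add: mult_ac)
    finally have xP: "dist x P \<le> r / 8" .
    have "H D ?f x \<le> C * H D ?f z"
    proof (rule C(2)[of _ "m * r"])
      show "N x \<le> 1 - m * r" using Nx m r mult_right_mono[of m \<eta> r] by simp
      have "m * r \<le> r / K" using mult_right_mono[OF m(3), of r] r by simp
      then show "N z \<le> 1 - m * r" using z by simp
      have "dist x z \<le> r / 8 + K * r" using dist_triangle2[of x z P] xP z by simp
      also have "\<dots> \<le> (K + 1) * r" using r by (simp add: algebra_simps)
      also have "\<dots> = (K + 1) / m * (m * r)" using m by simp
      finally show "dist x z \<le> (K + 1) / m * (m * r)" .
    qed (use m r in auto)
    moreover have "c \<le> H D ?f x" using P r xP Nx \<eta>r by (intro c(2)) (auto simp: D_eq)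
    ultimately show "c / C \<le> H D ?f z" using C(1) by (simp add: divide_le_eq mult.commute)
  qed
qed

section \<open>The doubling property\<close>

lemma H_homothety_indicator:
  assumes "k \<noteq> 0" "A \<in> sets borel" "homothety v k ` A \<in> sets borel" "bdd_open U" "x \<in> U"
  shows "H (homothety v k ` U) (indicator (homothety v k ` A)) (homothety v k x) = H U (indicator A) x"
proof -
  have "indicator (homothety v k ` A) \<circ> homothety v k = indicat_real A"
    using inj_homothety[OF assms(1), of v] by (auto simp: fun_eq_iff indicator_def dest: injD)
  then show ?thesis using H_homothety[OF assms(4,5,1), of "indicator (homothety v k ` A)" v] assms by auto
qed

text \<open>
  Let \<open>u\<close> be the harmonic measure of the dilated surface ball in \<open>k D\<close>, \<open>k = 1 + r\<close>. Points of
  \<open>\<partial>D\<close> have depth of order \<open>r\<close> in \<open>k D\<close>, so \<open>u\<close> is bounded below on the ball of radius \<open>2 r\<close>,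
  while \<open>u 0\<close> is the measure of the ball of radius \<open>r\<close> by dilation invariance.
\<close>

lemma doubling:
  obtains C where "C \<ge> 1"
    "\<And>P r. P \<in> frontier D \<Longrightarrow> r > 0 \<Longrightarrow>
       H D (indicator (frontier D \<inter> cball P (2 * r))) 0 \<le> C * H D (indicator (frontier D \<inter> cball P r)) 0"
proof -
  define R where "R = 2 * b"
  \<comment> \<open>The first summand bounds \<open>k = 1 + r\<close>, so that \<open>y / k\<close>
    has depth \<open>r / k \<ge> r / K\<close>; the second bounds the distance of
    \<open>y / k\<close> from \<open>P\<close> in units of \<open>r\<close>.\<close>
  define K where "K = (1 + R) + (2 + b)"
  have RK: "R > 0" "K > 0" "1 + R \<le> K" "2 + b \<le> K" using b_pos by (auto simp: R_def K_def)
  obtain c where c: "c > 0"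
    "\<And>P r z. P \<in> frontier D \<Longrightarrow> 0 < r \<Longrightarrow> r \<le> R \<Longrightarrow> N z \<le> 1 - r / K \<Longrightarrow> dist z P \<le> K * r \<Longrightarrow>
       c \<le> H D (indicator (frontier D \<inter> cball P r)) z"
    using nondegenerate[OF RK(2,1)] by blast
  show ?thesis
  proof (rule that[of "max 1 (1 / c)"])
    fix P :: 'a and r :: real assume P: "P \<in> frontier D" and r: "r > 0"
    let ?\<Delta> = "\<lambda>r. frontier D \<inter> cball P r"
    let ?w = "\<lambda>r. H D (indicator (?\<Delta> r)) 0"
    have w0: "0 \<le> ?w r" by (intro H_nonneg) auto
    show "?w (2 * r) \<le> max 1 (1 / c) * ?w r"
    proof (cases "r \<le> R")
      \<comment> \<open>At scales above the diameter bound both surface balls are the whole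
        boundary.\<close>
      case False
      have "dist P y \<le> r" if "y \<in> frontier D" for y
        using norm_triangle_ineq4[of P y] norm_frontier_le[OF P] norm_frontier_le[OF that] False
        by (simp add: dist_norm R_def)
      then have "?\<Delta> (2 * r) = ?\<Delta> r" using r by force
      then show ?thesis using w0 by (simp add: mult_le_cancel_right1)
    next
      case True
      define k where "k = 1 + r"
      define h where "h = (homothety 0 k :: 'a \<Rightarrow> 'a)"
      have k: "k > 0" "k \<noteq> 0" using r by (auto simp: k_def)
      have h: "h y = k *\<^sub>R y" for y by (simp add: h_def homothety_def)
      let ?g = "indicat_real (h ` ?\<Delta> r)"
      have comp: "compact (h ` ?\<Delta> r)"
        unfolding h_def using bdd_open_D by (intro compact_continuous_image continuous_on_homothety compact_Int_closed closed_cball compact_frontier_bounded) (auto simp: bdd_open_def)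
      then have meas: "h ` ?\<Delta> r \<in> sets borel" by (intro borel_closed compact_imp_closed)
      have bD': "bdd_open (h ` D)" unfolding h_def by (intro bdd_open_homothety bdd_open_D k)
      have eq: "H (h ` D) ?g (h z) = H D (indicator (?\<Delta> r)) z" if "z \<in> D" for z
        using meas k that unfolding h_def by (intro H_homothety_indicator bdd_open_D) auto
      have sub: "D \<subseteq> h ` D"
      proof
        fix y assume y: "y \<in> D"
        have "N ((1/k) *\<^sub>R y) = (1/k) * N y" using k by (simp add: N_scaleR)
        also have "\<dots> \<le> 1 * N y" using N_nonneg[of y] r by (intro mult_right_mono) (auto simp: k_def)
        finally have "(1/k) *\<^sub>R y \<in> D" using y unfolding D_eq by simp
        then show "y \<in> h ` D" using k by (intro image_eqI[of _ _ "(1/k) *\<^sub>R y"]) (auto simp: h)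
      qed
      have "c * ?w (2 * r) = H D (\<lambda>y. c * indicator (?\<Delta> (2 * r)) y) 0" by (simp add: H_cmult)
      also have "\<dots> \<le> H D (H (h ` D) ?g) 0"
      proof (rule H_mono[OF bdd_open_D _ _ zero_in_D])
        fix y assume y: "y \<in> frontier D"
        show "c * indicator (?\<Delta> (2 * r)) y \<le> H (h ` D) ?g y"
        proof (cases "y \<in> ?\<Delta> (2 * r)")
          case True
          define z where "z = (1/k) *\<^sub>R y"
          have k1: "1 / k = 1 - r / k" using r by (simp add: k_def field_simps)
          have Nz: "N z = 1 - r / k" using y k unfolding k1[symmetric] by (simp add: z_def N_scaleR frontier_eq)
          have "r / K \<le> r / k" using RK r \<open>r \<le> R\<close> by (intro divide_left_mono) (auto simp: k_def)
          moreover have "dist z P \<le> K * r"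
          proof -
            have "z - y = - ((r / k) *\<^sub>R y)" unfolding z_def k1 by (simp add: algebra_simps)
            then have "dist z y = r / k * norm y" unfolding dist_norm norm_minus_cancel
              using r k by simp
            also have "\<dots> \<le> r * b"
              using norm_frontier_le[OF y] r k by (intro mult_mono) (auto simp: k_def field_simps)
            finally have "dist z P \<le> r * b + 2 * r"
              using dist_triangle[of z P y] True by (auto simp: dist_commute)
            also have "\<dots> = (2 + b) * r" by (simp add: algebra_simps)
            also have "\<dots> \<le> K * r" using RK r by (intro mult_right_mono) auto
            finally show ?thesis .
          qed
          ultimately have "c \<le> H D (indicator (?\<Delta> r)) z" using P r \<open>r \<le> R\<close> Nz by (intro c(2)) auto
          moreover have "z \<in> D" using Nz r k by (simp add: D_eq)
          moreover have "h z = y" using k by (simp add: h z_def)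
          ultimately show ?thesis using eq[of z] True by simp
        qed (auto intro: H_nonneg)
      qed (use meas bD' in \<open>auto intro!: bounded_borel_cmult\<close>)
      also have "\<dots> = H (h ` D) ?g 0"
        using compatible[OF bD' bdd_open_D sub bounded_borel_indicator[OF meas] zero_in_D] by simp
      also have "\<dots> = ?w r" using eq[OF zero_in_D] by (simp add: h)
      finally have "?w (2 * r) \<le> 1 / c * ?w r" using c(1) by (simp add: field_simps)
      also have "\<dots> \<le> max 1 (1 / c) * ?w r" using w0 by (intro mult_right_mono) auto
      finally show ?thesis .
    qed
  qed simp
qed

section \<open>The weak type estimate\<close>

definition \<Delta> :: "'a \<Rightarrow> real \<Rightarrow> 'a set" where "\<Delta> P r = frontier D \<inter> cball P r"

definition \<pi> :: "'a \<Rightarrow> 'a" where "\<pi> x = (1 / N x) *\<^sub>R x"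

text \<open>Comparable to the depth of \<open>x\<close> and at least its distance from
  \<open>\<pi> x\<close>, so that balls about the projections cover the points themselves.\<close>

definition rad :: "'a \<Rightarrow> real" where "rad x = 2 * b * (1 - N x)"

lemma compact_\<Delta>: "compact (\<Delta> P r)"
  using bdd_open_D unfolding \<Delta>_def bdd_open_def
  by (intro compact_Int_closed closed_cball compact_frontier_bounded) auto

lemma \<Delta>_borel [measurable]: "\<Delta> P r \<in> sets borel"
  by (intro borel_closed compact_imp_closed compact_\<Delta>)

lemma
  assumes "x \<in> D" "x \<noteq> 0"
  shows \<pi>_frontier: "\<pi> x \<in> frontier D" and dist_\<pi>: "dist (\<pi> x) x \<le> rad x" and rad_pos: "0 < rad x"
    and rad_le: "rad x \<le> 2 * b"
proof -
  have N: "0 < N x" "N x < 1" using assms N_pos by (auto simp: D_eq)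
  then show "\<pi> x \<in> frontier D" by (simp add: \<pi>_def frontier_eq N_scaleR)
  show "0 < rad x" "rad x \<le> 2 * b" using N b_pos by (auto simp: rad_def)
  have "\<pi> x - x = (1 / N x - 1) *\<^sub>R x" by (simp add: \<pi>_def algebra_simps)
  then have "dist (\<pi> x) x = (1 / N x - 1) * norm x" using N by (simp add: dist_norm)
  also have "\<dots> \<le> (1 / N x - 1) * (b * N x)" using N norm_le_N by (intro mult_left_mono) auto
  also have "\<dots> = b * (1 - N x)" using N by (simp add: field_simps)
  also have "\<dots> \<le> rad x" using N b_pos by (simp add: rad_def)
  finally show "dist (\<pi> x) x \<le> rad x" .
qed

text \<open>
  \<open>S x\<close> is the surface ball pulled back to the level \<open>N x\<close>, and \<open>q x\<close> extends \<open>\<omega>(B x)\<close> from \<open>S x\<close> to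
  \<open>D - S x\<close>, the probability to visit \<open>S x\<close> and then to exit through \<open>B x\<close>. The shadows
  being disjoint, the \<open>q x\<close> sum up to at most 1, which \<open>H D f / l\<close> dominates on every \<open>S x\<close>;
  and \<open>q x 0\<close> controls \<open>\<omega>\<^sub>0(B x)\<close> since \<open>S x\<close> is a dilated copy of \<open>B x\<close> in the boundary of \<open>N x D\<close>.
\<close>

lemma shadow_sum_le:
  obtains C where "C > 0"
    "\<And>f l I. bounded_borel f \<Longrightarrow> (\<And>z. z \<in> frontier D \<Longrightarrow> 0 \<le> f z) \<Longrightarrow> 0 < l \<Longrightarrow> finite I \<Longrightarrow>
       I \<subseteq> {x \<in> D. l < H D f x} - {0} \<Longrightarrow>
       pairwise (\<lambda>x y. disjnt (cball (\<pi> x) (rad x)) (cball (\<pi> y) (rad y))) I \<Longrightarrow>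
       (\<Sum>x\<in>I. H D (indicator (\<Delta> (\<pi> x) (rad x))) 0) \<le> C / l * H D f 0"
proof -
  \<comment> \<open>A point of level \<open>N x\<close> has depth \<open>rad x / (2 * b)\<close>,
    and points of \<open>S x\<close> are within \<open>2 * rad x\<close> of \<open>\<pi> x\<close>;
    both have to fit \<open>nondegenerate\<close>.\<close>
  define K where "K = 2 * b + 2"
  have K: "K > 0" "2 * b \<le> K" "2 \<le> K" using b_pos by (auto simp: K_def)
  obtain c where c: "c > 0"
    "\<And>P r z. P \<in> frontier D \<Longrightarrow> 0 < r \<Longrightarrow> r \<le> 2 * b \<Longrightarrow> N z \<le> 1 - r / K \<Longrightarrow> dist z P \<le> K * r \<Longrightarrow>
       c \<le> H D (indicator (\<Delta> P r)) z"
    using nondegenerate[of K "2 * b"] K b_pos unfolding \<Delta>_def by auto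
  obtain C where C: "C \<ge> 1"
    "\<And>f a c \<delta>. bounded_borel f \<Longrightarrow> (\<And>z. z \<in> frontier D \<Longrightarrow> 0 \<le> f z) \<Longrightarrow> 0 < \<delta> \<Longrightarrow>
       N a \<le> 1 - \<delta> \<Longrightarrow> N c \<le> 1 - \<delta> \<Longrightarrow> dist a c \<le> (2 * b) * \<delta> \<Longrightarrow> H D f a \<le> C * H D f c"
    using Harnack_chain[of "2 * b"] b_pos by auto
  show ?thesis
  proof (rule that[of "C / c"])
    show "C / c > 0" using c C by simp
    fix f :: "'a \<Rightarrow> real" and l :: real and I
    assume f: "bounded_borel f" "\<And>z. z \<in> frontier D \<Longrightarrow> 0 \<le> f z" and l: "0 < l" and I: "finite I"
      "I \<subseteq> {x \<in> D. l < H D f x} - {0}"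
      and disj: "pairwise (\<lambda>x y. disjnt (cball (\<pi> x) (rad x)) (cball (\<pi> y) (rad y))) I"
    define B where "B x = \<Delta> (\<pi> x) (rad x)" for x
    define h where "h x = (homothety 0 (N x) :: 'a \<Rightarrow> 'a)" for x
    define S where "S x = h x ` B x" for x
    define p where "p x = H D (indicator (B x))" for x
    define g where "g x y = indicator (S x) y * p x y" for x y
    define q where "q x = H (D - S x) (g x)" for x
    have h: "h x y = N x *\<^sub>R y" for x y by (simp add: h_def homothety_def)
    have Ix: "x \<in> D" "x \<noteq> 0" "0 < N x" "N x < 1" "l < H D f x" if "x \<in> I" for x
      using I that N_pos[of x] by (auto simp: D_eq)
    have S_N: "N y = N x" if "x \<in> I" "y \<in> S x" for x y
      using that Ix[of x] by (auto simp: S_def h N_scaleR B_def \<Delta>_def frontier_eq)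
    have S_D: "S x \<subseteq> D" if "x \<in> I" for x using S_N Ix that by (auto simp: D_eq)
    have compS: "compact (S x)" for x
      unfolding S_def h_def B_def by (intro compact_continuous_image continuous_on_homothety compact_\<Delta>)
    have S_borel [measurable]: "S x \<in> sets borel" for x
      by (intro borel_closed compact_imp_closed compS)
    have B_borel [measurable]: "B x \<in> sets borel" for x by (simp add: B_def)
    have bp: "bounded_borel (p x)" for x unfolding p_def by (intro bounded_borel_H bdd_open_D bounded_borel_indicator B_borel)
    have p0: "0 \<le> p x y" for x y unfolding p_def by (intro H_nonneg) auto
    have bg: "bounded_borel (g x)" for x
      unfolding g_def by (intro bounded_borel_mult bounded_borel_indicator bp S_borel)
    have g0: "0 \<le> g x y" "g x y \<le> p x y" for x y using p0[of x y] by (auto simp: g_def indicator_def)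
    have zero_S: "0 \<notin> S x" if "x \<in> I" for x using S_N[OF that, of 0] Ix[OF that] by auto
    have bV: "bdd_open (D - S x)" if "x \<in> I" for x
      using bdd_open_D zero_in_D zero_S[OF that] compS[of x] by (auto simp: bdd_open_def intro!: open_Diff compact_imp_closed)
    have geometry: "dist z (\<pi> x) \<le> K * rad x \<and> dist x z \<le> rad x" if x: "x \<in> I" and z: "z \<in> S x" for x z
    proof -
      obtain y where y: "y \<in> B x" "z = N x *\<^sub>R y" using z by (auto simp: S_def h)
      have x_eq: "x = N x *\<^sub>R \<pi> x" using Ix[OF x] by (simp add: \<pi>_def)
      have "dist x z = dist (N x *\<^sub>R \<pi> x) (N x *\<^sub>R y)" using x_eq y by simp
      also have "\<dots> = N x * dist (\<pi> x) y" using Ix[OF x] by (simp add: dist_norm flip: scaleR_diff_right)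
      also have "\<dots> \<le> 1 * rad x"
        using Ix[OF x] y(1) by (intro mult_mono) (auto simp: B_def \<Delta>_def)
      finally have 1: "dist x z \<le> rad x" by simp
      have "dist z (\<pi> x) \<le> dist x z + dist (\<pi> x) x" by (metis dist_commute dist_triangle3 add.commute)
      also have "\<dots> \<le> 2 * rad x" using 1 dist_\<pi>[of x] Ix[OF x] by simp
      also have "\<dots> \<le> K * rad x" using K rad_pos[of x] Ix[OF x] by simp
      finally show ?thesis using 1 by simp
    qed
    have p_S: "c \<le> p x y" if x: "x \<in> I" and y: "y \<in> S x" for x y
      unfolding p_def B_def
    proof (rule c(2))
      have "rad x / K \<le> rad x / (2 * b)"
        using K b_pos rad_pos[of x] Ix[OF x] by (intro divide_left_mono) auto
      then show "N y \<le> 1 - rad x / K" using S_N[OF x y] b_pos by (simp add: rad_def)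
    qed (use Ix[OF x] \<pi>_frontier rad_pos rad_le geometry[OF x y] in auto)
    have u_S: "l \<le> C * H D f y" if x: "x \<in> I" and y: "y \<in> S x" for x y
    proof -
      have "H D f x \<le> C * H D f y"
        by (rule C(2)[of _ "1 - N x"])
          (use f Ix[OF x] S_N[OF x y] geometry[OF x y] in \<open>auto simp: rad_def\<close>)
      then show ?thesis using Ix[OF x] by linarith
    qed
    \<comment> \<open>On \<open>D - S x\<close> the function \<open>p x\<close> is the extension of
      its own values, and \<open>g x\<close> is \<open>p x\<close> cut down to
      \<open>S x\<close>.\<close>
    have q_le_p: "q x y \<le> p x y" if x: "x \<in> I" and y: "y \<in> D - S x \<or> y \<in> frontier (D - S x)" for x y
      using y
    proof
      assume y: "y \<in> D - S x"
      have "q x y \<le> H (D - S x) (p x) y"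
        unfolding q_def by (rule H_mono[OF bV[OF x] bg bp y g0(2)])
      also have "\<dots> = p x y"
        unfolding p_def using y by (intro compatible[symmetric] bdd_open_D bV[OF x]) auto
      finally show ?thesis .
    qed (simp add: q_def H_frontier g0)
    \<comment> \<open>The dilate \<open>N x\<close> times \<open>D\<close> avoids \<open>S x\<close>
      but has it in its boundary, and there \<open>q x\<close> equals \<open>p x \<ge> c\<close>.
      Seen from 0, \<open>S x\<close> has in this dilate the measure that \<open>B x\<close> has in
      \<open>D\<close>.\<close>
    have q_low: "c * p x 0 \<le> q x 0" if x: "x \<in> I" for x
    proof -
      let ?W = "h x ` D"
      have k: "N x \<noteq> 0" using Ix[OF x] by simp
      have W: "bdd_open ?W" unfolding h_def by (intro bdd_open_homothety bdd_open_D k)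
      have WV: "?W \<subseteq> D - S x"
      proof
        fix y assume "y \<in> ?W"
        then have "N y < N x" using Ix[OF x] by (auto simp: h N_scaleR D_eq)
        then show "y \<in> D - S x" using S_N[OF x, of y] Ix[OF x] by (auto simp: D_eq)
      qed
      have W0: "0 \<in> ?W" using zero_in_D by (intro image_eqI[of _ _ 0]) (auto simp: h)
      have "c * p x 0 = c * H ?W (indicator (S x)) 0"
      proof -
        have "H (homothety 0 (N x) ` D) (indicator (homothety 0 (N x) ` B x)) (homothety 0 (N x) 0) = H D (indicator (B x)) 0"
          by (rule H_homothety_indicator) (use k S_borel[of x] zero_in_D bdd_open_D in \<open>auto simp: S_def h_def\<close>)
        then show ?thesis by (simp add: p_def S_def h_def homothety_def)
      qed
      also have "\<dots> = H ?W (\<lambda>y. c * indicator (S x) y) 0" by (simp add: H_cmult)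
      also have "\<dots> \<le> H ?W (q x) 0"
      proof (rule H_mono[OF W _ _ W0])
        fix y assume y: "y \<in> frontier ?W"
        show "c * indicator (S x) y \<le> q x y"
        proof (cases "y \<in> S x")
          case True
          have "y \<in> closure (D - S x)" using y closure_mono[OF WV] by (auto simp: frontier_def)
          then have "y \<in> frontier (D - S x)" using True bV[OF x] by (auto simp: frontier_def bdd_open_def interior_open)
          then show ?thesis using True p_S[OF x True] by (simp add: q_def H_frontier g_def)
        qed (auto simp: q_def intro!: H_nonneg g0)
      qed (use bg bV[OF x] in \<open>auto simp: q_def intro!: bounded_borel_cmult\<close>)
      also have "\<dots> = q x 0"
        unfolding q_def by (intro compatible[symmetric] bV[OF x] W WV bg W0)
      finally show ?thesis .
    qed
    define V where "V = D - (\<Union>x\<in>I. S x)"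
    have V0: "0 \<in> V" using zero_in_D zero_S by (auto simp: V_def)
    have V: "bdd_open V"
      using bdd_open_D V0 I(1) compS unfolding V_def bdd_open_def
      by (auto intro!: open_Diff closed_UN compact_imp_closed)
    have bq: "bounded_borel (q x)" if "x \<in> I" for x unfolding q_def using bV[OF that] bg by auto
    \<comment> \<open>The sets \<open>B x\<close> are disjoint, so their indicators add up to at
      most 1, and extension preserves this bound.\<close>
    have sum_p: "(\<Sum>x\<in>I. p x y) \<le> 1" if "y \<in> D" for y
    proof -
      have "(\<Sum>x\<in>I. p x y) = H D (\<lambda>z. \<Sum>x\<in>I. indicator (B x) z) y"
        unfolding p_def by (subst H_sum[OF bdd_open_D]) auto
      also have "\<dots> \<le> 1"
      proof (rule H_le[OF bdd_open_D _ that])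
        fix z
        show "(\<Sum>x\<in>I. indicat_real (B x) z) \<le> 1"
        proof (cases "\<exists>x0\<in>I. z \<in> B x0")
          case True
          then obtain x0 where x0: "x0 \<in> I" "z \<in> B x0" by blast
          have "indicat_real (B x) z = (if x = x0 then 1 else 0)" if "x \<in> I" for x
            using disj x0 that by (auto simp: indicator_def B_def \<Delta>_def pairwise_def disjnt_iff)
          then show ?thesis using I(1) x0 by (simp add: sum.delta)
        next
          case False
          then have "(\<Sum>x\<in>I. indicat_real (B x) z) = 0" by (intro sum.neutral) auto
          then show ?thesis by simp
        qed
      qed (auto intro!: bounded_borel_sum)
      finally show ?thesis .
    qed
    have "(\<Sum>x\<in>I. c * p x 0) \<le> (\<Sum>x\<in>I. q x 0)" by (intro sum_mono q_low)
    \<comment> \<open>The functions \<open>q x\<close> belong to different open sets; the strong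
      Markov property transports them all to the common subset \<open>V\<close>, where they can be
      added.\<close>
    also have "\<dots> = (\<Sum>x\<in>I. H V (q x) 0)"
      unfolding q_def by (intro sum.cong refl compatible bV V V0 bg) (auto simp: V_def)
    also have "\<dots> = H V (\<lambda>y. \<Sum>x\<in>I. q x y) 0" using bq by (subst H_sum[OF V]) auto
    also have "\<dots> \<le> H V (\<lambda>y. C / l * H D f y) 0"
    proof (rule H_mono[OF V _ _ V0])
      fix y assume y: "y \<in> frontier V"
      then have yV: "y \<in> closure V" "y \<notin> V" using V by (auto simp: frontier_def bdd_open_def interior_open)
      have u0: "0 \<le> H D f y" using f(2) by (rule H_nonneg)
      have fr: "y \<in> frontier (D - S x)" if "x \<in> I" "y \<notin> D - S x" for x
      proof -
        have "y \<in> closure (D - S x)" using yV(1) closure_mono[of V "D - S x"] that by (auto simp: V_def)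
        then show ?thesis using that bV by (auto simp: frontier_def bdd_open_def interior_open)
      qed
      show "(\<Sum>x\<in>I. q x y) \<le> C / l * H D f y"
      proof (cases "y \<in> D")
        case True
        \<comment> \<open>A boundary point of \<open>V\<close> inside \<open>D\<close> lies on some
          \<open>S x0\<close>, where \<open>H D f\<close> is at least \<open>l / C\<close> while the
          \<open>q x\<close> sum up to at most 1. At the remaining boundary points, outside
          \<open>D\<close>, every \<open>q x\<close> vanishes.\<close>
        then obtain x0 where x0: "x0 \<in> I" "y \<in> S x0" using yV(2) by (auto simp: V_def)
        have "(\<Sum>x\<in>I. q x y) \<le> (\<Sum>x\<in>I. p x y)"
          using q_le_p fr by (intro sum_mono) blast
        also have "\<dots> \<le> 1" by (rule sum_p[OF True])
        also have "\<dots> \<le> C / l * H D f y" using u_S[OF x0] l by (simp add: field_simps)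
        finally show ?thesis .
      next
        case False
        have "q x y = 0" if x: "x \<in> I" for x
        proof -
          have "y \<notin> S x" using S_D[OF x] False by auto
          then show ?thesis using fr[OF x] False by (auto simp: q_def H_frontier g_def)
        qed
        then have "(\<Sum>x\<in>I. q x y) = 0" by simp
        then show ?thesis using u0 C(1) l by simp
      qed
    qed (use bq bounded_borel_cmult[OF bounded_borel_H[OF bdd_open_D f(1)], of "C / l"] in
        \<open>auto intro!: bounded_borel_sum\<close>)
    also have "\<dots> = C / l * H D f 0"
      unfolding H_cmult using f(1) by (subst compatible[OF bdd_open_D V _ _ V0, symmetric]) (auto simp: V_def)
    finally have "c * (\<Sum>x\<in>I. p x 0) \<le> C / l * H D f 0" by (simp add: sum_distrib_left)
    then have "(\<Sum>x\<in>I. p x 0) \<le> C / l * H D f 0 / c"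
      by (subst pos_le_divide_eq[OF c(1)]) (simp add: mult.commute)
    then show "(\<Sum>x\<in>I. H D (indicator (\<Delta> (\<pi> x) (rad x))) 0) \<le> C / c / l * H D f 0"
      by (simp add: p_def B_def mult.commute)
  qed
qed

text \<open>A ball of radius \<open>2 * b\<close> about any boundary point contains
  \<open>D\<close>.\<close>

lemma carleson_finite:
  assumes "M0 \<ge> 0"
    and carleson: "\<And>P r. P \<in> frontier D \<Longrightarrow> r > 0 \<Longrightarrow>
      emeasure \<nu> (D \<inter> cball P r) \<le> ennreal (M0 * H D (indicator (\<Delta> P r)) 0)"
  shows "emeasure \<nu> D \<le> ennreal M0"
proof -
  obtain P where P: "P \<in> frontier D"
    using pre_harmonic[OF bdd_open_D] by (auto simp: pre_harmonic_measure_def)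
  have "D \<inter> cball P (2 * b) = D"
  proof -
    have "dist P y \<le> 2 * b" if "y \<in> D" for y
      using norm_triangle_ineq4[of P y] norm_frontier_le[OF P] norm_D_le[OF that] by (simp add: dist_norm)
    then show ?thesis by auto
  qed
  then have "emeasure \<nu> D \<le> ennreal (M0 * H D (indicator (\<Delta> P (2 * b))) 0)"
    using carleson[OF P, of "2 * b"] b_pos by simp
  also have "\<dots> \<le> ennreal (M0 * 1)"
    using assms(1) H_indicator_le_1[OF bdd_open_D \<Delta>_borel] by (intro ennreal_leI mult_left_mono) auto
  finally show ?thesis by simp
qed

text \<open>Vitali's lemma picks disjoint shadow balls whose fivefold enlargements cover the
  superlevel set. The Carleson condition and doubling compare the \<open>\<nu>\<close>-measure of
  each enlargement with the harmonic measure of its shadow, and \<open>shadow_sum_le\<close> adds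
  these up.\<close>

lemma weak_type:
  assumes \<nu>: "\<And>A. A \<in> sets borel \<Longrightarrow> A \<subseteq> D \<Longrightarrow> A \<in> sets \<nu>" and M0: "M0 \<ge> 0"
    and carleson: "\<And>P r. P \<in> frontier D \<Longrightarrow> r > 0 \<Longrightarrow>
      emeasure \<nu> (D \<inter> cball P r) \<le> ennreal (M0 * H D (indicator (\<Delta> P r)) 0)"
  obtains C where "C > 0"
    "\<And>f l. bounded_borel f \<Longrightarrow> (\<And>z. z \<in> frontier D \<Longrightarrow> 0 \<le> f z) \<Longrightarrow> 0 < l \<Longrightarrow>
       emeasure \<nu> {x \<in> D. l < H D f x} \<le> ennreal (C / l * H D f 0)"
proof -
  obtain C1 where C1: "C1 > 0"
    "\<And>f l I. bounded_borel f \<Longrightarrow> (\<And>z. z \<in> frontier D \<Longrightarrow> 0 \<le> f z) \<Longrightarrow> 0 < l \<Longrightarrow> finite I \<Longrightarrow>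
       I \<subseteq> {x \<in> D. l < H D f x} - {0} \<Longrightarrow>
       pairwise (\<lambda>x y. disjnt (cball (\<pi> x) (rad x)) (cball (\<pi> y) (rad y))) I \<Longrightarrow>
       (\<Sum>x\<in>I. H D (indicator (\<Delta> (\<pi> x) (rad x))) 0) \<le> C1 / l * H D f 0"
    using shadow_sum_le by blast
  obtain C2 where C2: "C2 \<ge> 1"
    "\<And>P r. P \<in> frontier D \<Longrightarrow> r > 0 \<Longrightarrow> H D (indicator (\<Delta> P (2 * r))) 0 \<le> C2 * H D (indicator (\<Delta> P r)) 0"
    using doubling unfolding \<Delta>_def by blast
  have ind_mono: "H D (indicator (\<Delta> P r)) 0 \<le> H D (indicator (\<Delta> P r')) 0" if "r \<le> r'" for P r r'
    using that by (intro H_mono bdd_open_D zero_in_D) (auto simp: \<Delta>_def indicator_def)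
  \<comment> \<open>Three doublings, since \<open>5 \<le> 2 ^ 3\<close>.\<close>
  have dbl: "H D (indicator (\<Delta> P (5 * r))) 0 \<le> C2 ^ 3 * H D (indicator (\<Delta> P r)) 0"
    if "P \<in> frontier D" "r > 0" for P r
  proof -
    have "H D (indicator (\<Delta> P (5 * r))) 0 \<le> H D (indicator (\<Delta> P (2 * (2 * (2 * r))))) 0"
      using that by (intro ind_mono) auto
    also have "\<dots> \<le> C2 * (C2 * (C2 * H D (indicator (\<Delta> P r)) 0))"
      using that C2(1) by (intro order_trans[OF C2(2)] mult_left_mono) auto
    finally show ?thesis by (simp add: power3_eq_cube mult.assoc)
  qed
  have total: "emeasure \<nu> D \<le> ennreal M0" using M0 carleson by (rule carleson_finite)
  define C where "C = M0 + M0 * C2 ^ 3 * C1 + 1"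
  have C: "C > 0" "M0 \<le> C" "M0 * C2 ^ 3 * C1 \<le> C"
    using M0 C1 C2(1) by (auto simp: C_def add_nonneg_pos)
  show ?thesis
  proof (rule that[OF C(1)])
    fix f :: "'a \<Rightarrow> real" and l :: real
    assume f: "bounded_borel f" "\<And>z. z \<in> frontier D \<Longrightarrow> 0 \<le> f z" and l: "0 < l"
    let ?F = "{x \<in> D. l < H D f x}"
    have u0: "0 \<le> H D f 0" using f(2) by (rule H_nonneg)
    have "D \<in> sets \<nu>" using \<nu>[of D] open_D by auto
    show "emeasure \<nu> ?F \<le> ennreal (C / l * H D f 0)"
    \<comment> \<open>The origin has no radial projection, so the case where it belongs to the
      superlevel set is settled separately by the total mass of \<open>\<nu>\<close>; the empty set
      has nothing to enumerate.\<close>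
    proof (cases "l < H D f 0 \<or> ?F = {}")
      case True
      then show ?thesis
      proof
        assume u: "l < H D f 0"
        have "emeasure \<nu> ?F \<le> emeasure \<nu> D" using \<open>D \<in> sets \<nu>\<close> by (intro emeasure_mono) auto
        also have "\<dots> \<le> ennreal (M0 * 1)" using total by simp
        also have "\<dots> \<le> ennreal (C * (H D f 0 / l))"
          using C M0 u l by (intro ennreal_leI mult_mono) auto
        finally show ?thesis by simp
      next
        assume e: "?F = {}"
        show ?thesis unfolding e by simp
      qed
    next
      case False
      then have F0: "?F \<subseteq> D - {0}" and ne: "?F \<noteq> {}" by auto
      have F: "x \<in> D \<and> x \<noteq> 0" if "x \<in> ?F" for x using that F0 by auto
      have cov: "?F \<subseteq> (\<Union>x\<in>?F. cball (\<pi> x) (rad x))"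
        using F dist_\<pi> by fastforce
      have radb: "0 < rad x \<and> rad x \<le> 2 * b" if "x \<in> ?F" for x
        using F[OF that] rad_pos rad_le by blast
      obtain J where J: "countable J" "J \<subseteq> ?F"
        "pairwise (\<lambda>x y. disjnt (cball (\<pi> x) (rad x)) (cball (\<pi> y) (rad y))) J"
        "?F \<subseteq> (\<Union>x\<in>J. cball (\<pi> x) (5 * rad x))"
        by (rule Vitali_covering_lemma_cballs[OF cov radb])
      define e where "e = from_nat_into J"
      \<comment> \<open>\<open>shadow_sum_le\<close> is for finite families, so the countable cover
        is exhausted by finite ones. The sums run over the image of the enumeration, whose
        repetitions are therefore harmless.\<close>
      define A where "A n = (\<Union>x\<in>e ` {..<n}. D \<inter> cball (\<pi> x) (5 * rad x))" for n :: nat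
      have "J \<noteq> {}" using J(4) ne by auto
      then have range_e: "range e = J" using J(1) by (simp add: e_def range_from_nat_into)
      have ball_sets: "D \<inter> cball P r \<in> sets \<nu>" for P r using open_D by (intro \<nu>) auto
      have A_sets: "A n \<in> sets \<nu>" for n
        unfolding A_def by (rule sets.finite_UN) (use ball_sets in auto)
      have A_le: "emeasure \<nu> (A n) \<le> ennreal (C / l * H D f 0)" for n
      proof -
        let ?I = "e ` {..<n}"
        have IJ: "?I \<subseteq> J" using range_e by auto
        have IF: "x \<in> D" "x \<noteq> 0" if "x \<in> ?I" for x using that IJ J(2) F by blast+
        have "emeasure \<nu> (A n) \<le> (\<Sum>x\<in>?I. emeasure \<nu> (D \<inter> cball (\<pi> x) (5 * rad x)))"
          unfolding A_def using ball_sets by (intro emeasure_subadditive_finite) auto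
        also have "\<dots> \<le> (\<Sum>x\<in>?I. ennreal (M0 * (C2 ^ 3 * H D (indicator (\<Delta> (\<pi> x) (rad x))) 0)))"
        proof (rule sum_mono)
          fix x assume x: "x \<in> ?I"
          have P: "\<pi> x \<in> frontier D" "rad x > 0" using IF[OF x] \<pi>_frontier rad_pos by auto
          have "emeasure \<nu> (D \<inter> cball (\<pi> x) (5 * rad x)) \<le> ennreal (M0 * H D (indicator (\<Delta> (\<pi> x) (5 * rad x))) 0)"
            using P by (intro carleson) auto
          also have "\<dots> \<le> ennreal (M0 * (C2 ^ 3 * H D (indicator (\<Delta> (\<pi> x) (rad x))) 0))"
            using M0 dbl[OF P] by (intro ennreal_leI mult_left_mono)
          finally show "emeasure \<nu> (D \<inter> cball (\<pi> x) (5 * rad x)) \<le> \<dots>" .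
        qed
        also have "\<dots> = ennreal (\<Sum>x\<in>?I. M0 * (C2 ^ 3 * H D (indicator (\<Delta> (\<pi> x) (rad x))) 0))"
          using M0 C2(1) by (intro sum_ennreal mult_nonneg_nonneg H_nonneg) auto
        also have "(\<Sum>x\<in>?I. M0 * (C2 ^ 3 * H D (indicator (\<Delta> (\<pi> x) (rad x))) 0)) =
            M0 * C2 ^ 3 * (\<Sum>x\<in>?I. H D (indicator (\<Delta> (\<pi> x) (rad x))) 0)"
          by (simp add: sum_distrib_left mult.assoc)
        also have "\<dots> \<le> M0 * C2 ^ 3 * (C1 / l * H D f 0)"
        proof (rule mult_left_mono)
          show "(\<Sum>x\<in>?I. H D (indicator (\<Delta> (\<pi> x) (rad x))) 0) \<le> C1 / l * H D f 0"
          proof (rule C1(2)[OF f l])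
            show "?I \<subseteq> ?F - {0}" using IJ J(2) F0 by blast
            show "pairwise (\<lambda>x y. disjnt (cball (\<pi> x) (rad x)) (cball (\<pi> y) (rad y))) ?I"
              using J(3) IJ by (rule pairwise_subset)
            show "finite ?I" by (intro finite_imageI finite_lessThan)
          qed
        qed (use M0 C2 in auto)
        also have "\<dots> = M0 * C2 ^ 3 * C1 * (1 / l * H D f 0)" by simp
        also have "\<dots> \<le> C * (1 / l * H D f 0)" using C(3) u0 l by (intro mult_right_mono) auto
        finally show ?thesis by (simp add: ennreal_leI)
      qed
      have "?F \<subseteq> (\<Union>n. A n)"
      proof
        fix y assume y: "y \<in> ?F"
        then obtain x where x: "x \<in> J" "y \<in> cball (\<pi> x) (5 * rad x)" using J(4) by blast
        then obtain n where "x = e n" using range_e by auto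
        then have "y \<in> A (Suc n)" using x(2) y by (auto simp: A_def)
        then show "y \<in> (\<Union>n. A n)" by blast
      qed
      then have "emeasure \<nu> ?F \<le> emeasure \<nu> (\<Union>n. A n)"
        using A_sets by (intro emeasure_mono) auto
      also have "\<dots> = (SUP n. emeasure \<nu> (A n))"
      proof (rule SUP_emeasure_incseq[symmetric])
        show "incseq A" unfolding incseq_def A_def by (intro allI impI UN_mono image_mono) auto
      qed (use A_sets in auto)
      also have "\<dots> \<le> ennreal (C / l * H D f 0)" by (intro SUP_least A_le)
      finally show ?thesis .
    qed
  qed
qed

end

section \<open>The strong type estimate\<close>

lemma nn_integral_powr_from_0:
  fixes a q :: real
  assumes "q > -1" "a \<ge> 0"
  shows "(\<integral>\<^sup>+l. ennreal (l powr q) * indicator {0..a} l \<partial>lborel) = ennreal (a powr (q + 1) / (q + 1))"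
  by (rule nn_integral_has_integral_lebesgue'[OF _ has_integral_powr_from_0[OF assms]]) simp

context starlike_harmonic_system begin

text \<open>Marcinkiewicz interpolation between the weak type bound and the trivial sup bound: at
  level \<open>l\<close> only the part of \<open>f\<close> above \<open>l / 2\<close> matters, and
  the levels are then integrated by Fubini.\<close>

lemma strong_type_bounded:
  assumes \<nu>: "\<And>A. A \<in> sets borel \<Longrightarrow> A \<subseteq> D \<Longrightarrow> A \<in> sets \<nu>" and space_\<nu>: "space \<nu> = D"
    and M0: "M0 \<ge> 0"
    and carleson: "\<And>P r. P \<in> frontier D \<Longrightarrow> r > 0 \<Longrightarrow>
      emeasure \<nu> (D \<inter> cball P r) \<le> ennreal (M0 * H D (indicator (\<Delta> P r)) 0)"
    and p: "p > 1"
  obtains K where "K > 0"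
    "\<And>f. bounded_borel f \<Longrightarrow> (\<And>z. 0 \<le> f z) \<Longrightarrow>
       (\<integral>\<^sup>+x. ennreal (H D f x powr p) \<partial>\<nu>) \<le> ennreal K * (\<integral>\<^sup>+z. ennreal (f z powr p) \<partial>M D 0)"
proof -
  obtain C where C: "C > 0"
    "\<And>f l. bounded_borel f \<Longrightarrow> (\<And>z. z \<in> frontier D \<Longrightarrow> 0 \<le> f z) \<Longrightarrow> 0 < l \<Longrightarrow>
       emeasure \<nu> {x \<in> D. l < H D f x} \<le> ennreal (C / l * H D f 0)"
    using weak_type[OF \<nu> M0 carleson] by blast
  have "emeasure \<nu> D \<le> ennreal M0" using M0 carleson by (rule carleson_finite)
  then have "emeasure \<nu> D < top" by (rule le_less_trans) simp
  \<comment> \<open>Finiteness of both measures provides the sigma-finiteness for Fubini.\<close>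
  then interpret \<nu>: finite_measure \<nu> by (intro finite_measureI) (auto simp: space_\<nu>)
  interpret \<omega>: finite_measure "M D 0" by (rule finite_M[OF bdd_open_D zero_in_D])
  interpret \<nu>l: pair_sigma_finite \<nu> lborel ..
  interpret \<omega>l: pair_sigma_finite "M D 0" lborel ..
  \<comment> \<open>The value of \<open>4 * C * p\<close> times the integral of
    \<open>l powr (p - 2)\<close> from 0 to \<open>2 * f z\<close>, with the powers of
    \<open>f z\<close> taken out; it converges at 0 because of \<open>p > 1\<close>.\<close>
  define K where "K = 4 * C * p * 2 powr (p - 1) / (p - 1)"
  show ?thesis
  proof (rule that[of K])
    show "K > 0" using C p by (simp add: K_def)
    fix f :: "'a \<Rightarrow> real" assume f: "bounded_borel f" and f0: "\<And>z. 0 \<le> f z"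
    define u where "u = H D f"
    have u0: "0 \<le> u x" for x unfolding u_def by (intro H_nonneg f0)
    have fm [measurable]: "f \<in> borel_measurable borel" using f by (simp add: bounded_borel_def)
    have fm' [measurable]: "f \<in> borel_measurable (M D 0)" by (rule measurable_M[OF bdd_open_D zero_in_D fm])
    have ub [measurable]: "u \<in> borel_measurable borel"
      using bounded_borel_H[OF bdd_open_D f] by (simp add: bounded_borel_def u_def)
    have um [measurable]: "u \<in> borel_measurable \<nu>"
    proof (rule measurableI)
      fix A :: "real set" assume "A \<in> sets borel"
      then have "u -` A \<in> sets borel" using measurable_sets[OF ub] by simp
      then show "u -` A \<inter> space \<nu> \<in> sets \<nu>" unfolding space_\<nu> using open_D by (intro \<nu>) auto
    qed auto
    have set: "{x \<in> D. P (u x)} \<in> sets \<nu>" if "Measurable.pred borel P" for P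
      using measurable_sets[OF um, of "{y. P y}"] that
      by (simp add: pred_def space_\<nu> vimage_def Int_def conj_commute)
    \<comment> \<open>\<open>g1\<close> is the layer cake integrand of \<open>u x powr p\<close>,
      and \<open>g2\<close> is what the weak type bound puts in its place.\<close>
    define g1 where "g1 x l = (if 0 \<le> l \<and> l \<le> u x then ennreal (p * l powr (p - 1)) else 0)" for x l
    define g2 where "g2 z l = (if 0 \<le> l \<and> l \<le> 2 * f z then ennreal (4 * C * p * f z) * ennreal (l powr (p - 2)) else 0)" for z l
    have 1: "ennreal (u x powr p) = (\<integral>\<^sup>+l. g1 x l \<partial>lborel)" for x
    proof -
      have "(\<integral>\<^sup>+l. g1 x l \<partial>lborel) = (\<integral>\<^sup>+l. ennreal p * (ennreal (l powr (p - 1)) * indicator {0..u x} l) \<partial>lborel)"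
        using p by (intro nn_integral_cong) (auto simp: g1_def indicator_def ennreal_mult')
      also have "\<dots> = ennreal p * ennreal (u x powr (p - 1 + 1) / (p - 1 + 1))"
        using p u0 by (subst nn_integral_cmult) (auto simp: nn_integral_powr_from_0)
      also have "\<dots> = ennreal (u x powr p)" using p by (simp add: ennreal_mult'[symmetric])
      finally show ?thesis by simp
    qed
    have 2: "(\<integral>\<^sup>+l. g2 z l \<partial>lborel) = ennreal (K * f z powr p)" for z
    proof -
      have "(\<integral>\<^sup>+l. g2 z l \<partial>lborel) =
          (\<integral>\<^sup>+l. ennreal (4 * C * p * f z) * (ennreal (l powr (p - 2)) * indicator {0..2 * f z} l) \<partial>lborel)"
        by (intro nn_integral_cong) (auto simp: g2_def indicator_def)
      also have "\<dots> = ennreal (4 * C * p * f z) * ennreal ((2 * f z) powr (p - 2 + 1) / (p - 2 + 1))"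
        using p f0[of z] by (subst nn_integral_cmult) (auto simp: nn_integral_powr_from_0)
      also have "\<dots> = ennreal (4 * C * p * f z * ((2 * f z) powr (p - 1) / (p - 1)))"
        using p C f0[of z] by (simp add: ennreal_mult'[symmetric])
      also have "4 * C * p * f z * ((2 * f z) powr (p - 1) / (p - 1)) = K * (f z * f z powr (p - 1))"
        using f0[of z] by (simp add: K_def powr_mult)
      also have "f z * f z powr (p - 1) = f z powr p"
        using f0[of z] p by (cases "f z = 0") (auto simp: powr_mult_base)
      finally show ?thesis .
    qed
    have 3: "(\<integral>\<^sup>+x. g1 x l \<partial>\<nu>) \<le> (\<integral>\<^sup>+z. g2 z l \<partial>M D 0)" for l
    proof (cases "l > 0")
      case False
      then have "g1 x l = 0" for x using p by (auto simp: g1_def)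
      then show ?thesis by simp
    next
      case l: True
      define h where "h z = f z * indicator {z. l \<le> 2 * f z} z" for z
      have hb: "bounded_borel h" unfolding h_def by (intro bounded_borel_mult f bounded_borel_indicator) measurable
      have [measurable]: "h \<in> borel_measurable (M D 0)"
        using hb by (intro measurable_M[OF bdd_open_D zero_in_D]) (simp add: bounded_borel_def)
      have h0: "0 \<le> h z" for z using f0 by (simp add: h_def)
      have "u x \<le> H D h x + l / 2" if "x \<in> D" for x
      proof -
        have "u x \<le> H D (\<lambda>z. h z + l / 2) x"
          unfolding u_def
        proof (rule H_mono[OF bdd_open_D f _ that])
          show "bounded_borel (\<lambda>z. h z + l / 2)" by (intro bounded_borel_add hb bounded_borel_const)
          show "f z \<le> h z + l / 2" for z using l by (auto simp: h_def indicator_def)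
        qed
        also have "\<dots> = H D h x + H D (\<lambda>z. l / 2) x"
          by (intro H_add bdd_open_D hb bounded_borel_const)
        also have "H D (\<lambda>z. l / 2) x \<le> l / 2" using l that by (intro H_const_le bdd_open_D) auto
        finally show ?thesis by simp
      qed
      \<comment> \<open>\<open>l \<le> u x\<close> only gives \<open>l / 2 \<le> H D h x\<close>;
        the weak type bound is about strict superlevel sets, hence the level
        \<open>l / 4\<close>.\<close>
      then have sub: "{x \<in> D. l \<le> u x} \<subseteq> {x \<in> D. l / 4 < H D h x}" using l by force
      have "(\<integral>\<^sup>+x. g1 x l \<partial>\<nu>) = (\<integral>\<^sup>+x. ennreal (p * l powr (p - 1)) * indicator {x \<in> D. l \<le> u x} x \<partial>\<nu>)"
        using l by (intro nn_integral_cong) (auto simp: g1_def space_\<nu>)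
      also have "\<dots> = ennreal (p * l powr (p - 1)) * emeasure \<nu> {x \<in> D. l \<le> u x}"
        by (intro nn_integral_cmult_indicator set) measurable
      also have "\<dots> \<le> ennreal (p * l powr (p - 1)) * emeasure \<nu> {x \<in> D. l / 4 < H D h x}"
      proof (intro mult_left_mono emeasure_mono sub)
        have "H D h \<in> borel_measurable borel"
          using bounded_borel_H[OF bdd_open_D hb] by (simp add: bounded_borel_def)
        then have "{x. l / 4 < H D h x} \<in> sets borel" by measurable
        then have "D \<inter> {x. l / 4 < H D h x} \<in> sets \<nu>" using open_D by (intro \<nu>) auto
        then show "{x \<in> D. l / 4 < H D h x} \<in> sets \<nu>" by (simp add: Int_def)
      qed simp
      also have "\<dots> \<le> ennreal (p * l powr (p - 1)) * ennreal (C / (l / 4) * H D h 0)"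
        using l by (intro mult_left_mono C(2) hb h0) auto
      also have "\<dots> = ennreal (p * l powr (p - 1) * (C / (l / 4))) * ennreal (H D h 0)"
        using p l C H_nonneg[of D h 0] h0 by (simp add: ennreal_mult'[symmetric] mult.assoc)
      also have "p * l powr (p - 1) * (C / (l / 4)) = 4 * C * p * l powr (p - 2)"
        using l powr_mult_base[of l "p - 2"] by (simp add: field_simps)
      also have "ennreal (H D h 0) = (\<integral>\<^sup>+z. ennreal (h z) \<partial>M D 0)"
        unfolding H_inside[OF bdd_open_D zero_in_D]
        using integrable_M[OF bdd_open_D zero_in_D hb] h0 by (intro nn_integral_eq_integral[symmetric]) auto
      also have "ennreal (4 * C * p * l powr (p - 2)) * (\<integral>\<^sup>+z. ennreal (h z) \<partial>M D 0) =
          (\<integral>\<^sup>+z. ennreal (4 * C * p * l powr (p - 2)) * ennreal (h z) \<partial>M D 0)"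
        by (rule nn_integral_cmult[symmetric]) measurable
      also have "\<dots> = (\<integral>\<^sup>+z. g2 z l \<partial>M D 0)"
      proof (intro nn_integral_cong)
        fix z
        have "ennreal (4 * C * p * l powr (p - 2)) * ennreal (f z) = ennreal (4 * C * p * l powr (p - 2) * f z)"
          using f0 by (rule ennreal_mult''[symmetric])
        also have "4 * C * p * l powr (p - 2) * f z = 4 * C * p * f z * l powr (p - 2)" by simp
        also have "ennreal \<dots> = ennreal (4 * C * p * f z) * ennreal (l powr (p - 2))"
          by (rule ennreal_mult'') simp
        finally show "ennreal (4 * C * p * l powr (p - 2)) * ennreal (h z) = g2 z l"
          using l by (simp add: g2_def h_def indicator_def)
      qed
      finally show ?thesis .
    qed
    have "(\<integral>\<^sup>+x. ennreal (H D f x powr p) \<partial>\<nu>) = (\<integral>\<^sup>+x. (\<integral>\<^sup>+l. g1 x l \<partial>lborel) \<partial>\<nu>)"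
      using 1 by (simp add: u_def)
    also have "\<dots> = (\<integral>\<^sup>+l. (\<integral>\<^sup>+x. g1 x l \<partial>\<nu>) \<partial>lborel)"
      unfolding g1_def by (rule \<nu>l.Fubini'[symmetric]) measurable
    also have "\<dots> \<le> (\<integral>\<^sup>+l. (\<integral>\<^sup>+z. g2 z l \<partial>M D 0) \<partial>lborel)"
      by (intro nn_integral_mono 3)
    also have "\<dots> = (\<integral>\<^sup>+z. (\<integral>\<^sup>+l. g2 z l \<partial>lborel) \<partial>M D 0)"
      unfolding g2_def by (rule \<omega>l.Fubini') measurable
    also have "\<dots> = (\<integral>\<^sup>+z. ennreal K * ennreal (f z powr p) \<partial>M D 0)"
      using \<open>K > 0\<close> by (simp add: 2 ennreal_mult'[symmetric])
    also have "\<dots> = ennreal K * (\<integral>\<^sup>+z. ennreal (f z powr p) \<partial>M D 0)"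
      by (intro nn_integral_cmult) measurable
    finally show "(\<integral>\<^sup>+x. ennreal (H D f x powr p) \<partial>\<nu>) \<le> ennreal K * (\<integral>\<^sup>+z. ennreal (f z powr p) \<partial>M D 0)" .
  qed
qed

section \<open>From bounded Borel functions to measurable ones\<close>

lemma connected_D: "connected D"
proof (rule starlike_imp_connected)
  have "closed_segment 0 x \<subseteq> D" if "x \<in> D" for x
  proof
    fix y assume "y \<in> closed_segment 0 x"
    then obtain t where t: "0 \<le> t" "t \<le> 1" "y = t *\<^sub>R x" by (auto simp: in_segment)
    have "t * N x \<le> 1 * N x" using t N_nonneg[of x] by (intro mult_right_mono) auto
    then show "y \<in> D" using t that by (simp add: D_eq N_scaleR)
  qed
  then show "starlike D" using zero_in_D by (auto simp: starlike_def)
qed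

text \<open>
  The strong Markov property moves a boundary function to other domains, where sets in
  \<open>hm_sets D (\<Omega> D)\<close> need not be measurable; hence Borel versions are needed.
\<close>

lemma borel_version:
  fixes F :: "'a \<Rightarrow> real"
  assumes F: "F \<in> borel_measurable (M D 0)"
  obtains g :: "'a \<Rightarrow> real" where "g \<in> borel_measurable borel" "AE z in M D 0. F z = g z"
proof -
  note D0 = bdd_open_D zero_in_D
  define B where "B = distr (M D 0) borel (\<lambda>x. x)"
  have id: "(\<lambda>x. x) \<in> measurable (M D 0) borel" by (rule measurable_M[OF D0]) simp
  have B_null: "A \<inter> frontier D \<in> null_sets (M D 0)" if "A \<in> null_sets B" for A
    using that id unfolding B_def by (auto simp: null_sets_distr_iff)
  \<comment> \<open>Off the boundary the values of \<open>F\<close> are arbitrary and must not spoil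
    measurability on the whole space.\<close>
  define F0 where "F0 z = (if z \<in> frontier D then F z else 0)" for z
  have "F0 \<in> borel_measurable (completion B)"
  proof (rule measurableI)
    fix S :: "real set" assume S: "S \<in> sets borel"
    have "F -` S \<inter> frontier D \<in> hm_sets D (\<Omega> D)"
      using measurable_sets[OF F S] sets_M[OF D0] by simp
    then have "F -` S \<inter> frontier D \<in> hm_sets_at D (\<Omega> D 0)" using zero_in_D by (auto simp: hm_sets_def)
    then obtain E Z where EZ: "F -` S \<inter> frontier D = sym_diff E Z"
      "E \<in> sets (restrict_space borel (frontier D))" "Z \<subseteq> frontier D" "\<Omega> D 0 Z = 0"
      by (auto simp: hm_sets_at_def)
    have E: "E \<in> sets borel" using EZ(2) by (subst (asm) sets_restrict_space_iff) auto
    \<comment> \<open>The Radon property encloses the exceptional null set in a Borel null set; this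
      makes the preimage measurable for the completion of a Borel measure, where functions are known
      to have Borel versions.\<close>
    have "radon_outer_measure (frontier D) (\<Omega> D 0)"
      using system bdd_open_D zero_in_D by (auto simp: radon_harmonic_measure_system_def bdd_open_def)
    then have "\<exists>Z'\<in>sets (restrict_space borel (frontier D)). Z \<subseteq> Z' \<and> \<Omega> D 0 Z' = \<Omega> D 0 Z"
      using EZ(3) unfolding radon_outer_measure_def by blast
    then obtain Z' where Z': "Z' \<in> sets (restrict_space borel (frontier D))" "Z \<subseteq> Z'" "\<Omega> D 0 Z' = 0"
      using EZ(4) by auto
    have Z'': "Z' \<in> sets borel" "Z' \<subseteq> frontier D"
      using Z'(1) by (auto simp: sets_restrict_space_iff)
    have "Z' \<in> null_sets B"
      using Z'' Z'(3) emeasure_M[OF D0 Z''] id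
      by (auto simp: B_def emeasure_distr Int_absorb2 intro!: null_setsI)
    then have "Z \<in> sets (completion B)" using Z'(2) by (rule sets_completionI_sub)
    moreover have "E \<in> sets (completion B)" "- frontier D \<in> sets (completion B)"
      using E by (auto simp: B_def)
    ultimately have "sym_diff E Z \<union> (if 0 \<in> S then - frontier D else {}) \<in> sets (completion B)" by auto
    moreover have "F0 -` S \<inter> space (completion B) = (F -` S \<inter> frontier D) \<union> (if 0 \<in> S then - frontier D else {})"
      by (auto simp: F0_def B_def split: if_splits)
    ultimately show "F0 -` S \<inter> space (completion B) \<in> sets (completion B)" using EZ(1) by simp
  qed simp
  then obtain g where g: "g \<in> borel_measurable B" "AE z in B. F0 z = g z"
    using completion_ex_borel_measurable_real by blast
  obtain A where A: "A \<in> null_sets B" "{z \<in> space B. F0 z \<noteq> g z} \<subseteq> A"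
    using g(2) by (auto simp: eventually_ae_filter)
  have "AE z in M D 0. F z = g z"
  proof (rule AE_I'[OF B_null[OF A(1)]])
    show "{z \<in> space (M D 0). F z \<noteq> g z} \<subseteq> A \<inter> frontier D" using A(2) by (auto simp: F0_def B_def)
  qed
  moreover have "g \<in> borel_measurable borel" using g(1) by (simp add: B_def)
  ultimately show ?thesis using that by blast
qed

text \<open>A Borel version of the absolute value of \<open>F\<close> is truncated at height
  \<open>n\<close>, and Fatou's lemma passes to the limit. Measurability in \<open>\<nu>\<close> is
  thus needed only for extensions of the truncations.\<close>

lemma strong_type:
  assumes \<nu>: "\<And>A. A \<in> sets borel \<Longrightarrow> A \<subseteq> D \<Longrightarrow> A \<in> sets \<nu>" and space_\<nu>: "space \<nu> = D"
    and M0: "M0 \<ge> 0"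
    and carleson: "\<And>P r. P \<in> frontier D \<Longrightarrow> r > 0 \<Longrightarrow>
      emeasure \<nu> (D \<inter> cball P r) \<le> ennreal (M0 * H D (indicator (\<Delta> P r)) 0)"
    and p: "p > 1"
  obtains K where "K > 0"
    "\<And>F. F \<in> borel_measurable (M D 0) \<Longrightarrow>
       (\<integral>\<^sup>+x. ennreal (\<bar>hm_integral D (\<Omega> D) F x\<bar> powr p) \<partial>\<nu>)
         \<le> ennreal K * (\<integral>\<^sup>+z. ennreal (\<bar>F z\<bar> powr p) \<partial>M D 0)"
proof -
  obtain K where K: "K > 0"
    "\<And>f. bounded_borel f \<Longrightarrow> (\<And>z. 0 \<le> f z) \<Longrightarrow>
       (\<integral>\<^sup>+x. ennreal (H D f x powr p) \<partial>\<nu>) \<le> ennreal K * (\<integral>\<^sup>+z. ennreal (f z powr p) \<partial>M D 0)"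
    using strong_type_bounded[OF \<nu> space_\<nu> M0 carleson p] by blast
  show ?thesis
  proof (rule that[OF K(1)])
    fix F :: "'a \<Rightarrow> real" assume F: "F \<in> borel_measurable (M D 0)"
    obtain g' where g': "g' \<in> borel_measurable borel" "AE z in M D 0. F z = g' z"
      using borel_version[OF F] by blast
    define g where "g z = \<bar>g' z\<bar>" for z
    have g: "g \<in> borel_measurable borel" unfolding g_def using g'(1) by measurable
    have AE: "AE z in M D x. \<bar>F z\<bar> = g z" if "x \<in> D" for x
    proof -
      \<comment> \<open>A null set seen from 0 is a null set seen from every point of the connected
        set \<open>D\<close>.\<close>
      have "AE z in M D x. F z = g' z"
        using absolutely_continuous_M[OF bdd_open_D connected_D that zero_in_D] g'(2)
          sets_M[OF bdd_open_D that] sets_M[OF bdd_open_D zero_in_D]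
        by (intro absolutely_continuous_AE[of "M D x" "M D 0"]) auto
      then show ?thesis by eventually_elim (simp add: g_def)
    qed
    define G where "G n z = min (g z) (real n)" for n z
    have G0: "0 \<le> G n z" for n z by (simp add: G_def g_def)
    have Gb: "bounded_borel (G n)" for n
      unfolding bounded_borel_def
    proof (intro conjI exI allI)
      show "G n \<in> borel_measurable borel" unfolding G_def using g by measurable
      show "\<bar>G n z\<bar> \<le> real n" for z using G0[of n z] by (simp add: G_def)
    qed
    have point: "ennreal (\<bar>hm_integral D (\<Omega> D) F x\<bar> powr p) \<le> liminf (\<lambda>n. ennreal (H D (G n) x powr p))"
      if x: "x \<in> D" for x
    proof (cases "integrable (M D x) F")
      \<comment> \<open>The Bochner integral of a function that is not integrable is 0 by default,
        and the pointwise bound is trivial.\<close>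
      case False
      then have "hm_integral D (\<Omega> D) F x = 0"
        using not_frontier[OF bdd_open_D x] by (simp add: hm_integral_def not_integrable_integral_eq)
      then show ?thesis by simp
    next
      case True
      note gm = measurable_M[OF bdd_open_D x g]
      have ig: "integrable (M D x) g"
        using integrable_cong_AE[OF _ gm AE[OF x]] integrable_abs[OF True] True by auto
      have "(\<lambda>n. \<integral>z. G n z \<partial>M D x) \<longlonglongrightarrow> (\<integral>z. g z \<partial>M D x)"
      proof (rule integral_dominated_convergence[where w=g])
        show "AE z in M D x. (\<lambda>n. G n z) \<longlonglongrightarrow> g z"
        proof (rule AE_I2)
          fix z
          obtain m :: nat where "g z \<le> real m" using real_arch_simple by blast
          then have "\<forall>\<^sub>F n in sequentially. G n z = g z"
            by (intro eventually_sequentiallyI[of m]) (simp add: G_def)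
          then show "(\<lambda>n. G n z) \<longlonglongrightarrow> g z" by (rule tendsto_eventually)
        qed
        show "AE z in M D x. norm (G n z) \<le> g z" for n
          using G0 by (intro AE_I2) (simp add: G_def)
        show "G n \<in> borel_measurable (M D x)" for n
          using Gb by (intro measurable_M[OF bdd_open_D x]) (simp add: bounded_borel_def)
      qed (use ig gm in auto)
      then have "(\<lambda>n. H D (G n) x) \<longlonglongrightarrow> (\<integral>z. g z \<partial>M D x)" by (simp add: H_inside[OF bdd_open_D x])
      then have "(\<lambda>n. H D (G n) x powr p) \<longlonglongrightarrow> (\<integral>z. g z \<partial>M D x) powr p"
        using p G0 by (intro tendsto_powr') (auto intro!: always_eventually H_nonneg)
      then have lim: "liminf (\<lambda>n. ennreal (H D (G n) x powr p)) = ennreal ((\<integral>z. g z \<partial>M D x) powr p)"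
        by (intro lim_imp_Liminf) auto
      have "\<bar>hm_integral D (\<Omega> D) F x\<bar> \<le> (\<integral>z. \<bar>F z\<bar> \<partial>M D x)"
        using not_frontier[OF bdd_open_D x] integral_abs_bound[of "M D x" F] by (simp add: hm_integral_def)
      also have "\<dots> = (\<integral>z. g z \<partial>M D x)"
        using AE[OF x] gm True by (intro integral_cong_AE) auto
      finally show ?thesis unfolding lim using p by (intro ennreal_leI powr_mono2) auto
    qed
    have "(\<integral>\<^sup>+x. ennreal (\<bar>hm_integral D (\<Omega> D) F x\<bar> powr p) \<partial>\<nu>)
        \<le> (\<integral>\<^sup>+x. liminf (\<lambda>n. ennreal (H D (G n) x powr p)) \<partial>\<nu>)"
      by (intro nn_integral_mono point) (simp add: space_\<nu>)
    also have "\<dots> \<le> liminf (\<lambda>n. \<integral>\<^sup>+x. ennreal (H D (G n) x powr p) \<partial>\<nu>)"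
    proof (rule nn_integral_liminf)
      fix n
      have ub: "(\<lambda>x. ennreal (H D (G n) x powr p)) \<in> borel_measurable borel"
        using bounded_borel_H[OF bdd_open_D Gb, of n] by (auto simp: bounded_borel_def)
      show "(\<lambda>x. ennreal (H D (G n) x powr p)) \<in> borel_measurable \<nu>"
      proof (rule measurableI)
        fix A :: "ennreal set" assume "A \<in> sets borel"
        then have "(\<lambda>x. ennreal (H D (G n) x powr p)) -` A \<in> sets borel" using measurable_sets[OF ub] by simp
        then show "(\<lambda>x. ennreal (H D (G n) x powr p)) -` A \<inter> space \<nu> \<in> sets \<nu>"
          unfolding space_\<nu> using open_D by (intro \<nu>) auto
      qed auto
    qed
    also have "\<dots> \<le> ennreal K * (\<integral>\<^sup>+z. ennreal (\<bar>F z\<bar> powr p) \<partial>M D 0)"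
    proof (rule order_trans[OF Liminf_le_Limsup Limsup_bounded])
      have "(\<integral>\<^sup>+x. ennreal (H D (G n) x powr p) \<partial>\<nu>)
          \<le> ennreal K * (\<integral>\<^sup>+z. ennreal (\<bar>F z\<bar> powr p) \<partial>M D 0)" for n
      proof -
        have "(\<integral>\<^sup>+x. ennreal (H D (G n) x powr p) \<partial>\<nu>) \<le> ennreal K * (\<integral>\<^sup>+z. ennreal (G n z powr p) \<partial>M D 0)"
          by (intro K(2) Gb G0)
        also have "\<dots> \<le> ennreal K * (\<integral>\<^sup>+z. ennreal (\<bar>F z\<bar> powr p) \<partial>M D 0)"
        proof (intro mult_left_mono nn_integral_mono_AE)
          show "AE z in M D 0. ennreal (G n z powr p) \<le> ennreal (\<bar>F z\<bar> powr p)"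
            using AE[OF zero_in_D]
            by eventually_elim (use p G0 in \<open>auto intro!: ennreal_leI powr_mono2 simp: G_def\<close>)
        qed simp
        finally show ?thesis .
      qed
      then show "\<forall>\<^sub>F n in sequentially. (\<integral>\<^sup>+x. ennreal (H D (G n) x powr p) \<partial>\<nu>)
          \<le> ennreal K * (\<integral>\<^sup>+z. ennreal (\<bar>F z\<bar> powr p) \<partial>M D 0)" by simp
    qed simp
    finally show "(\<integral>\<^sup>+x. ennreal (\<bar>hm_integral D (\<Omega> D) F x\<bar> powr p) \<partial>\<nu>)
        \<le> ennreal K * (\<integral>\<^sup>+z. ennreal (\<bar>F z\<bar> powr p) \<partial>M D 0)" .
  qed
qed

section \<open>Carleson measures\<close>

lemma doubling_iterated:
  obtains C where "C \<ge> 1"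
    "\<And>P r. P \<in> frontier D \<Longrightarrow> r > 0 \<Longrightarrow> \<Omega> D 0 (\<Delta> P (A * r)) \<le> ennreal C * \<Omega> D 0 (\<Delta> P r)"
proof -
  obtain C where C: "C \<ge> 1"
    "\<And>P r. P \<in> frontier D \<Longrightarrow> r > 0 \<Longrightarrow> H D (indicator (\<Delta> P (2 * r))) 0 \<le> C * H D (indicator (\<Delta> P r)) 0"
    using doubling unfolding \<Delta>_def by blast
  obtain n where n: "A < 2 ^ n" using real_arch_pow[of 2 A] by auto
  have iter: "H D (indicator (\<Delta> P (2 ^ k * r))) 0 \<le> C ^ k * H D (indicator (\<Delta> P r)) 0"
    if "P \<in> frontier D" "r > 0" for P r k
  proof (induction k)
    case (Suc k)
    have "H D (indicator (\<Delta> P (2 ^ Suc k * r))) 0 \<le> C * H D (indicator (\<Delta> P (2 ^ k * r))) 0"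
      using C(2)[OF that(1), of "2 ^ k * r"] that(2) by (simp add: mult.assoc)
    also have "\<dots> \<le> C * (C ^ k * H D (indicator (\<Delta> P r)) 0)" using Suc C(1) by (intro mult_left_mono) auto
    finally show ?case by (simp add: mult.assoc)
  qed simp
  have eq: "\<Omega> D 0 (\<Delta> P r) = ennreal (H D (indicator (\<Delta> P r)) 0)" for P r
    by (intro outer_eq_H bdd_open_D zero_in_D) (auto simp: \<Delta>_def)
  show ?thesis
  proof (rule that[of "C ^ n"])
    fix P :: 'a and r :: real assume P: "P \<in> frontier D" and r: "r > 0"
    have "H D (indicator (\<Delta> P (A * r))) 0 \<le> H D (indicator (\<Delta> P (2 ^ n * r))) 0"
    proof (rule H_mono[OF bdd_open_D _ _ zero_in_D])
      have "A * r \<le> 2 ^ n * r" using n r by (intro mult_right_mono) auto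
      then show "indicat_real (\<Delta> P (A * r)) y \<le> indicator (\<Delta> P (2 ^ n * r)) y" for y
        by (auto simp: \<Delta>_def indicator_def)
    qed auto
    also have "\<dots> \<le> C ^ n * H D (indicator (\<Delta> P r)) 0" by (rule iter[OF P r])
    finally show "\<Omega> D 0 (\<Delta> P (A * r)) \<le> ennreal (C ^ n) * \<Omega> D 0 (\<Delta> P r)"
      using C(1) unfolding eq by (simp add: ennreal_mult'[symmetric] ennreal_leI)
  qed (use C in auto)
qed

lemma outer_mono:
  assumes "A \<subseteq> B" "B \<subseteq> frontier D" shows "\<Omega> D 0 A \<le> \<Omega> D 0 B"
  using borel_outer_measure[OF bdd_open_D zero_in_D] assms
  by (auto simp: borel_outer_measure_def outer_measure_space_def increasing_def)

end

text \<open>With the next lemma: a cylinder lies between concentric balls of comparable radii, so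
  that doubling allows balls to replace cylinders in the Carleson condition.\<close>

lemma cylinder_subset_cball:
  assumes "s > 0" "P \<noteq> P0" shows "cylinder P0 s P r \<subseteq> cball P ((1 + s / 2) * r)"
proof
  fix x assume "x \<in> cylinder P0 s P r"
  then obtain w t where x: "x = P + w + t *\<^sub>R sgn (P0 - P)" "norm w < r" "\<bar>t\<bar> < s * r / 2"
    by (auto simp: cylinder_def)
  have "norm (w + t *\<^sub>R sgn (P0 - P)) \<le> norm w + \<bar>t\<bar>"
    using norm_triangle_ineq[of w "t *\<^sub>R sgn (P0 - P)"] assms(2) by (simp add: norm_sgn)
  also have "\<dots> \<le> (1 + s / 2) * r" using x by (simp add: algebra_simps)
  finally have "norm (w + t *\<^sub>R sgn (P0 - P)) \<le> (1 + s / 2) * r" .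
  moreover have "x - P = w + t *\<^sub>R sgn (P0 - P)" by (simp add: x)
  ultimately have "dist x P \<le> (1 + s / 2) * r" by (simp only: dist_norm)
  then show "x \<in> cball P ((1 + s / 2) * r)" by (simp add: dist_commute)
qed

lemma cball_subset_cylinder:
  assumes "P \<noteq> P0" "\<rho> < r" "\<rho> < s * r / 2" shows "cball P \<rho> \<subseteq> cylinder P0 s P r"
proof
  fix x assume "x \<in> cball P \<rho>"
  then have x: "norm (x - P) \<le> \<rho>" by (simp add: dist_norm norm_minus_commute)
  define e where "e = sgn (P0 - P)"
  have e: "norm e = 1" "e \<bullet> e = 1" "P0 - P = norm (P0 - P) *\<^sub>R e"
    using assms(1) by (auto simp: e_def norm_sgn dot_square_norm sgn_div_norm)
  define t where "t = (x - P) \<bullet> e"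
  define w where "w = (x - P) - t *\<^sub>R e"
  have we: "w \<bullet> e = 0" by (simp add: w_def t_def inner_diff_left e(2))
  then have w0: "w \<bullet> (P0 - P) = 0" by (subst e(3)) simp
  have "(norm (x - P))\<^sup>2 = (norm w)\<^sup>2 + t\<^sup>2"
  proof -
    have "x - P = w + t *\<^sub>R e" by (simp add: w_def)
    then show ?thesis
      using we e(2) unfolding power2_norm_eq_inner
      by (simp add: inner_add_left inner_add_right inner_commute[of e w] power2_eq_square)
  qed
  then have "(norm w)\<^sup>2 \<le> (norm (x - P))\<^sup>2" "t\<^sup>2 \<le> (norm (x - P))\<^sup>2" by auto
  then have "norm w \<le> norm (x - P)" "\<bar>t\<bar> \<le> norm (x - P)"
    by (auto intro: power2_le_imp_le simp: abs_le_square_iff[symmetric])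
  then have "norm w < r" "\<bar>t\<bar> < s * r / 2" using x assms by auto
  moreover have "x = P + w + t *\<^sub>R sgn (P0 - P)" by (simp add: w_def e_def)
  ultimately show "x \<in> cylinder P0 s P r" unfolding cylinder_def using w0 by blast
qed

context starlike_harmonic_system begin

theorem carleson_iff_strongly_pp:
  assumes s: "s > 0" and \<mu>: "borel_outer_measure D \<mu>" and p: "p > 1"
  shows "carleson_measure D (\<Omega> D) 0 s \<mu> \<longleftrightarrow> strongly_pp D (\<Omega> D) 0 p \<mu>"
proof -
  define \<nu> where "\<nu> = caratheodory_measure D \<mu>"
  \<comment> \<open>Radii, in units of \<open>r\<close>, of a ball containing the cylinder and of
    one inside it; the latter is kept strictly below both the radius and the half height.\<close>
  define A where "A = 1 + s / 2"
  define a where "a = min (1/2) (s/4)"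
  have A: "A > 0" "1 \<le> A" using s by (auto simp: A_def)
  have a: "0 < a" "a < 1" "a < s / 2" using s by (auto simp: a_def)
  have sets_\<nu>: "B \<in> sets \<nu>" if "B \<in> sets borel" "B \<subseteq> D" for B
    using \<mu> that unfolding \<nu>_def sets_caratheodory_measure[OF \<mu>] borel_outer_measure_def
    by (auto simp: sets_restrict_space_iff open_D)
  have em: "emeasure \<nu> B = \<mu> B" if "B \<in> sets borel" "B \<subseteq> D" for B
    using sets_\<nu>[OF that] emeasure_caratheodory_measure[OF \<mu>]
    unfolding \<nu>_def sets_caratheodory_measure[OF \<mu>] by blast
  have space_\<nu>: "space \<nu> = D"
    by (simp add: \<nu>_def caratheodory_measure_def space_measure_of_conv)
  have \<mu>_mono: "\<mu> B \<le> \<mu> B'" if "B \<subseteq> B'" "B' \<subseteq> D" for B B'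
    using \<mu> that by (auto simp: borel_outer_measure_def outer_measure_space_def increasing_def)
  have P0: "P \<noteq> 0" if "P \<in> frontier D" for P
    using that not_frontier[OF bdd_open_D zero_in_D] by auto
  have cyl_sub: "cylinder 0 s P r \<subseteq> cball P (A * r)" if "P \<in> frontier D" for P r
    unfolding A_def using s P0[OF that] by (rule cylinder_subset_cball)
  have sub_cyl: "cball P (a * r) \<subseteq> cylinder 0 s P r" if "P \<in> frontier D" "r > 0" for P r
    using a that P0[OF that(1)] by (intro cball_subset_cylinder) auto
  have ball_sets: "D \<inter> cball P r \<in> sets borel" for P r using open_D by auto
  have eq: "\<Omega> D 0 (\<Delta> P r) = ennreal (H D (indicator (\<Delta> P r)) 0)" for P r
    by (intro outer_eq_H bdd_open_D zero_in_D) (auto simp: \<Delta>_def)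
  show ?thesis
  proof
    assume "carleson_measure D (\<Omega> D) 0 s \<mu>"
    then obtain M1 where M1: "M1 > 0" "\<And>P r. P \<in> frontier D \<Longrightarrow> r > 0 \<Longrightarrow>
        \<mu> (cylinder 0 s P r \<inter> D) \<le> ennreal M1 * \<Omega> D 0 (cylinder 0 s P r \<inter> frontier D)"
      by (auto simp: carleson_measure_def)
    obtain C where C: "C \<ge> 1" "\<And>P r. P \<in> frontier D \<Longrightarrow> r > 0 \<Longrightarrow>
        \<Omega> D 0 (\<Delta> P (A / a * r)) \<le> ennreal C * \<Omega> D 0 (\<Delta> P r)"
      using doubling_iterated by metis
    have "M1 * C \<ge> 0" using M1 C by simp
    have carleson: "emeasure \<nu> (D \<inter> cball P r) \<le> ennreal (M1 * C * H D (indicator (\<Delta> P r)) 0)"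
      if P: "P \<in> frontier D" and r: "r > 0" for P r
    proof -
      \<comment> \<open>The cylinder of radius \<open>r / a\<close> contains the ball of radius
        \<open>r\<close> and lies in the ball of radius \<open>A / a * r\<close>, which doubling
        brings back to \<open>r\<close>.\<close>
      have r': "r / a > 0" "a * (r / a) = r" using r a by auto
      have "emeasure \<nu> (D \<inter> cball P r) = \<mu> (D \<inter> cball P r)" by (intro em ball_sets) auto
      also have "\<dots> \<le> \<mu> (cylinder 0 s P (r / a) \<inter> D)"
        using sub_cyl[OF P r'(1)] unfolding r'(2) by (intro \<mu>_mono) auto
      also have "\<dots> \<le> ennreal M1 * \<Omega> D 0 (cylinder 0 s P (r / a) \<inter> frontier D)"
        by (intro M1(2) P r')
      also have "\<dots> \<le> ennreal M1 * \<Omega> D 0 (\<Delta> P (A / a * r))"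
        using cyl_sub[OF P, of "r / a"] by (intro mult_left_mono outer_mono) (auto simp: \<Delta>_def)
      also have "\<dots> \<le> ennreal M1 * (ennreal C * \<Omega> D 0 (\<Delta> P r))" by (intro mult_left_mono C P r) simp
      also have "\<dots> = ennreal (M1 * C * H D (indicator (\<Delta> P r)) 0)"
        using M1 C unfolding eq by (simp add: ennreal_mult' mult.assoc)
      finally show ?thesis .
    qed
    obtain K where K: "K > 0" "\<And>F. F \<in> borel_measurable (M D 0) \<Longrightarrow>
       (\<integral>\<^sup>+x. ennreal (\<bar>hm_integral D (\<Omega> D) F x\<bar> powr p) \<partial>\<nu>)
         \<le> ennreal K * (\<integral>\<^sup>+z. ennreal (\<bar>F z\<bar> powr p) \<partial>M D 0)"
      using strong_type[OF sets_\<nu> space_\<nu> \<open>M1 * C \<ge> 0\<close> carleson p] by blast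
    then show "strongly_pp D (\<Omega> D) 0 p \<mu>"
      unfolding strongly_pp_def Lp_functions_def \<nu>_def by blast
  next
    assume "strongly_pp D (\<Omega> D) 0 p \<mu>"
    then obtain K where K: "K > 0" "\<And>F. F \<in> Lp_functions p (M D 0) \<Longrightarrow>
        (\<integral>\<^sup>+x. ennreal (\<bar>hm_integral D (\<Omega> D) F x\<bar> powr p) \<partial>\<nu>)
          \<le> ennreal K * (\<integral>\<^sup>+z. ennreal (\<bar>F z\<bar> powr p) \<partial>M D 0)"
      by (auto simp: strongly_pp_def \<nu>_def)
    obtain c where c: "c > 0" "\<And>P r x. P \<in> frontier D \<Longrightarrow> r > 0 \<Longrightarrow> x \<in> D \<Longrightarrow> dist x P \<le> r / 8 \<Longrightarrow>
        c \<le> H D (indicator (\<Delta> P r)) x"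
      using nondegenerate_near unfolding \<Delta>_def by blast
    obtain C where C: "C \<ge> 1" "\<And>P r. P \<in> frontier D \<Longrightarrow> r > 0 \<Longrightarrow>
        \<Omega> D 0 (\<Delta> P (8 * A / a * r)) \<le> ennreal C * \<Omega> D 0 (\<Delta> P r)"
      using doubling_iterated by metis
    have "\<mu> (cylinder 0 s P r \<inter> D) \<le> ennreal (K * C / c powr p) * \<Omega> D 0 (cylinder 0 s P r \<inter> frontier D)"
      if P: "P \<in> frontier D" and r: "r > 0" for P r
    proof -
      \<comment> \<open>With the factor 8, \<open>nondegenerate_near\<close> bounds the extension of
        the indicator of \<open>B\<close> below by \<open>c\<close> on all of \<open>?E\<close>,
        which contains the part of the cylinder in \<open>D\<close>.\<close>
      define B where "B = \<Delta> P (8 * A * r)"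
      let ?F = "indicat_real B" and ?E = "D \<inter> cball P (A * r)"
      have B: "B \<in> sets borel" "B \<subseteq> frontier D" by (auto simp: B_def \<Delta>_def)
      have Fp: "\<bar>?F z\<bar> powr p = ?F z" for z using p by (simp add: indicator_def)
      have F: "?F \<in> Lp_functions p (M D 0)"
        unfolding Lp_functions_def mem_Collect_eq Fp
        using integrable_M[OF bdd_open_D zero_in_D bounded_borel_indicator[OF B(1)]]
        by (blast intro: borel_measurable_integrable)
      have low: "ennreal (c powr p) * indicator ?E x \<le> ennreal (\<bar>hm_integral D (\<Omega> D) ?F x\<bar> powr p)"
        if "x \<in> D" for x
      proof (cases "x \<in> ?E")
        case True
        then have "c \<le> H D ?F x" unfolding B_def using P r A by (intro c(2)) (auto simp: dist_commute)
        moreover have "H D ?F x = hm_integral D (\<Omega> D) ?F x"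
          using that closure_subset[of D] by (auto simp: H_def)
        ultimately show ?thesis using c(1) p True by (auto intro!: ennreal_leI powr_mono2)
      qed simp
      have "ennreal (c powr p) * \<mu> (cylinder 0 s P r \<inter> D) \<le> ennreal (c powr p) * \<mu> ?E"
        using cyl_sub[OF P, of r] by (intro mult_left_mono \<mu>_mono) auto
      also have "\<dots> = ennreal (c powr p) * emeasure \<nu> ?E" by (subst em) (auto simp: ball_sets)
      also have "\<dots> = (\<integral>\<^sup>+x. ennreal (c powr p) * indicator ?E x \<partial>\<nu>)"
        by (intro nn_integral_cmult_indicator[symmetric] sets_\<nu> ball_sets) auto
      also have "\<dots> \<le> (\<integral>\<^sup>+x. ennreal (\<bar>hm_integral D (\<Omega> D) ?F x\<bar> powr p) \<partial>\<nu>)"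
        by (intro nn_integral_mono low) (simp add: space_\<nu>)
      also have "\<dots> \<le> ennreal K * (\<integral>\<^sup>+z. ennreal (\<bar>?F z\<bar> powr p) \<partial>M D 0)" by (rule K(2)[OF F])
      also have "(\<integral>\<^sup>+z. ennreal (\<bar>?F z\<bar> powr p) \<partial>M D 0) = \<Omega> D 0 B"
        unfolding Fp using emeasure_M[OF bdd_open_D zero_in_D B] borel_hm_sets[OF bdd_open_D B]
          sets_M[OF bdd_open_D zero_in_D] by (simp add: ennreal_indicator)
      also have "\<dots> \<le> ennreal C * \<Omega> D 0 (\<Delta> P (a * r))"
        using C(2)[OF P, of "a * r"] a r by (simp add: B_def mult.assoc)
      also have "\<Omega> D 0 (\<Delta> P (a * r)) \<le> \<Omega> D 0 (cylinder 0 s P r \<inter> frontier D)"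
        using sub_cyl[OF P r] by (intro outer_mono) (auto simp: \<Delta>_def)
      finally have le: "ennreal (c powr p) * \<mu> (cylinder 0 s P r \<inter> D)
          \<le> ennreal K * (ennreal C * \<Omega> D 0 (cylinder 0 s P r \<inter> frontier D))"
        by (simp add: mult_left_mono)
      have "\<mu> (cylinder 0 s P r \<inter> D) = ennreal (1 / c powr p) * (ennreal (c powr p) * \<mu> (cylinder 0 s P r \<inter> D))"
        using c(1) by (simp add: mult.assoc[symmetric] ennreal_mult'[symmetric])
      also have "\<dots> \<le> ennreal (1 / c powr p) * (ennreal K * (ennreal C * \<Omega> D 0 (cylinder 0 s P r \<inter> frontier D)))"
        using le by (rule mult_left_mono) simp
      also have "\<dots> = ennreal (K * C / c powr p) * \<Omega> D 0 (cylinder 0 s P r \<inter> frontier D)"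
        using K(1) C(1) by (simp add: mult.assoc[symmetric] ennreal_mult'[symmetric])
      finally show ?thesis .
    qed
    moreover have "K * C / c powr p > 0" using K C c by simp
    ultimately show "carleson_measure D (\<Omega> D) 0 s \<mu>" unfolding carleson_measure_def by blast
  qed
qed

end

theorem theorem4p1:
  fixes \<D> :: "(real ^ 'n) set set"
    and \<Omega> :: "(real ^ 'n) set \<Rightarrow> real ^ 'n \<Rightarrow> (real ^ 'n) set \<Rightarrow> ennreal"
    and D :: "(real ^ 'n) set"
    and \<mu> :: "(real ^ 'n) set \<Rightarrow> ennreal"
    and s p :: real
  assumes dim: "CARD('n) \<ge> 3"
    and system: "radon_harmonic_measure_system \<D> \<Omega>"
    and H1: "\<D> = {U. open U \<and> bounded U \<and> U \<noteq> {}}"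
    and H2: "\<And>U. lipschitz_domain U \<Longrightarrow> bounded U \<Longrightarrow> regular_domain U (\<Omega> U)"
    and H3: "TSCI \<D> \<Omega>"
    and H4: "\<And>U. open U \<Longrightarrow> bounded U \<Longrightarrow> U \<noteq> {} \<Longrightarrow> continuous_RN_derivs U (\<Omega> U)"
    and D: "bounded D" "0 \<in> D" "starlike_lipschitz_domain 0 D"
    and s: "admissible_height 0 D s"
    and \<mu>: "borel_outer_measure D \<mu>"
    and p: "p > 1"
  shows "carleson_measure D (\<Omega> D) 0 s \<mu> \<longleftrightarrow> strongly_pp D (\<Omega> D) 0 p \<mu>"
proof -
  obtain N \<Lambda> b where "starlike_gauge D N \<Lambda> b" using starlike_gauge_exists[OF D] by blast
  moreover have "harmonic_system \<Omega>"
    using system H2 H3 H4 dim unfolding H1 by unfold_locales auto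
  ultimately interpret starlike_harmonic_system \<Omega> D N \<Lambda> b
    by (simp add: starlike_harmonic_system_def)
  show ?thesis using s by (intro carleson_iff_strongly_pp \<mu> p) (simp add: admissible_height_def)
qed

end
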